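(* Let $n\ge2$, $\gamma>0$, $r\in(0,\infty)$, and let $Z_0$ be the zero cell of the Poisson hyperplane process in $\mathbb{R}^n$ with intensity $\gamma$ and distance exponent $r$. Define \[ D(n,r) = \frac{n\kappa_n^2}{r}\, \Gamma\left(\frac{2n}{r}+1\right)\left(\frac{n\kappa_n r}{4\gamma c(n,r)}\right)^{\frac{2n}{r}} \] and \[ E(n,r) = \frac{n}{c(2,n-2)} \int_0^\pi (\sin\varphi)^{n-2} \int_0^1 t^{n-1}\left( 1+t^r-F_r(t,\varphi) \right) dt\,d\varphi . \] Then \[ E(n,r)\,D(n,r) \;\leq\; \operatorname{Var}[V_n(Z_0)]\; \leq \; E(n,r)\, D(n,r)\,4^{\frac{2n}{r}+1}. \]
   Context: $V_n$ denotes $n$-dimensional volume, $S^{n-1}$ the unit sphere of $\mathbb{R}^n$, $\mathcal{H}^{n-1}$ the $(n-1)$-dimensional Hausdorff measure, $\kappa_n=\pi^{n/2}/\Gamma(\frac n2+1)$ the volume of the unit ball of $\mathbb{R}^n$. For $u\in S^{n-1}$, $t\ge 0$ let $H(u,t)=\{x\in\mathbb{R}^n:\langle x,u\rangle=t\}$. $A(n,n-1)$ is the space of affine hyperplanes of $\mathbb{R}^n$ with its standard topology and Borel $\sigma$-algebra. The Poisson hyperplane process $X$ in $\mathbb{R}^n$ with intensity $\gamma>0$ and distance exponent $r>0$ is the Poisson point process on $A(n,n-1)$ whose intensity measure $\Theta(\cdot)=\mathbb{E}X(\cdot)$ is \[ \Theta(\cdot)=\frac{2\gamma}{n\kappa_n}\int_{S^{n-1}}\int_0^\infty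 \mathbf{1}\{H(u,t)\in\cdot\}\,t^{r-1}\,dt\,\mathcal{H}^{n-1}(du). \] The zero cell is $Z_0=\bigcap_{H\in X}H^-$, where $H^-$ is the (almost surely unique) closed half-space bounded by $H$ that contains the origin. For $m\ge2$, $s>0$ and any unit vector $e\in S^{m-1}$, \[ c(m,s)=\int_{S^{m-1}}\langle e,u\rangle_+^s\,\mathcal{H}^{m-1}(du)=\pi^{\frac{m-1}{2}}\frac{\Gamma(\frac{s+1}{2})}{\Gamma(\frac{s+m}{2})}, \] which does not depend on $e$, where $x_+=\max\{x,0\}$; for $s=0$, $c(m,0)$ is given by the Gamma-function expression, so that $c(2,0)=\pi$. For $(t,\varphi)\in[0,1]\times(0,\pi)$, \[ \alpha(t,\varphi)=\arctan\left(\frac{t-\cos\varphi}{\sin\varphi}\right)\in\left(-\frac\pi2,\frac\pi2\right), \] \[ F_r(t,\varphi)=\frac{1}{c(2,r)}\left(t^r\int_{-\frac\pi2}^{\alpha(t,\varphi)}(\cos\theta)^r\,d\theta+\int_{\alpha(t,\varphi)-\varphi}^{\frac\pi2}(\cos\theta)^r\,d\theta\right). \] *)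

theory Defs
  imports "HOL-Probability.Probability"
begin

section \<open>Hausdorff measure\<close>

text \<open>The normalisation is the usual one, under which the \<open>d\<close>-dimensional Hausdorff measure of a
  \<open>d\<close>-dimensional Euclidean space is Lebesgue measure. \<^const>\<open>diameter\<close> is only meaningful on
  bounded sets. Empty sets in a cover are free of charge also for \<open>d = 0\<close>.\<close>

definition hausdorff_weight :: "nat \<Rightarrow> 'a::metric_space set \<Rightarrow> ennreal" where
  "hausdorff_weight d U =
     (if U = {} then 0 else ennreal (unit_ball_vol (real d) * (diameter U / 2) ^ d))"

definition hausdorff_premeasure :: "real \<Rightarrow> nat \<Rightarrow> 'a::metric_space set \<Rightarrow> ennreal" where
  "hausdorff_premeasure \<delta> d A =
     (INF U \<in> {U :: nat \<Rightarrow> 'a set. A \<subseteq> (\<Union>i. U i) \<and> (\<forall>i. bounded (U i) \<and> diameter (U i) \<le> \<delta>)}.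
        \<Sum>i. hausdorff_weight d (U i))"

definition hausdorff_measure :: "nat \<Rightarrow> 'a::metric_space measure" where
  "hausdorff_measure d =
     measure_of UNIV (sets borel) (\<lambda>A. SUP \<delta> \<in> {0<..}. hausdorff_premeasure \<delta> d A)"

definition sphere_measure :: "'a::euclidean_space measure" where
  "sphere_measure = restrict_space (hausdorff_measure (DIM('a) - 1)) (sphere 0 1)"

section \<open>The space of affine hyperplanes\<close>

definition hyperplane :: "'a::euclidean_space \<Rightarrow> real \<Rightarrow> 'a set" where
  "hyperplane u t = {x. x \<bullet> u = t}"

definition hyperplanes :: "'a::euclidean_space set set" where
  "hyperplanes = {hyperplane u t |u t. u \<in> sphere 0 1}"

text \<open>The standard topology on the space of hyperplanes is the quotient topology of
  \<open>S\<^sup>n\<^sup>-\<^sup>1 \<times> \<real>\<close> under \<open>(u, t) \<mapsto> H(u, t)\<close>, a two-to-one map.\<close>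

definition hyperplane_open :: "'a::euclidean_space set set \<Rightarrow> bool" where
  "hyperplane_open W \<longleftrightarrow> W \<subseteq> hyperplanes \<and>
     openin (top_of_set (sphere 0 1 \<times> UNIV)) {(u, t). u \<in> sphere 0 1 \<and> hyperplane u t \<in> W}"

definition hyperplane_space :: "'a::euclidean_space set measure" where
  "hyperplane_space = sigma hyperplanes {W. hyperplane_open W}"

section \<open>Poisson processes\<close>

definition point_count :: "('w \<Rightarrow> 'b set) \<Rightarrow> 'b set \<Rightarrow> 'w \<Rightarrow> ennreal" where
  "point_count X A \<omega> = emeasure (count_space UNIV) (X \<omega> \<inter> A)"

text \<open>A Poisson process with intensity measure \<open>\<mu>\<close>, as a random countable set of points of the
  measurable space underlying \<open>\<mu>\<close>. (The intensity measures below have no atoms, so there are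
  almost surely no multiple points.)\<close>

definition poisson_process :: "'w measure \<Rightarrow> 'b measure \<Rightarrow> ('w \<Rightarrow> 'b set) \<Rightarrow> bool" where
  "poisson_process M \<mu> X \<longleftrightarrow>
     prob_space M \<and>
     (\<forall>\<omega> \<in> space M. X \<omega> \<subseteq> space \<mu> \<and> countable (X \<omega>)) \<and>
     (\<forall>A \<in> sets \<mu>. point_count X A \<in> borel_measurable M) \<and>
     (\<forall>A \<in> sets \<mu>. emeasure \<mu> A < \<infinity> \<longrightarrow>
        (\<forall>k::nat. measure M {\<omega> \<in> space M. point_count X A \<omega> = of_nat k} =
           exp (- measure \<mu> A) * measure \<mu> A ^ k / fact k)) \<and>
     (\<forall>A \<in> sets \<mu>. emeasure \<mu> A = \<infinity> \<longrightarrow> (AE \<omega> in M. point_count X A \<omega> = \<infinity>)) \<and>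
     (\<forall>(I :: nat set) A. finite I \<and> A ` I \<subseteq> sets \<mu> \<and> disjoint_family_on A I \<longrightarrow>
        prob_space.indep_vars M (\<lambda>_. borel) (\<lambda>i. point_count X (A i)) I)"

definition hyperplane_intensity :: "real \<Rightarrow> real \<Rightarrow> 'a::euclidean_space set measure" where
  "hyperplane_intensity \<gamma> r =
     scale_measure (ennreal (2 * \<gamma> / (real DIM('a) * unit_ball_vol (real DIM('a)))))
       (distr (sphere_measure \<Otimes>\<^sub>M
                 density lborel (\<lambda>t. ennreal (indicator {0..} t * t powr (r - 1))))
          hyperplane_space (\<lambda>(u :: 'a, t). hyperplane u t))"

definition poisson_hyperplane_process ::
    "'w measure \<Rightarrow> real \<Rightarrow> real \<Rightarrow> ('w \<Rightarrow> 'a::euclidean_space set set) \<Rightarrow> bool" where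
  "poisson_hyperplane_process M \<gamma> r X \<longleftrightarrow> poisson_process M (hyperplane_intensity \<gamma> r) X"

text \<open>If \<open>0 \<notin> H\<close>, there is exactly one closed half-space bounded by \<open>H\<close> that contains the origin.
  If \<open>0 \<in> H\<close>, which happens for some \<open>H\<close> in the process only with probability zero, there are two;
  intersecting them keeps the zero cell defined and closed for every realisation.\<close>

definition origin_halfspace :: "'a::euclidean_space set \<Rightarrow> 'a set" where
  "origin_halfspace H =
     \<Inter> {K. \<exists>u t. u \<in> sphere 0 1 \<and> H = hyperplane u t \<and> K = {x. x \<bullet> u \<le> t} \<and> 0 \<in> K}"

definition zero_cell :: "'a::euclidean_space set set \<Rightarrow> 'a set" where
  "zero_cell X = (\<Inter>H \<in> X. origin_halfspace H)"

section \<open>The constants\<close>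

text \<open>\<open>sphere_const TYPE('a) s\<close> is \<open>c(m, s)\<close> for \<open>m = DIM('a)\<close>. For \<open>s = 0\<close> it is not the integral but
  the value at \<open>s = 0\<close> of \<open>\<pi>\<^bsup>(m-1)/2\<^esup> \<Gamma>((s+1)/2) / \<Gamma>((s+m)/2)\<close>, to which the integral evaluates
  for \<open>s > 0\<close>. The integral does not depend on the unit vector \<open>e\<close>.\<close>

definition sphere_const :: "'a::euclidean_space itself \<Rightarrow> real \<Rightarrow> real" where
  "sphere_const _ s =
     (if s = 0 then pi powr ((real DIM('a) - 1) / 2) * Gamma (1 / 2) / Gamma (real DIM('a) / 2)
      else let e = (SOME e :: 'a. norm e = 1)
           in LINT u|sphere_measure. max 0 (e \<bullet> u) powr s)"

definition alpha :: "real \<Rightarrow> real \<Rightarrow> real" where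
  "alpha t \<phi> = arctan ((t - cos \<phi>) / sin \<phi>)"

definition F_fun :: "real \<Rightarrow> real \<Rightarrow> real \<Rightarrow> real" where
  "F_fun r t \<phi> = 1 / sphere_const TYPE(real^2) r *
     (t powr r * (LBINT \<theta>=- (pi / 2)..alpha t \<phi>. cos \<theta> powr r)
      + (LBINT \<theta>=alpha t \<phi> - \<phi>..pi / 2. cos \<theta> powr r))"

text \<open>\<open>D_const TYPE('a) \<gamma> r\<close> is \<open>D(n, r)\<close> for \<open>n = DIM('a)\<close>; it also depends on \<open>\<gamma>\<close>.\<close>

definition D_const :: "'a::euclidean_space itself \<Rightarrow> real \<Rightarrow> real \<Rightarrow> real" where
  "D_const _ \<gamma> r =
     (let n = real DIM('a); \<kappa> = unit_ball_vol n
      in n * \<kappa>\<^sup>2 / r * Gamma (2 * n / r + 1) *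
           (n * \<kappa> * r / (4 * \<gamma> * sphere_const TYPE('a) r)) powr (2 * n / r))"

definition E_const :: "nat \<Rightarrow> real \<Rightarrow> real" where
  "E_const n r = real n / sphere_const TYPE(real^2) (real n - 2) *
     (LBINT \<phi>=0..pi. sin \<phi> ^ (n - 2) *
        (LBINT t=0..1. t ^ (n - 1) * (1 + t powr r - F_fun r t \<phi>)))"

end

theory Submission
  imports Defs
begin

text \<open>For a point \<open>x\<close> put \<open>\<Phi> x y = \<Theta> {H. H separates 0 from x or from y}\<close>. Since
  \<open>x, y \<in> Z\<^sub>0\<close> has probability \<open>exp (- \<Phi> x y)\<close>, Fubini's theorem expresses the variance as the double
  integral of \<open>exp (- \<Phi> x y) - exp (- \<Phi> x x - \<Phi> y y)\<close>. On \<open>\<bar>y\<bar> \<le> \<bar>x\<bar>\<close> this integrand lies between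
  \<open>q x y * exp (- 2 * A * \<bar>x\<bar> powr r)\<close> and \<open>q x y * exp (- A * \<bar>x\<bar> powr r)\<close>, where
  \<open>\<Phi> x x = A * \<bar>x\<bar> powr r\<close> and \<open>q x y = \<Phi> x x + \<Phi> y y - \<Phi> x y\<close> is the measure of the hyperplanes
  separating \<open>0\<close> from both points. Averaging over the rotations in the plane spanned by \<open>x\<close> and
  \<open>y\<close> turns \<open>q\<close> into the integral over a circle that defines \<open>F\<^sub>r\<close>, and in polar coordinates both
  bounds become Gamma integrals, which differ by the factor \<open>2 powr (2 * n / r + 1)\<close>.\<close>

section \<open>Hausdorff outer measures are Borel measures\<close>

text \<open>The surface measure is a Hausdorff measure, built from covers, and its total mass in
  dimension n is never computed. The argument is arranged so that rotation invariance, finiteness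
  and positivity suffice; the exact mass is needed only on the circle, where it is
  \<open>2 * pi\<close>. Averaging over planar rotations leaves an unknown factor, the sphere
  integral of the r-th power of the length of the projection to a plane. The positive part of a
  coordinate produces the same factor, so it can be eliminated in favour of the quotient of c(n, r)
  and c(2, r). The integrals over x and y are with respect to Lebesgue measure; for functions of the
  norm and one angle, polar coordinates come from one-dimensional substitutions, and the constants
  \<kappa>_n and c(2, n-2) are linked by the volume of the unit ball. The base of the power in D is
  \<open>inverse (2 * A)\<close>: D is made from the Gamma integral that belongs to the smaller
  exponential, so the product of E and D is exactly the lower estimate.\<close>

definition hausdorff_outer :: "nat \<Rightarrow> 'a::metric_space set \<Rightarrow> ennreal" where
  "hausdorff_outer d A = (SUP \<delta> \<in> {0<..}. hausdorff_premeasure \<delta> d A)"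

lemma hausdorff_weight_empty [simp]: "hausdorff_weight d {} = 0"
  by (simp add: hausdorff_weight_def)

lemma hausdorff_premeasure_le:
  assumes "A \<subseteq> (\<Union>i. U i)" "\<And>i. bounded (U i)" "\<And>i. diameter (U i) \<le> \<delta>"
  shows "hausdorff_premeasure \<delta> d A \<le> (\<Sum>i. hausdorff_weight d (U i))"
  unfolding hausdorff_premeasure_def using assms by (intro INF_lower) auto

lemma hausdorff_premeasure_mono:
  "A \<subseteq> B \<Longrightarrow> hausdorff_premeasure \<delta> d A \<le> hausdorff_premeasure \<delta> d B"
  unfolding hausdorff_premeasure_def by (intro INF_superset_mono) auto

lemma hausdorff_premeasure_antimono:
  "\<delta> \<le> \<epsilon> \<Longrightarrow> hausdorff_premeasure \<epsilon> d A \<le> hausdorff_premeasure \<delta> d A"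
  unfolding hausdorff_premeasure_def by (intro INF_superset_mono) (auto intro: order_trans)

lemma hausdorff_premeasure_empty:
  "\<delta> > 0 \<Longrightarrow> hausdorff_premeasure \<delta> d {} = 0"
  using hausdorff_premeasure_le[of "{}" "\<lambda>_. {}" \<delta> d] by simp

text \<open>Covers of the \<open>A i\<close> that are optimal up to \<open>e * (1/2) ^ Suc i\<close>
  are merged into a single sequence along the pairing \<open>prod_decode\<close>; the errors add up
  to \<open>e\<close>.\<close>

lemma hausdorff_premeasure_UN:
  "hausdorff_premeasure \<delta> d (\<Union>i. A i) \<le> (\<Sum>i. hausdorff_premeasure \<delta> d (A i))"
proof (cases "(\<Sum>i. hausdorff_premeasure \<delta> d (A i)) = \<infinity>")
  case False
  let ?p = "\<lambda>i::nat. hausdorff_premeasure \<delta> d (A i)"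
  have fin: "?p i < \<infinity>" for i
    using False ennreal_suminf_lessD[of ?p \<infinity> i] by (auto simp: less_top)
  show ?thesis
  proof (rule ennreal_le_epsilon)
    fix e :: real assume e: "0 < e"
    have "\<exists>U. A i \<subseteq> (\<Union>j. U j) \<and> (\<forall>j. bounded (U j) \<and> diameter (U j) \<le> \<delta>) \<and>
        (\<Sum>j. hausdorff_weight d (U j)) \<le> ?p i + ennreal (e * (1/2) ^ Suc i)" for i
    proof -
      have "?p i < ?p i + ennreal (e * (1/2) ^ Suc i)"
        using fin[of i] e by (simp add: ennreal_less_zero_iff less_top)
      then show ?thesis
        unfolding hausdorff_premeasure_def[of _ _ "A i"]
        by (subst (asm) INF_less_iff) (auto intro: less_imp_le)
    qed
    then obtain U where U: "\<And>i. A i \<subseteq> (\<Union>j. U i j)" "\<And>i j. bounded (U i j)"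
      "\<And>i j. diameter (U i j) \<le> \<delta>"
      "\<And>i. (\<Sum>j. hausdorff_weight d (U i j)) \<le> ?p i + ennreal (e * (1/2) ^ Suc i)"
      by metis
    define V where "V k = (case prod_decode k of (i, j) \<Rightarrow> U i j)" for k
    have "(\<Union>i. A i) \<subseteq> (\<Union>k. V k)"
    proof
      fix x assume "x \<in> (\<Union>i. A i)"
      then obtain i j where "x \<in> U i j" using U(1) by blast
      then have "x \<in> V (prod_encode (i, j))" by (simp add: V_def)
      then show "x \<in> (\<Union>k. V k)" by blast
    qed
    then have "hausdorff_premeasure \<delta> d (\<Union>i. A i) \<le> (\<Sum>k. hausdorff_weight d (V k))"
      using U(2,3) by (intro hausdorff_premeasure_le) (auto simp: V_def split: prod.split)
    also have "\<dots> = (\<Sum>i. \<Sum>j. hausdorff_weight d (U i j))"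
      by (subst suminf_ennreal_2dimen[of "\<lambda>i. \<Sum>j. hausdorff_weight d (U i j)"
            "\<lambda>(i, j). hausdorff_weight d (U i j)", symmetric])
         (auto simp: V_def o_def intro!: suminf_cong split: prod.split)
    also have "\<dots> \<le> (\<Sum>i. ?p i + ennreal (e * (1/2) ^ Suc i))"
      using U(4) by (intro suminf_le) auto
    also have "\<dots> = (\<Sum>i. ?p i) + (\<Sum>i. ennreal (e * (1/2) ^ Suc i))"
      by (intro suminf_add[symmetric]) auto
    also have "(\<Sum>i. ennreal (e * (1/2) ^ Suc i)) = ennreal e"
      using e by (intro suminf_ennreal_eq) (use sums_mult[OF power_half_series, of e] in \<open>auto simp: mult_ac\<close>)
    finally show "hausdorff_premeasure \<delta> d (\<Union>i. A i) \<le> (\<Sum>i. ?p i) + ennreal e" .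
  qed
qed simp

lemma hausdorff_premeasure_le_outer:
  "\<delta> > 0 \<Longrightarrow> hausdorff_premeasure \<delta> d A \<le> hausdorff_outer d A"
  unfolding hausdorff_outer_def by (intro SUP_upper) auto

lemma hausdorff_outer_UN:
  "hausdorff_outer d (\<Union>i::nat. A i) \<le> (\<Sum>i. hausdorff_outer d (A i))"
  unfolding hausdorff_outer_def[of _ "\<Union>(_ ` _)"]
  by (intro SUP_least order_trans[OF hausdorff_premeasure_UN] suminf_le
            hausdorff_premeasure_le_outer) auto

lemma outer_measure_space_hausdorff:
  "outer_measure_space (Pow UNIV) (hausdorff_outer d)"
  unfolding outer_measure_space_def
proof (intro conjI)
  show "positive (Pow UNIV) (hausdorff_outer d)"
    by (simp add: positive_def hausdorff_outer_def hausdorff_premeasure_empty cong: SUP_cong_simp)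
  show "increasing (Pow UNIV) (hausdorff_outer d)"
    by (auto simp: increasing_def hausdorff_outer_def intro!: SUP_mono' hausdorff_premeasure_mono)
  show "countably_subadditive (Pow UNIV) (hausdorff_outer d)"
    by (auto simp: countably_subadditive_def intro: hausdorff_outer_UN)
qed

section \<open>Caratheodory's criterion for Borel sets\<close>

lemma hausdorff_outer_mono: "A \<subseteq> B \<Longrightarrow> hausdorff_outer d A \<le> hausdorff_outer d B"
  by (auto simp: hausdorff_outer_def intro!: SUP_mono' hausdorff_premeasure_mono)

lemma hausdorff_outer_empty: "hausdorff_outer d {} = 0"
  using outer_measure_space_hausdorff by (auto simp: outer_measure_space_def positive_def)

lemma hausdorff_outer_Un:
  "hausdorff_outer d (A \<union> B) \<le> hausdorff_outer d A + hausdorff_outer d B"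
proof -
  have "hausdorff_outer d (\<Union>i. binaryset A B i) \<le> (\<Sum>i. hausdorff_outer d (binaryset A B i))"
    by (rule hausdorff_outer_UN)
  also have "\<dots> = hausdorff_outer d A + hausdorff_outer d B"
    using binaryset_sums[of "hausdorff_outer d" A B, OF hausdorff_outer_empty]
    by (auto dest: sums_unique)
  finally show ?thesis by (simp add: UN_binaryset_eq)
qed

text \<open>A covering set of diameter at most \<delta> cannot meet both \<open>A\<close> and
  \<open>B\<close>, so every admissible cover of the union falls apart into a cover of
  \<open>A\<close> and a cover of \<open>B\<close>.\<close>

lemma hausdorff_premeasure_separated:
  assumes "\<And>x y. x \<in> A \<Longrightarrow> y \<in> B \<Longrightarrow> \<delta> < dist x y"
  shows "hausdorff_premeasure \<delta> d A + hausdorff_premeasure \<delta> d B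
    \<le> hausdorff_premeasure \<delta> d (A \<union> B)"
  unfolding hausdorff_premeasure_def[of _ _ "A \<union> B"]
proof (rule INF_greatest)
  fix U :: "nat \<Rightarrow> 'a set"
  assume "U \<in> {U. A \<union> B \<subseteq> (\<Union>i. U i) \<and> (\<forall>i. bounded (U i) \<and> diameter (U i) \<le> \<delta>)}"
  then have U: "A \<union> B \<subseteq> (\<Union>i. U i)" "\<forall>i. bounded (U i) \<and> diameter (U i) \<le> \<delta>" by auto
  define V where "V Y i = (if U i \<inter> Y = {} then {} else U i)" for Y i
  show "hausdorff_premeasure \<delta> d A + hausdorff_premeasure \<delta> d B
      \<le> (\<Sum>i. hausdorff_weight d (U i))"
  proof (cases "\<delta> \<ge> 0")
    case True
    have le: "hausdorff_premeasure \<delta> d Y \<le> (\<Sum>i. hausdorff_weight d (V Y i))"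
      if "Y \<subseteq> A \<union> B" for Y
      using True U that by (intro hausdorff_premeasure_le) (auto simp: V_def, blast)
    have "hausdorff_weight d (V A i) + hausdorff_weight d (V B i) \<le> hausdorff_weight d (U i)" for i
    proof -
      have "U i \<inter> A = {} \<or> U i \<inter> B = {}"
      proof (rule ccontr)
        assume "\<not> ?thesis"
        then obtain x y where "x \<in> U i" "x \<in> A" "y \<in> U i" "y \<in> B" by auto
        then show False
          using assms[of x y] diameter_bounded_bound[of "U i" x y] U(2) by (metis not_less order_trans)
      qed
      then show ?thesis by (auto simp: V_def)
    qed
    then have "(\<Sum>i. hausdorff_weight d (V A i)) + (\<Sum>i. hausdorff_weight d (V B i))
        \<le> (\<Sum>i. hausdorff_weight d (U i))"
      by (subst suminf_add) (auto intro!: suminf_le)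
    then show ?thesis using add_mono[OF le[of A] le[of B]] by (auto intro: order_trans)
  next
    \<comment> \<open>For negative \<delta> there is no admissible cover, because diameters are
      nonnegative.\<close>
    case False
    with U(2) diameter_ge_0[of "U 0"] show ?thesis by (meson order_trans)
  qed
qed

text \<open>The premeasures increase as \<delta> decreases, so the supremum over all \<delta> is a
  limit along a sequence. This lets inequalities between premeasures at the same \<delta> pass to
  the outer measures.\<close>

lemma hausdorff_outer_lim:
  "(\<lambda>n. hausdorff_premeasure (1 / real (Suc n)) d A) \<longlonglongrightarrow> hausdorff_outer d A"
proof -
  have "hausdorff_outer d A = (SUP n. hausdorff_premeasure (1 / real (Suc n)) d A)"
    unfolding hausdorff_outer_def
  proof (intro antisym SUP_least)
    fix \<delta> :: real assume "\<delta> \<in> {0<..}"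
    then obtain n where "1 / real (Suc n) < \<delta>" using nat_approx_posE[of \<delta>] by auto
    then show "hausdorff_premeasure \<delta> d A \<le> (SUP n. hausdorff_premeasure (1 / real (Suc n)) d A)"
      by (intro SUP_upper2[of n] hausdorff_premeasure_antimono) auto
  qed (intro SUP_upper, auto)
  moreover have "incseq (\<lambda>n. hausdorff_premeasure (1 / real (Suc n)) d A)"
    by (intro incseq_SucI hausdorff_premeasure_antimono) (auto simp: field_simps)
  ultimately show ?thesis by (simp add: LIMSEQ_SUP)
qed

lemma hausdorff_outer_separated:
  assumes "\<eta> > 0" "\<And>x y. x \<in> A \<Longrightarrow> y \<in> B \<Longrightarrow> \<eta> \<le> dist x y"
  shows "hausdorff_outer d A + hausdorff_outer d B \<le> hausdorff_outer d (A \<union> B)"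
proof (rule LIMSEQ_le[OF tendsto_add[OF hausdorff_outer_lim hausdorff_outer_lim]
        hausdorff_outer_lim])
  obtain N where N: "1 / real (Suc N) < \<eta>" using nat_approx_posE[OF assms(1)] by auto
  have "1 / real (Suc n) < \<eta>" if "n \<ge> N" for n
    using that N by (smt (verit) frac_le of_nat_0_less_iff of_nat_mono zero_less_Suc Suc_le_mono)
  then show "\<exists>N. \<forall>n\<ge>N. hausdorff_premeasure (1 / real (Suc n)) d A +
      hausdorff_premeasure (1 / real (Suc n)) d B \<le> hausdorff_premeasure (1 / real (Suc n)) d (A \<union> B)"
    using assms(2) by (intro exI[of _ N] allI impI hausdorff_premeasure_separated) fastforce
qed

text \<open>Induction on the number of rings: ring \<open>N\<close> keeps the distance
  \<open>\<eta> N\<close> from the whole union of the earlier rings, since the separation depends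
  only on the later of the two indices.\<close>

lemma hausdorff_outer_rings:
  fixes \<eta> :: "nat \<Rightarrow> real"
  assumes sep: "\<And>i j x y. i < j \<Longrightarrow> x \<in> A i \<Longrightarrow> y \<in> A j \<Longrightarrow> \<eta> j \<le> dist x y"
    and pos: "\<And>j. j > 0 \<Longrightarrow> \<eta> j > 0"
  shows "(\<Sum>i<N. hausdorff_outer d (A i)) \<le> hausdorff_outer d (\<Union>i<N. A i)"
proof (induction N)
  case (Suc N)
  have "(\<Sum>i<Suc N. hausdorff_outer d (A i)) \<le> hausdorff_outer d (\<Union>i<N. A i) + hausdorff_outer d (A N)"
    using Suc by (simp add: add_right_mono)
  also have "\<dots> \<le> hausdorff_outer d ((\<Union>i<N. A i) \<union> A N)"
  proof (cases "N = 0")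
    case False
    with assms show ?thesis by (intro hausdorff_outer_separated[of "\<eta> N"]) auto
  qed (simp add: hausdorff_outer_empty)
  also have "(\<Union>i<N. A i) \<union> A N = (\<Union>i<Suc N. A i)" by (auto simp: lessThan_Suc)
  finally show ?case .
qed (simp add: hausdorff_outer_empty)

text \<open>The rings around \<open>C\<close> with even index are pairwise separated, and so are those with odd index;
  hence their outer measures are summable.\<close>

lemma hausdorff_outer_closed:
  fixes C :: "'a::metric_space set"
  assumes "closed C"
  shows "hausdorff_outer d (X \<inter> C) + hausdorff_outer d (X - C) \<le> hausdorff_outer d X"
proof (cases "C = {} \<or> hausdorff_outer d X = \<infinity>")
  case True
  then show ?thesis by (auto simp: hausdorff_outer_empty)
next
  case False
  then have C: "C \<noteq> {}" and fin: "hausdorff_outer d X < \<infinity>" by (auto simp: less_top)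
  let ?f = "hausdorff_outer d" and ?i = "\<lambda>x. infdist x C"
  \<comment> \<open>Points whose distance from \<open>C\<close> lies between consecutive
    reciprocals; neighbouring rings may touch.\<close>
  define R where "R k = {x \<in> X. 1 / real (k + 2) < ?i x \<and> ?i x \<le> 1 / real (k + 1)}" for k
  define D where "D n = {x \<in> X. 1 / real (n + 1) < ?i x}" for n
  have ring: "(\<Sum>i<N. ?f (R (2 * i + e))) \<le> ?f X" for N e
  proof (rule order_trans[OF hausdorff_outer_rings])
    \<comment> \<open>This is the width of ring \<open>2 * j + e - 1\<close>, which lies between
      ring \<open>2 * j + e\<close> and every earlier ring of the same parity.\<close>
    show "1 / real (2 * j + e) - 1 / real (2 * j + e + 1) \<le> dist x y"
      if "i < j" "x \<in> R (2 * i + e)" "y \<in> R (2 * j + e)" for i j x y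
    proof -
      have "1 / real (2 * j + e) \<le> 1 / real (2 * i + e + 2)"
        using that(1) by (intro divide_left_mono) auto
      moreover have "?i x \<le> ?i y + dist x y" by (rule infdist_triangle)
      ultimately show ?thesis using that(2,3) unfolding R_def by (auto simp: add_ac)
    qed
    show "?f (\<Union>i<N. R (2 * i + e)) \<le> ?f X"
      by (intro hausdorff_outer_mono) (auto simp: R_def)
    show "0 < 1 / real (2 * j + e) - 1 / real (2 * j + e + 1)" if "0 < j" for j
      using that by (simp add: frac_less2)
  qed
  define S where "S = (\<Sum>k. ?f (R k))"
  have "(\<Sum>k<N. ?f (R k)) \<le> ?f X + ?f X" for N
  proof -
    have "(\<Sum>k<N. ?f (R k)) \<le> (\<Sum>k<N * 2. ?f (R k))"
      by (intro sum_mono2) auto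
    also have "\<dots> = (\<Sum>i<N. ?f (R (2 * i + 0)) + ?f (R (2 * i + 1)))"
      by (subst sum.nat_group[symmetric]) (simp add: numeral_2_eq_2 mult.commute)
    also have "\<dots> \<le> ?f X + ?f X"
      using ring[of 0 N] ring[of 1 N] by (simp add: sum.distrib add_mono)
    finally show ?thesis .
  qed
  then have "S \<le> ?f X + ?f X"
    unfolding S_def by (intro suminf_le_const) auto
  with fin have S: "S < \<infinity>"
    by (metis ennreal_add_less_top infinity_ennreal_def le_less_trans)
  \<comment> \<open>Subtraction is avoided in \<open>ennreal\<close>: the first \<open>n\<close>
    ring measures are added on the left, where they complete the tail to the full sum
    \<open>S\<close>, and the finite \<open>S\<close> is cancelled in the limit.\<close>
  have "?f (X \<inter> C) + ?f (X - C) + (\<Sum>k<n. ?f (R k)) \<le> ?f X + S" for n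
  proof -
    have "X - C \<subseteq> D n \<union> (\<Union>k. R (k + n))"
    proof
      fix x assume x: "x \<in> X - C"
      then have pos: "?i x > 0"
        using assms C in_closed_iff_infdist_zero[of C x] infdist_nonneg[of x C] by auto
      show "x \<in> D n \<union> (\<Union>k. R (k + n))"
      proof (cases "x \<in> D n")
        case False
        \<comment> \<open>The least index \<open>l\<close> with \<open>1 / (l + 1)\<close> below the
          distance locates the ring: \<open>x\<close> lies in ring \<open>l - 1\<close>, and
          \<open>l - 1\<close> is at least \<open>n\<close> because \<open>x\<close> is not in
          \<open>D n\<close>.\<close>
        define P where "P k \<longleftrightarrow> 1 / real (k + 1) < ?i x" for k
        obtain m where m: "P m" using nat_approx_posE[OF pos] by (auto simp: P_def)
        define l where "l = (LEAST k. P k)"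
        have l: "P l" "\<And>k. k < l \<Longrightarrow> \<not> P k"
          using m by (auto simp: l_def intro: LeastI dest: not_less_Least)
        have "\<not> P n" using False x by (auto simp: D_def P_def)
        have "n < l"
        proof (rule ccontr)
          assume "\<not> n < l"
          then have "1 / real (n + 1) \<le> 1 / real (l + 1)"
            by (intro divide_left_mono) auto
          with l(1) \<open>\<not> P n\<close> show False by (simp add: P_def)
        qed
        then obtain k where k: "l = k + n + 1" by (metis add.commute less_natE plus_1_eq_Suc)
        have "\<not> P (k + n)" using l(2) k by auto
        with l(1) k x have "x \<in> R (k + n)" by (auto simp: R_def P_def add_ac)
        then show ?thesis by blast
      qed blast
    qed
    then have "?f (X - C) \<le> ?f (D n \<union> (\<Union>k. R (k + n)))"
      by (rule hausdorff_outer_mono)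
    also have "\<dots> \<le> ?f (D n) + (\<Sum>k. ?f (R (k + n)))"
      by (intro order_trans[OF hausdorff_outer_Un] add_left_mono hausdorff_outer_UN)
    finally have "?f (X \<inter> C) + ?f (X - C) + (\<Sum>k<n. ?f (R k))
        \<le> ?f (X \<inter> C) + (?f (D n) + (\<Sum>k. ?f (R (k + n)))) + (\<Sum>k<n. ?f (R k))"
      by (intro add_mono) auto
    also have "\<dots> = (?f (X \<inter> C) + ?f (D n)) + S"
      unfolding S_def using suminf_offset[of "\<lambda>k. ?f (R k)" n] by (simp add: add_ac)
    also have "?f (X \<inter> C) + ?f (D n) \<le> ?f ((X \<inter> C) \<union> D n)"
    proof (rule hausdorff_outer_separated)
      show "1 / real (n + 1) \<le> dist x y" if "x \<in> X \<inter> C" "y \<in> D n" for x y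
        using that infdist_le[of x C y] by (auto simp: D_def dist_commute)
    qed auto
    also have "\<dots> \<le> ?f X" by (intro hausdorff_outer_mono) (auto simp: D_def)
    finally show ?thesis by (simp add: add_right_mono)
  qed
  then have "?f (X \<inter> C) + ?f (X - C) + S \<le> ?f X + S"
    unfolding S_def
    by (intro LIMSEQ_le_const2[OF tendsto_add[OF tendsto_const summable_LIMSEQ]]) auto
  with S show ?thesis by (auto simp: add.commute[of _ S] ennreal_add_left_cancel_le)
qed

lemma sets_hausdorff_measure [simp, measurable_cong]: "sets (hausdorff_measure d) = sets borel"
  by (simp add: hausdorff_measure_def sigma_algebra.sigma_sets_eq[OF sets.sigma_algebra_axioms, of borel, simplified])

lemma space_hausdorff_measure [simp]: "space (hausdorff_measure d) = UNIV"
  by (simp add: hausdorff_measure_def)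

text \<open>\<open>measure_of\<close> returns the given set function only when it is a measure on
  the sigma-algebra, and the zero measure otherwise. Caratheodory's lemma makes the outer measure a
  measure on its \<open>lambda_system\<close>, which contains the closed sets and hence all Borel
  sets.\<close>

lemma emeasure_hausdorff_measure:
  fixes A :: "'a::metric_space set"
  assumes "A \<in> sets borel"
  shows "emeasure (hausdorff_measure d) A = hausdorff_outer d A"
proof -
  let ?L = "lambda_system UNIV (Pow UNIV) (hausdorff_outer d) :: 'a set set"
  have ms: "measure_space UNIV ?L (hausdorff_outer d)"
    by (intro sigma_algebra.caratheodory_lemma outer_measure_space_hausdorff sigma_algebra_Pow)
  then interpret L: sigma_algebra UNIV ?L by (simp add: measure_space_def)
  have "C \<in> ?L" if "closed C" for C
  proof -
    have "hausdorff_outer d (X \<inter> C) + hausdorff_outer d (X - C) = hausdorff_outer d X" for X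
      using hausdorff_outer_closed[OF that, of d X] hausdorff_outer_Un[of d "X \<inter> C" "X - C"]
      by (simp add: Int_Diff_Un)
    then show ?thesis
      by (subst algebra.lambda_system_eq)
         (auto simp: sigma_algebra.axioms(1)[OF sigma_algebra_Pow, of UNIV, simplified])
  qed
  then have "sets borel \<subseteq> ?L"
    unfolding borel_eq_closed using L.sigma_sets_subset[of "Collect closed"] by auto
  then have "measure_space UNIV (sets borel) (hausdorff_outer d :: 'a set \<Rightarrow> _)"
    using measure_down[OF ms] sets.sigma_algebra_axioms[of borel] by simp
  then show ?thesis
    using emeasure_measure_of_sigma[of UNIV "sets borel" "hausdorff_outer d" A] assms
    by (simp add: measure_space_def hausdorff_measure_def hausdorff_outer_def[abs_def])
qed

section \<open>The spherical measure\<close>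

lemma hausdorff_weight_mono:
  assumes "A = {} \<Longrightarrow> B = {}" "diameter B \<le> diameter A" "bounded B"
  shows "hausdorff_weight d B \<le> hausdorff_weight d A"
  using assms diameter_ge_0[of B] by (auto simp: hausdorff_weight_def intro!: ennreal_leI mult_left_mono power_mono)

lemma diameter_nonexpansive_image:
  assumes "\<And>x y. x \<in> A \<Longrightarrow> y \<in> A \<Longrightarrow> dist (f x) (f y) \<le> dist x y" "bounded A"
  shows "bounded (f ` A) \<and> diameter (f ` A) \<le> diameter A"
proof -
  have *: "dist u v \<le> diameter A" if "u \<in> f ` A" "v \<in> f ` A" for u v
  proof -
    from that obtain x y where "x \<in> A" "y \<in> A" "u = f x" "v = f y" by auto
    then show ?thesis using assms(1)[of x y] diameter_bounded_bound[OF assms(2), of x y] by simp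
  qed
  then have "bounded (f ` A)" unfolding bounded_two_points by blast
  moreover from this have "diameter (f ` A) \<le> diameter A"
  proof (cases "A = {}")
    case False
    then have "(SUP (x, y)\<in>f ` A \<times> f ` A. dist x y) \<le> diameter A"
      by (intro cSUP_least) (use * in auto)
    then show ?thesis using False by (simp add: diameter_def)
  qed simp
  ultimately show ?thesis by blast
qed

text \<open>Images of the covering sets, cut down to \<open>A\<close> where \<open>f\<close> is
  nonexpansive, cover the image of \<open>A\<close>. Besides rotations, the angle parametrisation of
  the circle and the projection to a coordinate are treated through this comparison.\<close>

lemma hausdorff_outer_nonexpansive_image:
  assumes "\<And>x y. x \<in> A \<Longrightarrow> y \<in> A \<Longrightarrow> dist (f x) (f y) \<le> dist x y"
  shows "hausdorff_outer d (f ` A) \<le> hausdorff_outer d A"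
  unfolding hausdorff_outer_def
proof (intro SUP_mono')
  fix \<delta> :: real
  show "hausdorff_premeasure \<delta> d (f ` A) \<le> hausdorff_premeasure \<delta> d A"
    unfolding hausdorff_premeasure_def[of _ _ A]
  proof (intro INF_greatest, clarsimp)
    fix U :: "nat \<Rightarrow> _"
    assume U: "A \<subseteq> (\<Union>i. U i)" "\<forall>i. bounded (U i) \<and> diameter (U i) \<le> \<delta>"
    have *: "bounded (f ` (U i \<inter> A)) \<and> diameter (f ` (U i \<inter> A)) \<le> diameter (U i)" for i
      using diameter_nonexpansive_image[of "U i \<inter> A" f] diameter_subset[of "U i \<inter> A" "U i"] U(2) assms
      by (auto intro: bounded_subset order_trans)
    have "hausdorff_premeasure \<delta> d (f ` A) \<le> (\<Sum>i. hausdorff_weight d (f ` (U i \<inter> A)))"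
    proof (intro hausdorff_premeasure_le)
      show "f ` A \<subseteq> (\<Union>i. f ` (U i \<inter> A))" using U(1) by blast
    qed (use * U(2) in \<open>blast intro: order_trans\<close>)+
    also have "\<dots> \<le> (\<Sum>i. hausdorff_weight d (U i))"
      using * by (intro suminf_le hausdorff_weight_mono) auto
    finally show "hausdorff_premeasure \<delta> d (f ` A) \<le> (\<Sum>i. hausdorff_weight d (U i))" .
  qed
qed

lemma space_sphere_measure [simp]: "space sphere_measure = sphere 0 1"
  by (simp add: sphere_measure_def space_restrict_space)

lemma sets_sphere_measure [measurable_cong]:
  "sets sphere_measure = sets (restrict_space borel (sphere 0 1))"
  unfolding sphere_measure_def by (intro sets_restrict_space_cong) simp

lemma measurable_sphere_measure:
  "f \<in> borel \<rightarrow>\<^sub>M N \<Longrightarrow> f \<in> sphere_measure \<rightarrow>\<^sub>M N"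
  by (simp add: measurable_cong_sets[OF sets_sphere_measure refl] measurable_restrict_space1)

lemma borel_measurable_orthogonal_transformation:
  fixes f :: "'a::euclidean_space \<Rightarrow> 'a"
  shows "orthogonal_transformation f \<Longrightarrow> f \<in> borel \<rightarrow>\<^sub>M borel"
  by (auto intro!: borel_measurable_continuous_onI linear_continuous_on
      simp: linear_conv_bounded_linear[symmetric] orthogonal_transformation_linear)

lemma measurable_orthogonal_transformation_sphere:
  fixes f :: "'a::euclidean_space \<Rightarrow> 'a"
  assumes f: "orthogonal_transformation f"
  shows "f \<in> sphere_measure \<rightarrow>\<^sub>M sphere_measure"
  using f borel_measurable_orthogonal_transformation[OF f]
  unfolding measurable_cong_sets[OF sets_sphere_measure sets_sphere_measure]
  by (intro measurable_restrict_space3) (auto simp: orthogonal_transformation_norm)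

section \<open>Rotation invariance and finiteness\<close>

lemma emeasure_sphere_measure:
  fixes A :: "'a::euclidean_space set"
  assumes "A \<subseteq> sphere 0 1" "A \<in> sets borel"
  shows "emeasure sphere_measure A = hausdorff_outer (DIM('a) - 1) A"
  using assms unfolding sphere_measure_def
  by (subst emeasure_restrict_space) (auto simp: emeasure_hausdorff_measure)

text \<open>An orthogonal map and its inverse are both isometries, so neither of them can increase
  the Hausdorff measure.\<close>

lemma distr_sphere_measure_orthogonal:
  fixes f :: "'a::euclidean_space \<Rightarrow> 'a"
  assumes f: "orthogonal_transformation f"
  shows "distr sphere_measure sphere_measure f = sphere_measure"
proof (rule measure_eqI)
  note f_meas = measurable_orthogonal_transformation_sphere[OF f]
  fix A assume "A \<in> sets (distr sphere_measure sphere_measure f)"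
  then have A: "A \<subseteq> sphere 0 1" "A \<in> sets borel"
    by (auto simp: sets_sphere_measure sets_restrict_space)
  obtain g where g: "orthogonal_transformation g" "\<And>x. g (f x) = x" "\<And>x. f (g x) = x"
    using f by (metis orthogonal_transformation_bij orthogonal_transformation_inv bij_inv_eq_iff)
  have iso: "dist (h x) (h y) = dist x y" if "orthogonal_transformation h" for h :: "'a \<Rightarrow> 'a" and x y
    using that by (simp add: orthogonal_transformation_isometry)
  have pre: "f -` A \<inter> sphere 0 1 = g ` A"
    using A(1) g f by (auto simp: orthogonal_transformation_norm image_iff) metis
  have "hausdorff_outer (DIM('a) - 1) (f ` (g ` A)) \<le> hausdorff_outer (DIM('a) - 1) (g ` A)"
    by (rule hausdorff_outer_nonexpansive_image) (simp add: iso f)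
  moreover have "hausdorff_outer (DIM('a) - 1) (g ` A) \<le> hausdorff_outer (DIM('a) - 1) A"
    by (rule hausdorff_outer_nonexpansive_image) (simp add: iso g)
  moreover have "f ` (g ` A) = A" using g by (auto simp: image_iff)
  ultimately have "hausdorff_outer (DIM('a) - 1) (g ` A) = hausdorff_outer (DIM('a) - 1) A" by auto
  moreover have "f -` A \<inter> sphere 0 1 \<in> sets borel"
    using measurable_sets_borel[OF borel_measurable_orthogonal_transformation[OF f] A(2)] by auto
  moreover have "g ` A \<subseteq> sphere 0 1" using pre by blast
  ultimately show "emeasure (distr sphere_measure sphere_measure f) A = emeasure sphere_measure A"
    using A f_meas pre \<open>A \<in> sets (distr _ _ _)\<close>
    by (simp add: emeasure_distr emeasure_sphere_measure)
qed simp

text \<open>Packing by volume: the balls of radius \<open>\<delta> / 2\<close> about the points are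
  disjoint and lie in a shell around the unit sphere. The volume of the shell is of order \<delta>,
  which lowers the exponent from the dimension to the dimension minus one.\<close>

lemma card_separated_sphere_le:
  fixes P :: "'a::euclidean_space set"
  assumes P: "P \<subseteq> sphere 0 1" "finite P" "\<And>x y. x \<in> P \<Longrightarrow> y \<in> P \<Longrightarrow> x \<noteq> y \<Longrightarrow> \<delta> \<le> dist x y"
    and \<delta>: "0 < \<delta>" "\<delta> \<le> 1"
  shows "real (card P) * \<delta> ^ (DIM('a) - 1) \<le> real DIM('a) * 2 ^ (2 * DIM('a))"
proof -
  let ?n = "DIM('a)" and ?\<kappa> = "unit_ball_vol (real DIM('a))"
  have n: "?n \<ge> 1" by (simp add: Suc_leI)
  have fin_ball: "emeasure lborel (ball c s) \<noteq> \<infinity>" for c :: 'a and s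
    using emeasure_lborel_ball_finite[of c s] by auto
  have fm_ball: "ball c s \<in> fmeasurable lborel" for c :: 'a and s
    using emeasure_lborel_ball_finite[of c s] by (simp add: fmeasurable_def)
  have fm_cball: "cball c s \<in> fmeasurable lborel" for c :: 'a and s
    by (rule fmeasurable_compact) simp
  have disj: "disjoint_family_on (\<lambda>p. ball p (\<delta> / 2)) P"
    unfolding disjoint_family_on_def
  proof (intro ballI impI, rule ccontr)
    fix p q assume pq: "p \<in> P" "q \<in> P" "p \<noteq> q" "ball p (\<delta> / 2) \<inter> ball q (\<delta> / 2) \<noteq> {}"
    then obtain z where "dist p z < \<delta> / 2" "dist q z < \<delta> / 2" by auto
    then have "dist p q < \<delta>" using dist_triangle2[of p q z] by linarith
    with P(3)[OF pq(1,2,3)] show False by simp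
  qed
  have "real (card P) * (?\<kappa> * (\<delta> / 2) ^ ?n) = (\<Sum>p\<in>P. measure lborel (ball p (\<delta> / 2)))"
    using \<delta> by (simp add: content_ball)
  also have "\<dots> = measure lborel (\<Union>p\<in>P. ball p (\<delta> / 2))"
    using disj P(2) by (intro measure_finite_Union[symmetric]) (use fin_ball in auto)
  also have "\<dots> \<le> measure lborel (cball (0::'a) (1 + \<delta> / 2) - ball 0 (1 - \<delta> / 2))"
  proof (intro measure_mono_fmeasurable)
    show "(\<Union>p\<in>P. ball p (\<delta> / 2)) \<subseteq> cball 0 (1 + \<delta> / 2) - ball 0 (1 - \<delta> / 2)"
    proof
      fix z assume "z \<in> (\<Union>p\<in>P. ball p (\<delta> / 2))"
      then obtain p where "p \<in> P" "dist p z < \<delta> / 2" by auto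
      moreover from this P(1) have "norm p = 1" by auto
      ultimately show "z \<in> cball 0 (1 + \<delta> / 2) - ball 0 (1 - \<delta> / 2)"
        using norm_triangle_ineq2[of p z] norm_triangle_ineq2[of z p]
        by (auto simp: dist_norm norm_minus_commute)
    qed
  qed (use P(2) in \<open>auto intro!: fmeasurable.Diff fm_ball fm_cball\<close>)
  also have "\<dots> = ?\<kappa> * ((1 + \<delta> / 2) ^ ?n - (1 - \<delta> / 2) ^ ?n)"
  proof (subst measurable_measure_Diff[OF fm_cball fmeasurableD[OF fm_ball]])
    show "ball (0::'a) (1 - \<delta> / 2) \<subseteq> cball 0 (1 + \<delta> / 2)" using \<delta> by auto
  qed (use \<delta> in \<open>simp add: content_ball content_cball algebra_simps\<close>)
  \<comment> \<open>Factorisation of a difference of powers: the bases differ by \<delta>, and each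
    summand is at most \<open>2 ^ ?n\<close>.\<close>
  also have "(1 + \<delta> / 2) ^ ?n - (1 - \<delta> / 2) ^ ?n \<le> real ?n * \<delta> * 2 ^ ?n"
  proof -
    have "(1 + \<delta> / 2) ^ ?n - (1 - \<delta> / 2) ^ ?n
        = \<delta> * (\<Sum>i<?n. (1 - \<delta> / 2) ^ (?n - Suc i) * (1 + \<delta> / 2) ^ i)"
      by (subst power_diff_sumr2) simp
    also have "\<dots> \<le> \<delta> * (\<Sum>i<?n. 1 * 2 ^ ?n)"
    proof (intro mult_left_mono sum_mono mult_mono)
      fix i assume i: "i \<in> {..<?n}"
      show "(1 - \<delta> / 2) ^ (?n - Suc i) \<le> 1" using \<delta> by (intro power_le_one) auto
      have "(1 + \<delta> / 2) ^ i \<le> 2 ^ i" using \<delta> by (intro power_mono) auto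
      also have "\<dots> \<le> (2::real) ^ ?n" using i by (intro power_increasing) auto
      finally show "(1 + \<delta> / 2) ^ i \<le> 2 ^ ?n" .
    qed (use \<delta> in auto)
    finally show ?thesis by (simp add: mult_ac)
  qed
  finally have "?\<kappa> * (real (card P) * (\<delta> / 2) ^ ?n) \<le> ?\<kappa> * (real ?n * \<delta> * 2 ^ ?n)"
    by (simp add: mult_ac)
  then have "real (card P) * (\<delta> / 2) ^ ?n \<le> real ?n * \<delta> * 2 ^ ?n"
    using unit_ball_vol_pos[of "real ?n"] by (subst (asm) mult_le_cancel_left_pos) auto
  then have "real (card P) * \<delta> ^ ?n \<le> real ?n * \<delta> * 2 ^ ?n * 2 ^ ?n"
    by (simp add: power_divide field_simps)
  also have "\<delta> ^ ?n = \<delta> * \<delta> ^ (?n - 1)"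
    using n by (cases ?n) auto
  finally have "\<delta> * (real (card P) * \<delta> ^ (?n - 1)) \<le> \<delta> * (real ?n * 2 ^ (2 * ?n))"
    by (simp add: mult.assoc mult.left_commute mult_2 power_add)
  then show ?thesis using \<delta> by (subst (asm) mult_le_cancel_left_pos) auto
qed

text \<open>A separated set of greatest cardinality is a net: the balls of radius \<eta> about its
  points cover the sphere. By the packing bound their number times \<open>\<eta> ^ (?n - 1)\<close>
  stays bounded as \<eta> shrinks, so one constant \<open>C\<close> serves for every
  \<delta>.\<close>

lemma emeasure_sphere_measure_finite:
  "emeasure (sphere_measure :: 'a::euclidean_space measure) (sphere 0 1) < \<infinity>"
proof -
  let ?n = "DIM('a)" and ?S = "sphere (0::'a) 1"
  define C where "C = unit_ball_vol (real (?n - 1)) * (real ?n * 2 ^ (2 * ?n))"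
  have "hausdorff_premeasure \<delta> (?n - 1) ?S \<le> ennreal C" if "\<delta> > 0" for \<delta> :: real
  proof -
    \<comment> \<open>Balls of radius \<eta> have diameter at most \<delta>, and
      \<open>\<eta> \<le> 1\<close> is what the packing bound asks for.\<close>
    define \<eta> where "\<eta> = min 1 (\<delta> / 2)"
    have \<eta>: "0 < \<eta>" "\<eta> \<le> 1" "2 * \<eta> \<le> \<delta>" using that by (auto simp: \<eta>_def)
    define sep where "sep P \<longleftrightarrow> P \<subseteq> ?S \<and> finite P \<and>
      (\<forall>x\<in>P. \<forall>y\<in>P. x \<noteq> y \<longrightarrow> \<eta> \<le> dist x y)" for P
    have bound: "real (card P) * \<eta> ^ (?n - 1) \<le> real ?n * 2 ^ (2 * ?n)" if "sep P" for P
      using card_separated_sphere_le[of P \<eta>] that \<eta> by (auto simp: sep_def)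
    have "\<exists>P. sep P \<and> (\<forall>Q. sep Q \<longrightarrow> card Q \<le> card P)"
    proof (rule Lattices_Big.ex_has_greatest_nat)
      show "sep {}" by (simp add: sep_def)
      show "\<forall>Q. sep Q \<longrightarrow> card Q < Suc (nat \<lceil>real ?n * 2 ^ (2 * ?n) / \<eta> ^ (?n - 1)\<rceil>)"
      proof (intro allI impI)
        fix Q assume "sep Q"
        then have "real (card Q) \<le> real ?n * 2 ^ (2 * ?n) / \<eta> ^ (?n - 1)"
          using bound[of Q] \<eta> by (simp add: field_simps)
        then show "card Q < Suc (nat \<lceil>real ?n * 2 ^ (2 * ?n) / \<eta> ^ (?n - 1)\<rceil>)"
          by linarith
      qed
    qed
    then obtain P where P: "sep P" "\<And>Q. sep Q \<Longrightarrow> card Q \<le> card P" by blast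
    have cover: "?S \<subseteq> (\<Union>p\<in>P. cball p \<eta>)"
    proof (rule ccontr)
      assume "\<not> ?thesis"
      then obtain x where x: "x \<in> ?S" "\<And>p. p \<in> P \<Longrightarrow> \<eta> < dist p x" by fastforce
      then have "x \<notin> P" using \<eta> by force
      moreover have "sep (insert x P)"
        using P(1) x by (force simp: sep_def dist_commute less_imp_le)
      ultimately show False using P(1) P(2)[of "insert x P"] by (simp add: sep_def)
    qed
    obtain g where g: "bij_betw g {..<card P} P"
      using P(1) ex_bij_betw_nat_finite[of P] by (auto simp: sep_def atLeast0LessThan)
    \<comment> \<open>A finite cover is continued by empty sets, whose weight is zero.\<close>
    define U where "U i = (if i < card P then cball (g i) \<eta> else {})" for i
    have U: "bounded (U i) \<and> diameter (U i) \<le> 2 * \<eta>" for i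
      using \<eta> by (auto simp: U_def)
    then have U2: "diameter (U i) \<le> \<eta> * 2" for i by (simp add: mult.commute)
    have "hausdorff_premeasure \<delta> (?n - 1) ?S \<le> (\<Sum>i. hausdorff_weight (?n - 1) (U i))"
    proof (intro hausdorff_premeasure_le)
      show "?S \<subseteq> (\<Union>i. U i)"
      proof
        fix x assume "x \<in> ?S"
        then obtain p where p: "p \<in> P" "x \<in> cball p \<eta>" using cover by blast
        then obtain i where "i < card P" "p = g i" using bij_betw_imp_surj_on[OF g] by blast
        with p have "x \<in> U i" by (simp add: U_def)
        then show "x \<in> (\<Union>i. U i)" by blast
      qed
      show "diameter (U i) \<le> \<delta>" for i using U[of i] \<eta> by linarith
    qed (use U in auto)
    also have "\<dots> = (\<Sum>i<card P. hausdorff_weight (?n - 1) (U i))"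
      by (intro suminf_finite) (auto simp: U_def)
    also have "\<dots> \<le> (\<Sum>i<card P. ennreal (unit_ball_vol (real (?n - 1)) * \<eta> ^ (?n - 1)))"
      using U U2 \<eta> by (intro sum_mono) (auto simp: hausdorff_weight_def intro!: ennreal_leI mult_left_mono power_mono diameter_ge_0)
    also have "\<dots> = ennreal (unit_ball_vol (real (?n - 1)) * (real (card P) * \<eta> ^ (?n - 1)))"
      using \<eta> by (simp add: ennreal_of_nat_eq_real_of_nat mult_ac flip: ennreal_mult)
    also have "\<dots> \<le> ennreal C"
      unfolding C_def by (intro ennreal_leI mult_left_mono bound P) auto
    finally show ?thesis .
  qed
  then have "hausdorff_outer (?n - 1) ?S \<le> ennreal C"
    unfolding hausdorff_outer_def by (intro SUP_least) auto
  then show ?thesis by (subst emeasure_sphere_measure) (auto intro: le_less_trans)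
qed

section \<open>Averages over planar rotations\<close>

text \<open>For an orthonormal pair \<open>e1\<close>, \<open>e2\<close> this is the rotation by
  \<theta> in their plane that fixes the orthogonal complement; it is written as \<open>v\<close>
  plus a correction in the plane, so that \<open>v\<close> need not be decomposed.\<close>

definition plane_rotation :: "'a::euclidean_space \<Rightarrow> 'a \<Rightarrow> real \<Rightarrow> 'a \<Rightarrow> 'a" where
  "plane_rotation e1 e2 \<theta> v = v + ((cos \<theta> - 1) * (v \<bullet> e1) - sin \<theta> * (v \<bullet> e2)) *\<^sub>R e1
     + (sin \<theta> * (v \<bullet> e1) + (cos \<theta> - 1) * (v \<bullet> e2)) *\<^sub>R e2"

lemma plane_rotation_inner:
  assumes "norm e1 = 1" "norm e2 = 1" "e1 \<bullet> e2 = 0"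
  shows "plane_rotation e1 e2 \<theta> v \<bullet> e1 = cos \<theta> * (v \<bullet> e1) - sin \<theta> * (v \<bullet> e2)"
    and "plane_rotation e1 e2 \<theta> v \<bullet> e2 = sin \<theta> * (v \<bullet> e1) + cos \<theta> * (v \<bullet> e2)"
  using assms
  by (simp_all add: plane_rotation_def inner_add_left norm_eq_1 inner_commute[of e2 e1] algebra_simps)

lemma orthogonal_transformation_plane_rotation:
  assumes e: "norm e1 = 1" "norm e2 = 1" "e1 \<bullet> e2 = 0"
  shows "orthogonal_transformation (plane_rotation e1 e2 \<theta>)"
  unfolding orthogonal_transformation
proof (intro conjI allI)
  show "linear (plane_rotation e1 e2 \<theta>)"
    by (rule linearI) (simp_all add: plane_rotation_def inner_add_left algebra_simps)
  fix v
  let ?w = "plane_rotation e1 e2 \<theta> v"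
  define a b where "a = v \<bullet> e1" and "b = v \<bullet> e2"
  \<comment> \<open>Only one of the two factors is expanded; the inner products with
    \<open>e1\<close> and \<open>e2\<close> are already known, and a polynomial identity modulo
    sin^2 + cos^2 = 1 remains.\<close>
  have "?w \<bullet> ?w = ?w \<bullet> v + ((cos \<theta> - 1) * a - sin \<theta> * b) * (?w \<bullet> e1)
      + (sin \<theta> * a + (cos \<theta> - 1) * b) * (?w \<bullet> e2)"
    by (subst (2) plane_rotation_def) (simp add: inner_add_right a_def b_def)
  also have "?w \<bullet> v = v \<bullet> v + ((cos \<theta> - 1) * a - sin \<theta> * b) * a + (sin \<theta> * a + (cos \<theta> - 1) * b) * b"
    by (simp add: plane_rotation_def inner_add_left a_def b_def inner_commute[of e1 v] inner_commute[of e2 v])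
  finally have "?w \<bullet> ?w = v \<bullet> v"
    unfolding plane_rotation_inner[OF e] a_def[symmetric] b_def[symmetric]
    using sin_cos_squared_add[of \<theta>] by algebra
  then show "norm ?w = norm v" by (simp add: norm_eq_sqrt_inner)
qed

text \<open>The shift moves the window of integration; the piece that sticks out on the right is
  brought back by one period and fills the gap on the left.\<close>

lemma nn_integral_periodic:
  fixes g :: "real \<Rightarrow> ennreal"
  assumes [measurable]: "g \<in> borel_measurable borel" and per: "\<And>x. g (x + p) = g x"
    and \<beta>: "0 \<le> \<beta>" "\<beta> \<le> p"
  shows "(\<integral>\<^sup>+x. g (x + \<beta>) * indicator {a..<a + p} x \<partial>lborel)
    = (\<integral>\<^sup>+x. g x * indicator {a..<a + p} x \<partial>lborel)"
proof -
  have shift: "(\<integral>\<^sup>+x. h x \<partial>lborel) = (\<integral>\<^sup>+x. h (x + b) \<partial>lborel)"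
    if "h \<in> borel_measurable borel" for h :: "real \<Rightarrow> ennreal" and b
    using nn_integral_real_affine[of h 1 b] that by (simp add: add.commute)
  have "(\<integral>\<^sup>+x. g (x + \<beta>) * indicator {a..<a + p} x \<partial>lborel)
      = (\<integral>\<^sup>+x. g x * indicator {a + \<beta>..<a + p + \<beta>} x \<partial>lborel)"
    by (subst shift[of "\<lambda>x. g x * indicator {a + \<beta>..<a + p + \<beta>} x" \<beta>])
       (auto intro!: nn_integral_cong split: split_indicator)
  also have "\<dots> = (\<integral>\<^sup>+x. g x * indicator {a + \<beta>..<a + p} x + g x * indicator {a + p..<a + \<beta> + p} x \<partial>lborel)"
    using \<beta> by (intro nn_integral_cong) (auto split: split_indicator)
  also have "\<dots> = (\<integral>\<^sup>+x. g x * indicator {a + \<beta>..<a + p} x \<partial>lborel)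
      + (\<integral>\<^sup>+x. g x * indicator {a + p..<a + \<beta> + p} x \<partial>lborel)"
    by (intro nn_integral_add) auto
  also have "(\<integral>\<^sup>+x. g x * indicator {a + p..<a + \<beta> + p} x \<partial>lborel)
      = (\<integral>\<^sup>+x. g x * indicator {a..<a + \<beta>} x \<partial>lborel)"
    by (subst shift[of "\<lambda>x. g x * indicator {a + p..<a + \<beta> + p} x" p])
       (auto simp: per intro!: nn_integral_cong split: split_indicator)
  also have "(\<integral>\<^sup>+x. g x * indicator {a + \<beta>..<a + p} x \<partial>lborel) + \<dots>
      = (\<integral>\<^sup>+x. g x * indicator {a + \<beta>..<a + p} x + g x * indicator {a..<a + \<beta>} x \<partial>lborel)"
    by (intro nn_integral_add[symmetric]) auto
  also have "\<dots> = (\<integral>\<^sup>+x. g x * indicator {a..<a + p} x \<partial>lborel)"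
    using \<beta> by (intro nn_integral_cong) (auto split: split_indicator)
  finally show ?thesis .
qed

lemma finite_measure_sphere_measure: "finite_measure sphere_measure"
  using emeasure_sphere_measure_finite by (intro finite_measureI) (auto simp: less_top)

lemma nn_integral_sphere_orthogonal:
  fixes f :: "'a::euclidean_space \<Rightarrow> 'a"
  assumes f: "orthogonal_transformation f" and g: "g \<in> borel_measurable borel"
  shows "(\<integral>\<^sup>+u. g (f u) \<partial>sphere_measure) = (\<integral>\<^sup>+u. g u \<partial>sphere_measure)"
proof -
  have "f \<in> sphere_measure \<rightarrow>\<^sub>M sphere_measure"
    by (rule measurable_orthogonal_transformation_sphere[OF f])
  then have "(\<integral>\<^sup>+u. g u \<partial>distr sphere_measure sphere_measure f) = (\<integral>\<^sup>+u. g (f u) \<partial>sphere_measure)"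
    using g by (intro nn_integral_distr) (auto intro: measurable_sphere_measure)
  then show ?thesis by (simp add: distr_sphere_measure_orthogonal[OF f])
qed

definition circle_integral :: "(real \<times> real \<Rightarrow> ennreal) \<Rightarrow> ennreal" where
  "circle_integral f = (\<integral>\<^sup>+\<theta>. f (cos \<theta>, sin \<theta>) * indicator {-pi..<pi} \<theta> \<partial>lborel)"

text \<open>A function of the component of \<open>u\<close> in a plane is averaged over the rotations in this plane.\<close>

lemma nn_integral_sphere_plane:
  fixes e1 e2 :: "'a::euclidean_space"
  assumes e: "norm e1 = 1" "norm e2 = 1" "e1 \<bullet> e2 = 0" and r: "r > 0"
    and f [measurable]: "f \<in> borel_measurable borel"
    and hom: "\<And>s a b. s \<ge> 0 \<Longrightarrow> f (s * a, s * b) = ennreal (s powr r) * f (a, b)"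
  shows "ennreal (2 * pi) * (\<integral>\<^sup>+u. f (u \<bullet> e1, u \<bullet> e2) \<partial>sphere_measure)
    = (\<integral>\<^sup>+u. ennreal (sqrt ((u \<bullet> e1)\<^sup>2 + (u \<bullet> e2)\<^sup>2) powr r) \<partial>sphere_measure) * circle_integral f"
proof -
  interpret S: finite_measure "sphere_measure :: 'a measure" by (rule finite_measure_sphere_measure)
  interpret P: pair_sigma_finite "sphere_measure :: 'a measure" lborel ..
  have id [measurable]: "(\<lambda>u. u) \<in> (sphere_measure :: 'a measure) \<rightarrow>\<^sub>M borel"
    by (rule measurable_sphere_measure) simp
  let ?I = "indicator {-pi..<pi} :: real \<Rightarrow> ennreal"
  let ?g = "\<lambda>\<theta> u. f (cos \<theta> * (u \<bullet> e1) - sin \<theta> * (u \<bullet> e2), sin \<theta> * (u \<bullet> e1) + cos \<theta> * (u \<bullet> e2))"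
  have inner: "(\<integral>\<^sup>+\<theta>. ?g \<theta> u * ?I \<theta> \<partial>lborel)
      = ennreal (sqrt ((u \<bullet> e1)\<^sup>2 + (u \<bullet> e2)\<^sup>2) powr r) * circle_integral f" for u
  proof -
    define \<rho> where "\<rho> = sqrt ((u \<bullet> e1)\<^sup>2 + (u \<bullet> e2)\<^sup>2)"
    have "\<rho> \<ge> 0" by (simp add: \<rho>_def)
    \<comment> \<open>The polar angle of the projection of \<open>u\<close> to the plane; if the
      projection vanishes, every angle will do.\<close>
    obtain \<beta> where \<beta>: "0 \<le> \<beta>" "\<beta> \<le> 2 * pi" "u \<bullet> e1 = \<rho> * cos \<beta>" "u \<bullet> e2 = \<rho> * sin \<beta>"
    proof (cases "\<rho> = 0")
      case True
      then show ?thesis using that[of 0] by (simp add: \<rho>_def sum_power2_eq_zero_iff)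
    next
      case False
      then have "(u \<bullet> e1 / \<rho>)\<^sup>2 + (u \<bullet> e2 / \<rho>)\<^sup>2 = 1"
        by (simp add: \<rho>_def power_divide add_divide_distrib[symmetric] sum_power2_eq_zero_iff)
      then obtain t where "0 \<le> t" "t < 2 * pi" "u \<bullet> e1 / \<rho> = cos t" "u \<bullet> e2 / \<rho> = sin t"
        by (rule sincos_total_2pi)
      then show ?thesis using False by (intro that[of t]) (auto simp: field_simps)
    qed
    \<comment> \<open>The rotation adds \<theta> to the polar angle, and homogeneity splits off the
      length; periodicity then removes the dependence on \<beta>.\<close>
    have "?g \<theta> u = ennreal (\<rho> powr r) * f (cos (\<theta> + \<beta>), sin (\<theta> + \<beta>))" for \<theta>
      unfolding hom[OF \<open>\<rho> \<ge> 0\<close>, symmetric] \<beta>(3,4) cos_add sin_add by (simp add: algebra_simps)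
    then have "(\<integral>\<^sup>+\<theta>. ?g \<theta> u * ?I \<theta> \<partial>lborel)
        = (\<integral>\<^sup>+\<theta>. ennreal (\<rho> powr r) * (f (cos (\<theta> + \<beta>), sin (\<theta> + \<beta>)) * ?I \<theta>) \<partial>lborel)"
      by (simp add: mult.assoc)
    also have "\<dots> = ennreal (\<rho> powr r) * (\<integral>\<^sup>+\<theta>. f (cos (\<theta> + \<beta>), sin (\<theta> + \<beta>)) * ?I \<theta> \<partial>lborel)"
      by (intro nn_integral_cmult) measurable
    also have "(\<integral>\<^sup>+\<theta>. f (cos (\<theta> + \<beta>), sin (\<theta> + \<beta>)) * ?I \<theta> \<partial>lborel) = circle_integral f"
      unfolding circle_integral_def
      using nn_integral_periodic[of "\<lambda>\<theta>. f (cos \<theta>, sin \<theta>)" "2 * pi" \<beta> "-pi"] \<beta> by simp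
    finally show ?thesis by (simp add: \<rho>_def)
  qed
  \<comment> \<open>The factor \<open>2 * pi\<close> is the length of the window of angles: the
    sphere integral, a constant, is integrated over it before the rotation is inserted.\<close>
  have "ennreal (2 * pi) * (\<integral>\<^sup>+u. f (u \<bullet> e1, u \<bullet> e2) \<partial>sphere_measure)
      = (\<integral>\<^sup>+\<theta>. (\<integral>\<^sup>+u. f (u \<bullet> e1, u \<bullet> e2) \<partial>(sphere_measure :: 'a measure)) * ?I \<theta> \<partial>lborel)"
    by (subst nn_integral_cmult) (auto simp: mult.commute)
  also have "\<dots> = (\<integral>\<^sup>+\<theta>. (\<integral>\<^sup>+u. ?g \<theta> u * ?I \<theta> \<partial>(sphere_measure :: 'a measure)) \<partial>lborel)"
  proof (intro nn_integral_cong)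
    fix \<theta>
    have "(\<integral>\<^sup>+u. f (u \<bullet> e1, u \<bullet> e2) \<partial>(sphere_measure :: 'a measure)) = (\<integral>\<^sup>+u. ?g \<theta> u \<partial>sphere_measure)"
      using nn_integral_sphere_orthogonal[OF orthogonal_transformation_plane_rotation[OF e, of \<theta>],
          of "\<lambda>u. f (u \<bullet> e1, u \<bullet> e2)"]
      by (simp add: plane_rotation_inner[OF e])
    then show "(\<integral>\<^sup>+u. f (u \<bullet> e1, u \<bullet> e2) \<partial>(sphere_measure :: 'a measure)) * ?I \<theta>
        = (\<integral>\<^sup>+u. ?g \<theta> u * ?I \<theta> \<partial>(sphere_measure :: 'a measure))"
      by (subst nn_integral_multc) auto
  qed
  also have "\<dots> = (\<integral>\<^sup>+u. (\<integral>\<^sup>+\<theta>. ?g \<theta> u * ?I \<theta> \<partial>lborel) \<partial>(sphere_measure :: 'a measure))"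
    by (rule P.Fubini') measurable
  also have "\<dots> = (\<integral>\<^sup>+u. ennreal (sqrt ((u \<bullet> e1)\<^sup>2 + (u \<bullet> e2)\<^sup>2) powr r) \<partial>sphere_measure) * circle_integral f"
    unfolding inner by (subst nn_integral_multc) auto
  finally show ?thesis .
qed

section \<open>Length of the unit circle\<close>

lemma hausdorff_weight_1:
  "hausdorff_weight (Suc 0) U = (if U = {} then 0 else ennreal (diameter U))"
  by (simp add: hausdorff_weight_def unit_ball_vol_1)

text \<open>A nonempty bounded set lies in the interval from its infimum to its supremum, whose
  length is at most its diameter; covers at scale 1 already give the bound.\<close>

lemma emeasure_le_hausdorff_outer_real:
  fixes A :: "real set"
  assumes "A \<in> sets borel"
  shows "emeasure lborel A \<le> hausdorff_outer 1 A"
proof -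
  have "emeasure lborel A \<le> hausdorff_premeasure 1 1 A"
    unfolding hausdorff_premeasure_def
  proof (intro INF_greatest, clarsimp)
    fix U :: "nat \<Rightarrow> real set"
    assume U: "A \<subseteq> (\<Union>i. U i)" "\<forall>i. bounded (U i) \<and> diameter (U i) \<le> 1"
    define V where "V i = (if U i = {} then {} else {Inf (U i)..Sup (U i)})" for i
    have "U i \<subseteq> V i" for i
      using bounded_imp_bdd_above[of "U i"] bounded_imp_bdd_below[of "U i"] U(2)
      by (auto simp: V_def intro: cInf_lower cSup_upper)
    then have "(\<Union>i. U i) \<subseteq> (\<Union>i. V i)" by (intro UN_mono) auto
    with U(1) have "emeasure lborel A \<le> emeasure lborel (\<Union>i. V i)"
      by (intro emeasure_mono) (auto simp: V_def)
    also have "\<dots> \<le> (\<Sum>i. emeasure lborel (V i))"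
      by (intro emeasure_subadditive_countably) (auto simp: V_def)
    also have "\<dots> \<le> (\<Sum>i. hausdorff_weight 1 (U i))"
    proof (intro suminf_le)
      fix i
      show "emeasure lborel (V i) \<le> hausdorff_weight 1 (U i)"
      proof (cases "U i = {}")
        case False
        have "Sup (U i) \<le> Inf (U i) + diameter (U i)"
        proof (intro cSup_least False)
          fix x assume x: "x \<in> U i"
          have "x - diameter (U i) \<le> Inf (U i)"
          proof (intro cInf_greatest False)
            fix y assume "y \<in> U i"
            then show "x - diameter (U i) \<le> y"
              using diameter_bounded_bound[of "U i" x y] x U(2) by (auto simp: dist_real_def)
          qed
          then show "x \<le> Inf (U i) + diameter (U i)" by simp
        qed
        then show ?thesis using False diameter_ge_0[of "U i"] U(2)
          by (auto simp: V_def hausdorff_weight_1 emeasure_lborel_Icc_eq intro!: ennreal_leI)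
      qed (simp add: V_def)
    qed auto
    finally show "emeasure lborel A \<le> (\<Sum>i. hausdorff_weight (Suc 0) (U i))" by simp
  qed
  also have "\<dots> \<le> hausdorff_outer 1 A" by (rule hausdorff_premeasure_le_outer) simp
  finally show ?thesis .
qed

text \<open>Cutting into \<open>m > \<epsilon> / \<delta>\<close> equal closed intervals makes the
  pieces shorter than \<delta>, and their lengths add up to \<epsilon>.\<close>

lemma hausdorff_outer_Ioo_le:
  fixes \<epsilon> :: real
  assumes "\<epsilon> > 0"
  shows "hausdorff_outer 1 {0<..<\<epsilon>} \<le> ennreal \<epsilon>"
  unfolding hausdorff_outer_def
proof (intro SUP_least)
  fix \<delta> :: real assume "\<delta> \<in> {0<..}"
  then have "\<epsilon> / \<delta> > 0" using assms by simp
  then obtain m :: nat where m: "\<epsilon> / \<delta> < real m" using reals_Archimedean2 by blast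
  with \<open>\<epsilon> / \<delta> > 0\<close> have m0: "real m > 0" by linarith
  define U where "U i = (if i < m then {\<epsilon> * real i / real m..\<epsilon> * real (Suc i) / real m} else {})" for i
  have len: "\<epsilon> * real (Suc i) / real m - \<epsilon> * real i / real m = \<epsilon> / real m" for i
    using m0 by (simp add: field_simps)
  have le: "\<epsilon> * real i / real m \<le> \<epsilon> * real (Suc i) / real m" for i
    using assms m0 len[of i] by (smt (verit) divide_nonneg_pos)
  have diam: "diameter (U i) = (if i < m then \<epsilon> / real m else 0)" for i
    using le[of i] len[of i] by (auto simp: U_def diameter_closed_interval)
  have "hausdorff_premeasure \<delta> 1 {0<..<\<epsilon>} \<le> (\<Sum>i. hausdorff_weight 1 (U i))"
  proof (intro hausdorff_premeasure_le)
    show "{0<..<\<epsilon>} \<subseteq> (\<Union>i. U i)"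
    proof
      fix x assume x: "x \<in> {0<..<\<epsilon>}"
      define i where "i = nat \<lfloor>x * real m / \<epsilon>\<rfloor>"
      have pos: "x * real m / \<epsilon> \<ge> 0" using x assms m0 by simp
      have i: "real i \<le> x * real m / \<epsilon>" "x * real m / \<epsilon> < real (Suc i)"
        using pos unfolding i_def by linarith+
      have "x * real m / \<epsilon> < real m" using x assms m0 by (simp add: field_simps)
      with i have "i < m" by linarith
      moreover have "\<epsilon> * real i / real m \<le> x" "x \<le> \<epsilon> * real (Suc i) / real m"
        using i assms m0 by (simp_all add: field_simps)
      ultimately show "x \<in> (\<Union>i. U i)" by (auto simp: U_def)
    qed
    show "bounded (U i)" for i by (simp add: U_def)
    show "diameter (U i) \<le> \<delta>" for i
      using m m0 assms \<open>\<delta> \<in> {0<..}\<close> by (auto simp: diam field_simps)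
  qed
  also have "\<dots> = (\<Sum>i<m. hausdorff_weight 1 (U i))"
    by (intro suminf_finite) (auto simp: U_def)
  also have "\<dots> \<le> (\<Sum>i<m. ennreal (\<epsilon> / real m))"
    using diam by (intro sum_mono) (auto simp: hausdorff_weight_1)
  also have "\<dots> = ennreal \<epsilon>"
    using m0 assms by (simp add: ennreal_of_nat_eq_real_of_nat flip: ennreal_mult)
  finally show "hausdorff_premeasure \<delta> 1 {0<..<\<epsilon>} \<le> ennreal \<epsilon>" .
qed

lemma sets_sphere_measureI: "A \<subseteq> sphere 0 1 \<Longrightarrow> A \<in> sets borel \<Longrightarrow> A \<in> sets sphere_measure"
  by (simp add: sets_sphere_measure sets_restrict_space image_iff)
    (metis Int_absorb1)

text \<open>Let \<open>s\<close> be the total mass. Averaging over rotations gives an arc of angle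
  \<epsilon> the mass \<open>s * \<epsilon> / (2 * pi)\<close>. Its Hausdorff measure is at most
  \<epsilon>, because the angle parametrisation is nonexpansive, and at least
  \<open>sin \<epsilon>\<close>, because the projection to the second coordinate is. Letting
  \<epsilon> tend to 0 leaves only \<open>s = 2 * pi\<close>.\<close>

lemma emeasure_sphere_measure_2:
  "emeasure (sphere_measure :: (real^2) measure) (sphere 0 1) = ennreal (2 * pi)"
proof -
  let ?S = "sphere (0 :: real^2) 1" and ?\<sigma> = "sphere_measure :: (real^2) measure"
  interpret S: finite_measure ?\<sigma> by (rule finite_measure_sphere_measure)
  define e1 e2 :: "real^2" where "e1 = axis 1 1" and "e2 = axis 2 1"
  have e: "norm e1 = 1" "norm e2 = 1" "e1 \<bullet> e2 = 0"
    by (auto simp: e1_def e2_def inner_axis_axis)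
  have inner: "u \<bullet> e1 = u $ 1" "u \<bullet> e2 = u $ 2" for u :: "real^2"
    by (auto simp: e1_def e2_def inner_axis)
  have norm: "(u $ 1)\<^sup>2 + (u $ 2)\<^sup>2 = 1" if "u \<in> ?S" for u
    using that by (simp add: norm_vec_def L2_set_def sum_2)
  define s where "s = measure ?\<sigma> ?S"
  have s: "emeasure ?\<sigma> ?S = ennreal s" unfolding s_def by (rule S.emeasure_eq_measure)
  have bound: "sin \<epsilon> * (2 * pi) \<le> s * \<epsilon> \<and> s * \<epsilon> \<le> \<epsilon> * (2 * pi)" if \<epsilon>: "0 < \<epsilon>" "\<epsilon> < pi / 2" for \<epsilon>
  proof -
    define A where "A = {u \<in> ?S. 0 < u $ 1 \<and> 0 < u $ 2 \<and> u $ 2 * cos \<epsilon> < u $ 1 * sin \<epsilon>}"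
    \<comment> \<open>The indicator of a sector, weighted by the norm to make it homogeneous of
      degree 1 as the averaging formula requires; on the circle the weight is 1.\<close>
    define f where "f = (\<lambda>(a, b). ennreal (sqrt (a\<^sup>2 + b\<^sup>2)) *
      indicator {p :: real \<times> real. 0 < fst p \<and> 0 < snd p \<and> snd p * cos \<epsilon> < fst p * sin \<epsilon>} (a, b))"
    have fm: "f \<in> borel_measurable borel"
      unfolding f_def case_prod_beta borel_prod[symmetric] by measurable
    have A: "A \<in> sets borel" unfolding A_def by measurable
    \<comment> \<open>The last inequality says \<open>sin (\<epsilon> - \<theta>) > 0\<close>; the
      signs of sine and cosine place \<theta> in the first quadrant.\<close>
    have angle: "0 < cos \<theta> \<and> 0 < sin \<theta> \<and> sin \<theta> * cos \<epsilon> < cos \<theta> * sin \<epsilon> \<longleftrightarrow> \<theta> \<in> {0<..<\<epsilon>}"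
      if "\<theta> \<in> {-pi..<pi}" for \<theta>
    proof
      assume *: "0 < cos \<theta> \<and> 0 < sin \<theta> \<and> sin \<theta> * cos \<epsilon> < cos \<theta> * sin \<epsilon>"
      have "0 < \<theta>"
        using that * sin_ge_zero[of "-\<theta>"] by (cases "\<theta> \<le> 0") auto
      moreover have "sin (\<epsilon> - \<theta>) > 0" using * by (simp add: sin_diff mult.commute)
      then have "\<theta> < \<epsilon>"
        using that \<epsilon> sin_ge_zero[of "\<theta> - \<epsilon>"] sin_minus[of "\<theta> - \<epsilon>"] by (cases "\<epsilon> \<le> \<theta>") auto
      ultimately show "\<theta> \<in> {0<..<\<epsilon>}" by simp
    next
      assume "\<theta> \<in> {0<..<\<epsilon>}"
      moreover from this have "sin (\<epsilon> - \<theta>) > 0" using \<epsilon> by (intro sin_gt_zero) auto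
      ultimately show "0 < cos \<theta> \<and> 0 < sin \<theta> \<and> sin \<theta> * cos \<epsilon> < cos \<theta> * sin \<epsilon>"
        using \<epsilon> by (auto simp: sin_diff mult.commute intro!: cos_gt_zero_pi sin_gt_zero)
    qed
    have "ennreal (2 * pi) * (\<integral>\<^sup>+u. f (u \<bullet> e1, u \<bullet> e2) \<partial>?\<sigma>)
        = (\<integral>\<^sup>+u. ennreal (sqrt ((u \<bullet> e1)\<^sup>2 + (u \<bullet> e2)\<^sup>2) powr 1) \<partial>?\<sigma>) * circle_integral f"
    proof (rule nn_integral_sphere_plane[OF e _ fm])
      fix t a b :: real assume "0 \<le> t"
      moreover have "sqrt ((t * a)\<^sup>2 + (t * b)\<^sup>2) = t * sqrt (a\<^sup>2 + b\<^sup>2)"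
        using \<open>0 \<le> t\<close> by (simp add: power_mult_distrib real_sqrt_mult flip: distrib_left)
      moreover have "indicator {p. 0 < fst p \<and> 0 < snd p \<and> snd p * cos \<epsilon> < fst p * sin \<epsilon>} (t * a, t * b)
          = (indicator {p. 0 < fst p \<and> 0 < snd p \<and> snd p * cos \<epsilon> < fst p * sin \<epsilon>} (a, b) :: ennreal)"
        if "t > 0" using that by (auto simp: indicator_def zero_less_mult_iff mult.assoc)
      ultimately show "f (t * a, t * b) = ennreal (t powr 1) * f (a, b)"
        by (cases "t = 0") (auto simp: f_def ennreal_mult mult.assoc)
    qed simp
    also have "(\<integral>\<^sup>+u. f (u \<bullet> e1, u \<bullet> e2) \<partial>?\<sigma>) = (\<integral>\<^sup>+u. indicator A u \<partial>?\<sigma>)"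
      by (intro nn_integral_cong) (auto simp: f_def inner norm A_def indicator_def)
    also have "\<dots> = emeasure ?\<sigma> A"
      using A by (intro nn_integral_indicator sets_sphere_measureI) (auto simp: A_def)
    also have "(\<integral>\<^sup>+u. ennreal (sqrt ((u \<bullet> e1)\<^sup>2 + (u \<bullet> e2)\<^sup>2) powr 1) \<partial>?\<sigma>) = (\<integral>\<^sup>+u. 1 \<partial>?\<sigma>)"
      by (intro nn_integral_cong) (simp add: inner norm)
    also have "(\<integral>\<^sup>+u. 1 \<partial>?\<sigma>) = ennreal s" using s by simp
    also have "circle_integral f = (\<integral>\<^sup>+\<theta>. indicator {0<..<\<epsilon>} \<theta> \<partial>lborel)"
      unfolding circle_integral_def
    proof (intro nn_integral_cong)
      fix \<theta>
      show "f (cos \<theta>, sin \<theta>) * indicator {- pi..<pi} \<theta> = indicator {0<..<\<epsilon>} \<theta>"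
        using angle[of \<theta>] \<epsilon> by (auto simp: f_def indicator_def)
    qed
    also have "\<dots> = ennreal \<epsilon>" using \<epsilon> by simp
    finally have eq: "ennreal (2 * pi) * emeasure ?\<sigma> A = ennreal (s * \<epsilon>)"
      by (simp add: s_def ennreal_mult')
    have H: "emeasure ?\<sigma> A = hausdorff_outer 1 A"
      using A by (subst emeasure_sphere_measure) (auto simp: A_def)
    define p where "p \<theta> = cos \<theta> *\<^sub>R e1 + sin \<theta> *\<^sub>R e2" for \<theta>
    have "A \<subseteq> p ` {0<..<\<epsilon>}"
    proof
      fix u assume u: "u \<in> A"
      obtain \<theta> where \<theta>: "0 \<le> \<theta>" "\<theta> < 2 * pi" "u $ 1 = cos \<theta>" "u $ 2 = sin \<theta>"
        using sincos_total_2pi[of "u $ 1" "u $ 2"] norm[of u] u by (auto simp: A_def)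
      have "sin \<theta> > 0" using u \<theta> by (simp add: A_def)
      then have "\<theta> < pi"
        using \<theta> sin_ge_zero[of "\<theta> - pi"] by (cases "pi \<le> \<theta>") auto
      then have "\<theta> \<in> {0<..<\<epsilon>}" using angle[of \<theta>] u \<theta> pi_gt_zero by (simp add: A_def)
      moreover have "u = p \<theta>"
        using \<theta> by (auto simp: p_def vec_eq_iff forall_2 e1_def e2_def axis_def)
      ultimately show "u \<in> p ` {0<..<\<epsilon>}" by blast
    qed
    then have "hausdorff_outer 1 A \<le> hausdorff_outer 1 (p ` {0<..<\<epsilon>})" by (rule hausdorff_outer_mono)
    also have "\<dots> \<le> hausdorff_outer 1 {0<..<\<epsilon>}"
    proof (rule hausdorff_outer_nonexpansive_image)
      fix x y :: real
      have "(dist (p x) (p y))\<^sup>2 = (cos x - cos y)\<^sup>2 + (sin x - sin y)\<^sup>2"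
      proof -
        have "p x - p y = (cos x - cos y) *\<^sub>R e1 + (sin x - sin y) *\<^sub>R e2"
          by (simp add: p_def algebra_simps)
        then show ?thesis
          using e unfolding dist_norm power2_norm_eq_inner
          by (simp add: inner_add_left inner_add_right norm_eq_1 inner_commute[of e2 e1] power2_eq_square)
      qed
      also have "\<dots> = 2 - 2 * cos (x - y)"
        using sin_cos_squared_add[of x] sin_cos_squared_add[of y]
        by (simp add: cos_diff power2_eq_square algebra_simps)
      \<comment> \<open>The chord is twice the sine of half the angle, hence no longer than the
        arc.\<close>
      also have "\<dots> = (2 * sin ((x - y) / 2))\<^sup>2"
      proof -
        have "2 * ((x - y) / 2) = x - y" by (rule nonzero_mult_div_cancel_left[of 2 "x - y", simplified times_divide_eq_right[symmetric]]) simp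
        with cos_double_sin[of "(x - y) / 2"] show ?thesis by (simp only: power_mult_distrib) simp
      qed
      also have "\<dots> \<le> (x - y)\<^sup>2"
        using abs_sin_x_le_abs_x[of "(x - y) / 2"] by (intro abs_le_square_iff[THEN iffD1]) auto
      finally show "dist (p x) (p y) \<le> dist x y"
        by (simp add: dist_real_def abs_le_square_iff[symmetric])
    qed
    also have "\<dots> \<le> ennreal \<epsilon>" using \<epsilon>(1) by (rule hausdorff_outer_Ioo_le)
    finally have "ennreal (2 * pi) * emeasure ?\<sigma> A \<le> ennreal (2 * pi) * ennreal \<epsilon>"
      unfolding H by (intro mult_left_mono) auto
    then have upper: "s * \<epsilon> \<le> \<epsilon> * (2 * pi)"
      unfolding eq using \<epsilon> by (subst (asm) ennreal_mult[symmetric]) (auto simp: ennreal_le_iff mult_ac)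
    \<comment> \<open>The point of the arc at height \<open>z\<close> has the angle
      \<open>arcsin z\<close>, which is below \<epsilon> by monotonicity.\<close>
    have "{0<..<sin \<epsilon>} \<subseteq> (\<lambda>u. u $ 2) ` A"
    proof
      fix z assume z: "z \<in> {0<..<sin \<epsilon>}"
      define \<theta> where "\<theta> = arcsin z"
      have z1: "z < 1" using z sin_le_one[of \<epsilon>] unfolding greaterThanLessThan_iff by linarith
      have "0 < z" "z < sin \<epsilon>" using z by auto
      then have "arcsin 0 < arcsin z" "arcsin z < arcsin (sin \<epsilon>)"
        using z1 sin_le_one[of \<epsilon>] by (intro arcsin_less_arcsin; linarith)+
      then have \<theta>: "sin \<theta> = z" "0 < \<theta>" "\<theta> < \<epsilon>"
        using z z1 \<epsilon> arcsin_sin[of \<epsilon>] unfolding \<theta>_def by (simp_all add: sin_arcsin)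
      have comp: "p \<theta> $ 1 = cos \<theta>" "p \<theta> $ 2 = sin \<theta>"
        by (auto simp: p_def e1_def e2_def axis_def)
      then have "p \<theta> \<in> A"
        using angle[of \<theta>] \<theta>(2,3) \<epsilon> by (auto simp: A_def norm_vec_def L2_set_def sum_2)
      then show "z \<in> (\<lambda>u. u $ 2) ` A" using \<theta>(1) comp by force
    qed
    then have "hausdorff_outer 1 {0<..<sin \<epsilon>} \<le> hausdorff_outer 1 ((\<lambda>u. u $ 2) ` A)"
      by (rule hausdorff_outer_mono)
    also have "\<dots> \<le> hausdorff_outer 1 A"
      by (rule hausdorff_outer_nonexpansive_image) (rule dist_vec_nth_le)
    finally have "ennreal (sin \<epsilon>) \<le> emeasure ?\<sigma> A"
      using emeasure_le_hausdorff_outer_real[of "{0<..<sin \<epsilon>}"] sin_gt_zero[of \<epsilon>] \<epsilon>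
      by (simp add: H)
    then have "ennreal (2 * pi) * ennreal (sin \<epsilon>) \<le> ennreal (s * \<epsilon>)"
      unfolding eq[symmetric] by (intro mult_left_mono) auto
    then have "sin \<epsilon> * (2 * pi) \<le> s * \<epsilon>"
      using \<epsilon> sin_gt_zero[of \<epsilon>] by (subst (asm) ennreal_mult[symmetric]) (auto simp: ennreal_le_iff s_def mult_ac)
    with upper show ?thesis by blast
  qed
  \<comment> \<open>The upper estimate is linear in \<epsilon>, so the single value 1 suffices; only
    the lower one needs the limit of \<open>sin \<epsilon> / \<epsilon>\<close>.\<close>
  have "s \<le> 2 * pi" using bound[of 1] pi_gt3 by simp
  moreover have "2 * pi \<le> s"
  proof (rule tendsto_le[of "at_right 0"])
    show "((\<lambda>\<epsilon>::real. sin \<epsilon> / \<epsilon> * (2 * pi)) \<longlongrightarrow> 2 * pi) (at_right 0)"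
    proof -
      have "((\<lambda>\<epsilon>::real. sin \<epsilon> / \<epsilon>) \<longlongrightarrow> 1) (at 0)"
        using DERIV_sin[of 0] by (simp add: has_field_derivative_iff)
      then have "((\<lambda>\<epsilon>::real. sin \<epsilon> / \<epsilon>) \<longlongrightarrow> 1) (at_right 0)"
        by (rule filterlim_at_split[THEN iffD1, THEN conjunct2])
      from tendsto_mult[OF this tendsto_const, of "2 * pi"] show ?thesis by simp
    qed
    show "\<forall>\<^sub>F \<epsilon> in at_right 0. sin \<epsilon> / \<epsilon> * (2 * pi) \<le> s"
      unfolding eventually_at_right_field
      using bound pi_gt_zero by (intro exI[of _ "pi / 2"]) (auto simp: field_simps)
  qed auto
  ultimately show ?thesis unfolding s by (intro arg_cong[of _ _ ennreal]) auto
qed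

section \<open>The function \<open>F\<^sub>r\<close>\<close>

text \<open>This is c(2, r) for positive \<open>r\<close>, as \<open>sphere_const_2\<close>
  shows.\<close>

definition cos_integral :: "real \<Rightarrow> real" where
  "cos_integral r = (LBINT \<theta>=- (pi / 2)..pi / 2. cos \<theta> powr r)"

text \<open>The planar overlap up to a constant: the two points are the unit vector at angle \<phi>
  and the vector of length \<open>t\<close> at angle 0.\<close>

definition min_integral :: "real \<Rightarrow> real \<Rightarrow> real \<Rightarrow> ennreal" where
  "min_integral r t \<phi> = (\<integral>\<^sup>+\<theta>. ennreal (min (max 0 (cos (\<theta> - \<phi>))) (t * max 0 (cos \<theta>)) powr r)
     * indicator {-pi..<pi} \<theta> \<partial>lborel)"

lemma cos_powr_integral:
  assumes r: "r > 0" and ab: "- (pi / 2) \<le> a" "a \<le> b" "b \<le> pi / 2"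
  shows "(\<integral>\<^sup>+\<theta>. ennreal (cos \<theta> powr r) * indicator {a..b} \<theta> \<partial>lborel) = ennreal (LBINT \<theta>=a..b. cos \<theta> powr r)"
    and "0 \<le> (LBINT \<theta>=a..b. cos \<theta> powr r)"
    and "interval_lebesgue_integrable lborel a b (\<lambda>\<theta>. cos \<theta> powr r)"
proof -
  have cont: "continuous_on {a..b} (\<lambda>\<theta>. cos \<theta> powr r)"
    using ab r by (intro continuous_on_powr' continuous_intros) (auto intro!: cos_ge_zero)
  then have int: "integrable lborel (\<lambda>\<theta>. indicator {a..b} \<theta> *\<^sub>R (cos \<theta> powr r))"
    using borel_integrable_compact[of "{a..b}" "\<lambda>\<theta>. cos \<theta> powr r"] by (simp add: indicator_scaleR_eq_if)
  have eq: "(LBINT \<theta>=a..b. cos \<theta> powr r) = (LINT \<theta>|lborel. indicator {a..b} \<theta> *\<^sub>R (cos \<theta> powr r))"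
    using ab by (subst interval_integral_Icc) (auto simp: set_lebesgue_integral_def)
  have "(\<integral>\<^sup>+\<theta>. ennreal (cos \<theta> powr r) * indicator {a..b} \<theta> \<partial>lborel)
      = (\<integral>\<^sup>+\<theta>. ennreal (indicator {a..b} \<theta> *\<^sub>R (cos \<theta> powr r)) \<partial>lborel)"
    by (intro nn_integral_cong) (auto split: split_indicator)
  also have "\<dots> = ennreal (LBINT \<theta>=a..b. cos \<theta> powr r)"
    unfolding eq by (intro nn_integral_eq_integral int) auto
  finally show "(\<integral>\<^sup>+\<theta>. ennreal (cos \<theta> powr r) * indicator {a..b} \<theta> \<partial>lborel) = ennreal (LBINT \<theta>=a..b. cos \<theta> powr r)" .
  show "0 \<le> (LBINT \<theta>=a..b. cos \<theta> powr r)"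
    unfolding eq by (intro integral_nonneg_AE) auto
  show "interval_lebesgue_integrable lborel a b (\<lambda>\<theta>. cos \<theta> powr r)"
    using int ab unfolding interval_lebesgue_integrable_def set_integrable_def
    by (auto simp: einterval_eq_Icc intro!: set_integrable_subset[of lborel "{a..b}", unfolded set_integrable_def] simp del: real_scaleR_def)
qed

lemma circle_integral_cos:
  assumes r: "r > 0"
  shows "circle_integral (\<lambda>(a, b). ennreal (max 0 a powr r)) = ennreal (cos_integral r)"
proof -
  have "circle_integral (\<lambda>(a, b). ennreal (max 0 a powr r))
      = (\<integral>\<^sup>+\<theta>. ennreal (cos \<theta> powr r) * indicator {- (pi / 2)..pi / 2} \<theta> \<partial>lborel)"
    unfolding circle_integral_def
  proof (intro nn_integral_cong, cases)
    fix \<theta> assume "\<theta> \<in> {- (pi / 2)..pi / 2}"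
    moreover from this have "-pi \<le> \<theta> \<and> \<theta> < pi" using pi_gt_zero unfolding atLeastAtMost_iff by linarith
    ultimately show "(case (cos \<theta>, sin \<theta>) of (a, b) \<Rightarrow> ennreal (max 0 a powr r)) * indicator {- pi..<pi} \<theta>
        = ennreal (cos \<theta> powr r) * indicator {- (pi / 2)..pi / 2} \<theta>"
      using cos_ge_zero[of \<theta>] by (auto simp: indicator_def)
  next
    fix \<theta> assume \<theta>: "\<theta> \<notin> {- (pi / 2)..pi / 2}"
    have "cos \<theta> \<le> 0" if "\<theta> \<in> {- pi..<pi}"
    proof -
      have "cos \<bar>\<theta>\<bar> \<le> cos (pi / 2)" using \<theta> that by (intro cos_monotone_0_pi_le) auto
      then show ?thesis by (simp add: abs_if split: if_splits)
    qed
    then show "(case (cos \<theta>, sin \<theta>) of (a, b) \<Rightarrow> ennreal (max 0 a powr r)) * indicator {- pi..<pi} \<theta>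
        = ennreal (cos \<theta> powr r) * indicator {- (pi / 2)..pi / 2} \<theta>"
      using \<theta> r by (auto simp: max_def indicator_def)
  qed
  also have "\<dots> = ennreal (cos_integral r)"
    unfolding cos_integral_def using cos_powr_integral(1)[OF r, of "- (pi / 2)" "pi / 2"] by simp
  finally show ?thesis .
qed

text \<open>Because pi > 3, the interval \<open>{0..1}\<close> lies inside the range, and there the
  integrand is at least \<open>cos 1 powr r\<close>.\<close>

lemma cos_integral_pos:
  assumes r: "r > 0"
  shows "cos_integral r > 0"
proof -
  have "ennreal (cos 1 powr r) = (\<integral>\<^sup>+\<theta>. ennreal (cos 1 powr r) * indicator {0..1::real} \<theta> \<partial>lborel)"
    by (subst nn_integral_cmult_indicator) auto
  also have "\<dots> \<le> (\<integral>\<^sup>+\<theta>. ennreal (cos \<theta> powr r) * indicator {- (pi / 2)..pi / 2} \<theta> \<partial>lborel)"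
  proof (intro nn_integral_mono)
    fix \<theta> :: real
    have "cos 1 powr r \<le> cos \<theta> powr r" if "0 \<le> \<theta>" "\<theta> \<le> 1"
      using that r pi_gt3 by (intro powr_mono2 cos_monotone_0_pi_le cos_ge_zero) auto
    then show "ennreal (cos 1 powr r) * indicator {0..1} \<theta>
        \<le> ennreal (cos \<theta> powr r) * indicator {- (pi / 2)..pi / 2} \<theta>"
      using pi_gt3 by (auto simp: indicator_def intro!: ennreal_leI)
  qed
  also have "\<dots> = ennreal (cos_integral r)"
    unfolding cos_integral_def using cos_powr_integral(1)[OF r, of "- (pi / 2)" "pi / 2"] by simp
  finally have "ennreal (cos 1 powr r) \<le> ennreal (cos_integral r)" .
  moreover have "cos 1 > (0::real)" using pi_gt3 by (intro cos_gt_zero_pi) auto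
  then have "cos 1 powr r > 0" by simp
  moreover from this calculation have "cos 1 powr r \<le> cos_integral r" by (auto simp: ennreal_le_iff2)
  ultimately show ?thesis by linarith
qed

text \<open>The lower bound compares
  \<open>tan (\<phi> - pi / 2) = - cos \<phi> / sin \<phi>\<close> with the argument of the
  arctangent. Both integrals in \<open>F_fun\<close> thus stay inside the range where the cosine is
  nonnegative.\<close>

lemma alpha_bounds:
  assumes t: "0 < t" and \<phi>: "0 < \<phi>" "\<phi> < pi"
  shows "\<phi> - pi / 2 < alpha t \<phi>" "alpha t \<phi> < pi / 2"
proof -
  have s: "sin \<phi> > 0" using \<phi> by (rule sin_gt_zero)
  have "tan (\<phi> - pi / 2) = - cos \<phi> / sin \<phi>"
    by (simp add: tan_def sin_diff cos_diff)
  also have "\<dots> < (t - cos \<phi>) / sin \<phi>" using s t by (intro divide_strict_right_mono) auto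
  finally have "arctan (tan (\<phi> - pi / 2)) < alpha t \<phi>"
    unfolding alpha_def by (rule arctan_monotone)
  then show "\<phi> - pi / 2 < alpha t \<phi>" using \<phi> by (subst (asm) arctan_tan) auto
  show "alpha t \<phi> < pi / 2" unfolding alpha_def by (rule arctan_ubound)
qed

text \<open>\<open>alpha t \<phi>\<close> is the angle at which \<open>t * cos \<theta>\<close> and
  \<open>cos (\<theta> - \<phi>)\<close> cross. To its right the first is the minimum; to its left
  the second, whose positive part starts at \<open>\<phi> - pi / 2\<close>.\<close>

lemma min_cos_eq:
  assumes r: "r > 0" and t: "0 < t" and \<phi>: "0 < \<phi>" "\<phi> < pi" and \<theta>: "-pi \<le> \<theta>" "\<theta> < pi"
  shows "min (max 0 (cos (\<theta> - \<phi>))) (t * max 0 (cos \<theta>)) powr r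
    = t powr r * (cos \<theta> powr r) * indicator {alpha t \<phi>..pi / 2} \<theta>
      + cos (\<theta> - \<phi>) powr r * indicator {\<phi> - pi / 2..<alpha t \<phi>} \<theta>"
proof (cases "\<theta> \<in> {- (pi / 2)<..<pi / 2}")
  case True
  let ?a = "alpha t \<phi>"
  have c: "cos \<theta> > 0" using True by (intro cos_gt_zero_pi) auto
  have s: "sin \<phi> > 0" using \<phi> by (rule sin_gt_zero)
  have "tan ?a = (t - cos \<phi>) / sin \<phi>" by (simp add: alpha_def tan_arctan)
  then have "tan \<theta> - tan ?a = sin \<theta> / cos \<theta> - (t - cos \<phi>) / sin \<phi>" by (simp add: tan_def)
  \<comment> \<open>The sign of this difference is that of \<open>tan \<theta> - tan ?a\<close>,
    since \<open>cos \<theta>\<close> and \<open>sin \<phi>\<close> are positive; monotonicity of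
    the tangent turns it into a comparison of angles.\<close>
  then have diff: "cos (\<theta> - \<phi>) - t * cos \<theta> = cos \<theta> * sin \<phi> * (tan \<theta> - tan ?a)"
    using c s by (simp add: cos_diff field_simps)
  have tan: "?a \<le> \<theta> \<longleftrightarrow> tan ?a \<le> tan \<theta>"
  proof -
    have "\<theta> = arctan (tan \<theta>)" using True by (simp add: arctan_tan)
    then have "?a \<le> \<theta> \<longleftrightarrow> arctan ((t - cos \<phi>) / sin \<phi>) \<le> arctan (tan \<theta>)" by (simp add: alpha_def)
    then show ?thesis by (simp add: arctan_le_iff alpha_def tan_arctan)
  qed
  have ge: "?a \<le> \<theta> \<longleftrightarrow> t * cos \<theta> \<le> cos (\<theta> - \<phi>)"
    using diff c s unfolding tan by (smt (verit) mult_pos_pos zero_le_mult_iff mult_neg_pos mult_pos_neg)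
  have b: "\<phi> - pi / 2 < ?a" "?a < pi / 2" using alpha_bounds[OF t \<phi>] .
  have tc: "t * cos \<theta> > 0" using c t by simp
  consider "?a \<le> \<theta>" | "\<theta> < ?a" "\<phi> - pi / 2 \<le> \<theta>" | "\<theta> < ?a" "\<theta> < \<phi> - pi / 2" by linarith
  then show ?thesis
  proof cases
    case 1
    then have "min (max 0 (cos (\<theta> - \<phi>))) (t * max 0 (cos \<theta>)) = t * cos \<theta>"
      using ge tc c by (simp add: max_def min_def)
    then show ?thesis using 1 True t c by (simp add: powr_mult)
  next
    case 2
    have "cos (\<theta> - \<phi>) \<ge> 0" using 2 True \<phi> by (intro cos_ge_zero) auto
    then have "min (max 0 (cos (\<theta> - \<phi>))) (t * max 0 (cos \<theta>)) = cos (\<theta> - \<phi>)"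
      using ge 2 c by (simp add: max_def min_def)
    then show ?thesis using 2 by simp
  next
    case 3
    have "cos (\<phi> - \<theta> - pi) \<ge> 0" using 3 True \<phi> by (intro cos_ge_zero) auto
    then have "cos (\<theta> - \<phi>) \<le> 0" by (simp add: cos_diff mult.commute)
    then show ?thesis using 3 b tc c r by (simp add: max_def min_def)
  qed
next
  case False
  have "cos \<theta> \<le> 0"
  proof -
    have "cos \<bar>\<theta>\<bar> \<le> cos (pi / 2)" using \<theta> False by (intro cos_monotone_0_pi_le) auto
    then show ?thesis by (simp add: abs_if split: if_splits)
  qed
  then have "min (max 0 (cos (\<theta> - \<phi>))) (t * max 0 (cos \<theta>)) = 0" by (simp add: max_def)
  moreover have "cos \<theta> powr r * indicator {alpha t \<phi>..pi / 2} \<theta> = (0::real)"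
  \<comment> \<open>The closed right end belongs to the indicator, but the cosine vanishes
    there.\<close>
  proof (cases "\<theta> = pi / 2")
    case True
    then have "cos \<theta> = 0" by (simp only: cos_pi_half)
    then show ?thesis by simp
  next
    case False
    with \<open>\<theta> \<notin> _\<close> alpha_bounds[OF t \<phi>] \<phi> show ?thesis by (auto simp: indicator_def)
  qed
  ultimately show ?thesis
    using False alpha_bounds[OF t \<phi>] \<phi> r by (auto simp: indicator_def)
qed

text \<open>The minimum is integrated over the ranges complementary to those in
  \<open>F_fun\<close>: above \<open>alpha t \<phi>\<close> with weight \<open>t powr r\<close>,
  and, after a shift by \<phi>, below \<open>alpha t \<phi> - \<phi>\<close> with weight 1. Each
  range and its complement make up the interval from \<open>- (pi / 2)\<close> to
  \<open>pi / 2\<close>, which yields the total \<open>(1 + t powr r) * cos_integral r\<close>. The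
  equation \<open>c2\<close> is supplied later by \<open>sphere_const_2\<close>.\<close>

lemma min_integral_eq_F:
  assumes r: "r > 0" and t: "0 < t" "t \<le> 1" and \<phi>: "0 < \<phi>" "\<phi> < pi"
    and c2: "sphere_const TYPE(real^2) r = cos_integral r"
  shows "min_integral r t \<phi> = ennreal (cos_integral r * (1 + t powr r - F_fun r t \<phi>))"
    and "0 \<le> 1 + t powr r - F_fun r t \<phi>"
proof -
  let ?a = "alpha t \<phi>" and ?I = "\<lambda>a b. LBINT \<theta>=ereal a..ereal b. cos \<theta> powr r"
  let ?h = "pi / 2"
  have b: "\<phi> - ?h < ?a" "?a < ?h" using alpha_bounds[OF t(1) \<phi>] .
  have b': "- ?h < ?a" "?a - \<phi> < ?h" "- ?h < ?a - \<phi>" using b \<phi> by auto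
  have sum: "?I (- ?h) x + ?I x ?h = cos_integral r" if "- ?h \<le> x" "x \<le> ?h" for x
    unfolding cos_integral_def
    using that interval_integral_sum[of "ereal (- ?h)" "ereal x" "ereal ?h" "\<lambda>\<theta>. cos \<theta> powr r"]
      cos_powr_integral(3)[OF r, of "- ?h" ?h] by (simp add: min_def max_def)
  have "min_integral r t \<phi> = (\<integral>\<^sup>+\<theta>. ennreal (t powr r) * (ennreal (cos \<theta> powr r) * indicator {?a..?h} \<theta>)
      + ennreal (cos (\<theta> - \<phi>) powr r) * indicator {\<phi> - ?h..<?a} \<theta> \<partial>lborel)"
    unfolding min_integral_def
  proof (intro nn_integral_cong, cases)
    fix \<theta> assume "\<theta> \<in> {-pi..<pi}"
    then show "ennreal (min (max 0 (cos (\<theta> - \<phi>))) (t * max 0 (cos \<theta>)) powr r) * indicator {- pi..<pi} \<theta>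
      = ennreal (t powr r) * (ennreal (cos \<theta> powr r) * indicator {?a..?h} \<theta>)
      + ennreal (cos (\<theta> - \<phi>) powr r) * indicator {\<phi> - ?h..<?a} \<theta>"
      by (subst min_cos_eq[OF r t(1) \<phi>]) (auto simp: ennreal_mult split: split_indicator)
  next
    fix \<theta> assume "\<theta> \<notin> {-pi..<pi}"
    then show "ennreal (min (max 0 (cos (\<theta> - \<phi>))) (t * max 0 (cos \<theta>)) powr r) * indicator {- pi..<pi} \<theta>
      = ennreal (t powr r) * (ennreal (cos \<theta> powr r) * indicator {?a..?h} \<theta>)
      + ennreal (cos (\<theta> - \<phi>) powr r) * indicator {\<phi> - ?h..<?a} \<theta>"
      using b b' \<phi> pi_gt_zero by (auto simp: indicator_def)
  qed
  also have "\<dots> = (\<integral>\<^sup>+\<theta>. ennreal (t powr r) * (ennreal (cos \<theta> powr r) * indicator {?a..?h} \<theta>) \<partial>lborel)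
      + (\<integral>\<^sup>+\<theta>. ennreal (cos (\<theta> - \<phi>) powr r) * indicator {\<phi> - ?h..<?a} \<theta> \<partial>lborel)"
    by (intro nn_integral_add) auto
  also have "(\<integral>\<^sup>+\<theta>. ennreal (t powr r) * (ennreal (cos \<theta> powr r) * indicator {?a..?h} \<theta>) \<partial>lborel)
      = ennreal (t powr r * ?I ?a ?h)"
    using b b' cos_powr_integral[OF r, of ?a ?h] by (subst nn_integral_cmult) (auto simp: ennreal_mult)
  also have "(\<integral>\<^sup>+\<theta>. ennreal (cos (\<theta> - \<phi>) powr r) * indicator {\<phi> - ?h..<?a} \<theta> \<partial>lborel)
      = (\<integral>\<^sup>+\<theta>. ennreal (cos \<theta> powr r) * indicator {- ?h..<?a - \<phi>} \<theta> \<partial>lborel)"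
    by (subst nn_integral_real_affine[where c = 1 and t = \<phi>])
       (auto intro!: nn_integral_cong split: split_indicator)
  also have "\<dots> = (\<integral>\<^sup>+\<theta>. ennreal (cos \<theta> powr r) * indicator {- ?h..?a - \<phi>} \<theta> \<partial>lborel)"
    using AE_lborel_singleton[of "?a - \<phi>"]
    by (intro nn_integral_cong_AE) (auto elim!: eventually_mono split: split_indicator)
  also have "\<dots> = ennreal (?I (- ?h) (?a - \<phi>))"
    using b b' by (intro cos_powr_integral(1)[OF r]) auto
  also have "ennreal (t powr r * ?I ?a ?h) + ennreal (?I (- ?h) (?a - \<phi>))
      = ennreal (t powr r * ?I ?a ?h + ?I (- ?h) (?a - \<phi>))"
    using b b' by (intro ennreal_plus[symmetric] mult_nonneg_nonneg cos_powr_integral(2)[OF r]) auto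
  finally have *: "min_integral r t \<phi> = ennreal (t powr r * ?I ?a ?h + ?I (- ?h) (?a - \<phi>))" .
  have "cos_integral r * F_fun r t \<phi> = t powr r * ?I (- ?h) ?a + ?I (?a - \<phi>) ?h"
    using cos_integral_pos[OF r] by (simp add: F_fun_def c2)
  then have eq: "cos_integral r * (1 + t powr r - F_fun r t \<phi>) = t powr r * ?I ?a ?h + ?I (- ?h) (?a - \<phi>)"
    using sum[of ?a] sum[of "?a - \<phi>"] b b' by (simp add: algebra_simps flip: distrib_left)
  then show "min_integral r t \<phi> = ennreal (cos_integral r * (1 + t powr r - F_fun r t \<phi>))"
    using * by simp
  have "0 \<le> cos_integral r * (1 + t powr r - F_fun r t \<phi>)"
    unfolding eq using b b' by (intro add_nonneg_nonneg mult_nonneg_nonneg cos_powr_integral(2)[OF r]) auto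
  then show "0 \<le> 1 + t powr r - F_fun r t \<phi>"
    using cos_integral_pos[OF r] by (simp add: zero_le_mult_iff)
qed

section \<open>Sphere integrals reduced to the circle\<close>

lemma pos_part_mult: "s \<ge> 0 \<Longrightarrow> max 0 (s * a) = s * max 0 a" for s a :: real
  using max_mult_distrib_left[of s 0 a] by simp

text \<open>\<open>sphere_const\<close> fixes a unit vector by \<open>SOME\<close>; an orthogonal
  map carrying \<open>e\<close> to it transfers the integral to any other direction.\<close>

lemma nn_integral_sphere_pos_part:
  fixes e :: "real^'n"
  assumes r: "r > 0" and e: "norm e = 1"
  shows "(\<integral>\<^sup>+u. ennreal (max 0 (u \<bullet> e) powr r) \<partial>sphere_measure) = ennreal (sphere_const TYPE(real^'n) r)"
proof -
  interpret S: finite_measure "sphere_measure :: (real^'n) measure" by (rule finite_measure_sphere_measure)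
  have id [measurable]: "(\<lambda>u. u) \<in> (sphere_measure :: (real^'n) measure) \<rightarrow>\<^sub>M borel"
    by (rule measurable_sphere_measure) simp
  define e' :: "real^'n" where "e' = (SOME e. norm e = 1)"
  have e': "norm e' = 1" unfolding e'_def using e by (rule someI)
  obtain f where f: "orthogonal_transformation f" "f e = e'"
    using orthogonal_transformation_exists[of e e'] e e' by auto
  have "f u \<bullet> e' = u \<bullet> e" for u
    using f by (metis orthogonal_transformation_def)
  then have "(\<integral>\<^sup>+u. ennreal (max 0 (u \<bullet> e) powr r) \<partial>sphere_measure)
      = (\<integral>\<^sup>+u. ennreal (max 0 (u \<bullet> e') powr r) \<partial>sphere_measure)"
    using nn_integral_sphere_orthogonal[OF f(1), of "\<lambda>u. ennreal (max 0 (u \<bullet> e') powr r)"] by simp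
  also have "\<dots> = ennreal (LINT u|sphere_measure. max 0 (u \<bullet> e') powr r)"
  proof (intro nn_integral_eq_integral S.integrable_const_bound[where B = 1])
    show "AE u in sphere_measure. norm (max 0 (u \<bullet> e') powr r) \<le> 1"
    proof (intro AE_I2)
      fix u :: "real^'n" assume "u \<in> space sphere_measure"
      then have "u \<bullet> e' \<le> 1" using norm_cauchy_schwarz[of u e'] e' by simp
      then show "norm (max 0 (u \<bullet> e') powr r) \<le> 1" using r by (auto intro!: powr_le1)
    qed
  qed auto
  also have "(LINT u|sphere_measure. max 0 (u \<bullet> e') powr r) = sphere_const TYPE(real^'n) r"
    using r by (simp add: sphere_const_def e'_def inner_commute)
  finally show ?thesis .
qed

lemma sphere_const_nonneg:
  assumes "r > 0"
  shows "sphere_const TYPE(real^'n) r \<ge> 0"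
  using assms by (simp add: sphere_const_def Let_def integral_nonneg_AE)

text \<open>In the plane the projection is the vector itself, so the length factor in the averaging
  formula is the total mass \<open>2 * pi\<close>, which cancels.\<close>

lemma sphere_const_2:
  assumes r: "r > 0"
  shows "sphere_const TYPE(real^2) r = cos_integral r"
proof -
  define e1 e2 :: "real^2" where "e1 = axis 1 1" and "e2 = axis 2 1"
  have e: "norm e1 = 1" "norm e2 = 1" "e1 \<bullet> e2 = 0"
    by (auto simp: e1_def e2_def inner_axis_axis)
  have norm: "sqrt ((u \<bullet> e1)\<^sup>2 + (u \<bullet> e2)\<^sup>2) = 1" if "norm u = 1" for u :: "real^2"
    using that by (simp add: norm_vec_def L2_set_def sum_2 e1_def e2_def inner_axis)
  let ?f = "\<lambda>(a::real, b::real). ennreal (max 0 a powr r)"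
  have "ennreal (2 * pi) * (\<integral>\<^sup>+u. ?f (u \<bullet> e1, u \<bullet> e2) \<partial>sphere_measure)
      = (\<integral>\<^sup>+u. ennreal (sqrt ((u \<bullet> e1)\<^sup>2 + (u \<bullet> e2)\<^sup>2) powr r) \<partial>sphere_measure) * circle_integral ?f"
  proof (rule nn_integral_sphere_plane[OF e r])
    show "?f \<in> borel_measurable borel"
      unfolding borel_prod[symmetric] by measurable
  qed (auto simp: pos_part_mult powr_mult ennreal_mult)
  also have "(\<integral>\<^sup>+u. ennreal (sqrt ((u \<bullet> e1)\<^sup>2 + (u \<bullet> e2)\<^sup>2) powr r) \<partial>sphere_measure)
      = (\<integral>\<^sup>+u. 1 \<partial>(sphere_measure :: (real^2) measure))"
    by (intro nn_integral_cong) (simp add: norm)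
  also have "\<dots> = ennreal (2 * pi)" using emeasure_sphere_measure_2 by simp
  finally show ?thesis
    using nn_integral_sphere_pos_part[OF r e(1)] sphere_const_nonneg[OF r, where 'n = 2] cos_integral_pos[OF r]
    by (simp add: circle_integral_cos[OF r] ennreal_mult_cancel_left)
qed

text \<open>The factor \<open>?C\<close> in the averaging formula depends on \<open>r\<close> and
  the plane, not on the integrand. For the positive part of a coordinate it satisfies
  \<open>2 * pi * sphere_const TYPE(real^'n) r = ?C * cos_integral r\<close>; the minimum brings in
  the same \<open>?C\<close>, and multiplying crosswise removes it.\<close>

lemma nn_integral_sphere_min:
  fixes e1 e2 :: "real^'n"
  assumes e: "norm e1 = 1" "norm e2 = 1" "e1 \<bullet> e2 = 0" and r: "r > 0" and t: "t \<ge> 0"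
  shows "ennreal (cos_integral r) * (\<integral>\<^sup>+u. ennreal (min (max 0 (cos \<phi> * (u \<bullet> e1) + sin \<phi> * (u \<bullet> e2)))
      (t * max 0 (u \<bullet> e1)) powr r) \<partial>sphere_measure)
    = ennreal (sphere_const TYPE(real^'n) r) * min_integral r t \<phi>"
proof -
  let ?f = "\<lambda>(a::real, b::real). ennreal (max 0 a powr r)"
  let ?g = "\<lambda>(a::real, b::real). ennreal (min (max 0 (cos \<phi> * a + sin \<phi> * b)) (t * max 0 a) powr r)"
  let ?C = "\<integral>\<^sup>+u. ennreal (sqrt ((u \<bullet> e1)\<^sup>2 + (u \<bullet> e2)\<^sup>2) powr r) \<partial>sphere_measure"
  have "ennreal (2 * pi) * (\<integral>\<^sup>+u. ?f (u \<bullet> e1, u \<bullet> e2) \<partial>sphere_measure) = ?C * circle_integral ?f"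
  proof (rule nn_integral_sphere_plane[OF e r])
    show "?f \<in> borel_measurable borel"
      unfolding borel_prod[symmetric] by measurable
  qed (auto simp: pos_part_mult powr_mult ennreal_mult)
  then have f: "ennreal (2 * pi) * ennreal (sphere_const TYPE(real^'n) r) = ?C * ennreal (cos_integral r)"
    using nn_integral_sphere_pos_part[OF r e(1)] by (simp add: circle_integral_cos[OF r])
  have g: "ennreal (2 * pi) * (\<integral>\<^sup>+u. ?g (u \<bullet> e1, u \<bullet> e2) \<partial>sphere_measure) = ?C * circle_integral ?g"
  proof (rule nn_integral_sphere_plane[OF e r])
    show "?g \<in> borel_measurable borel"
      unfolding borel_prod[symmetric] by measurable
    fix s a b :: real assume s: "s \<ge> 0"
    let ?m = "min (max 0 (cos \<phi> * a + sin \<phi> * b)) (t * max 0 a)"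
    have "cos \<phi> * (s * a) + sin \<phi> * (s * b) = s * (cos \<phi> * a + sin \<phi> * b)"
      by (simp only: distrib_left mult.left_commute)
    then have "min (max 0 (cos \<phi> * (s * a) + sin \<phi> * (s * b))) (t * max 0 (s * a)) = s * ?m"
      using s by (simp only: pos_part_mult min_mult_distrib_left mult.left_commute if_True)
    moreover have "ennreal ((s * ?m) powr r) = ennreal (s powr r) * ennreal (?m powr r)"
      unfolding powr_mult by (intro ennreal_mult) auto
    ultimately show "?g (s * a, s * b) = ennreal (s powr r) * ?g (a, b)"
      by (simp only: case_prod_conv)
  qed
  have "ennreal (2 * pi) * (ennreal (cos_integral r) * (\<integral>\<^sup>+u. ?g (u \<bullet> e1, u \<bullet> e2) \<partial>sphere_measure))
      = ennreal (cos_integral r) * (?C * circle_integral ?g)"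
    unfolding g[symmetric] by (simp add: mult_ac)
  also have "\<dots> = (?C * ennreal (cos_integral r)) * circle_integral ?g"
    by (simp only: mult.assoc mult.left_commute)
  also have "\<dots> = ennreal (2 * pi) * (ennreal (sphere_const TYPE(real^'n) r) * circle_integral ?g)"
    by (simp only: f[symmetric] mult.assoc)
  also have "circle_integral ?g = min_integral r t \<phi>"
    by (simp add: circle_integral_def min_integral_def cos_diff mult.commute)
  finally show ?thesis by (simp add: ennreal_mult_cancel_left)
qed

section \<open>Polar coordinates\<close>

text \<open>The image measure of \<open>N\<close> under \<open>f\<close> is determined by the
  sublevel sets, and its density is the derivative of \<open>c * R powr d\<close>. One statement
  serves both the norm of a vector, with \<open>d\<close> a dimension, and
  \<open>B * norm x powr r\<close>, with \<open>d\<close> a dimension divided by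
  \<open>r\<close>.\<close>

lemma nn_integral_powr_distribution:
  fixes f :: "'b \<Rightarrow> real"
  assumes f [measurable]: "f \<in> borel_measurable N" and nn: "\<And>x. x \<in> space N \<Longrightarrow> 0 \<le> f x"
    and d: "d > 0" and c: "c \<ge> 0"
    and level: "\<And>R. R > 0 \<Longrightarrow> emeasure N {x \<in> space N. f x \<le> R} = ennreal (c * R powr d)"
    and g [measurable]: "g \<in> borel_measurable borel"
  shows "(\<integral>\<^sup>+x. g (f x) \<partial>N)
    = (\<integral>\<^sup>+v. g v * ennreal (c * d * v powr (d - 1)) * indicator {0<..} v \<partial>lborel)"
proof -
  let ?h = "\<lambda>v. ennreal (c * d * v powr (d - 1)) * indicator {0<..} v"
  let ?E = "range (\<lambda>R::real. {..R})"
  have dens: "emeasure (density lborel ?h) {..R} = (if R > 0 then ennreal (c * R powr d) else 0)" for R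
  proof (cases "R > 0")
    case True
    have "emeasure (density lborel ?h) {..R} = (\<integral>\<^sup>+v. ?h v * indicator {..R} v \<partial>lborel)"
      by (intro emeasure_density) auto
    also have "\<dots> = (\<integral>\<^sup>+v. ennreal (c * d) * ennreal (indicator {0..R} v * v powr (d - 1)) \<partial>lborel)"
    proof (intro nn_integral_cong_AE)
      show "AE v in lborel. ?h v * indicator {..R} v
          = ennreal (c * d) * ennreal (indicator {0..R} v * v powr (d - 1))"
        using AE_lborel_singleton[of 0]
        by eventually_elim (use c d in \<open>auto simp: ennreal_mult split: split_indicator\<close>)
    qed
    also have "\<dots> = ennreal (c * d) * ennreal (R powr (d - 1 + 1) / (d - 1 + 1))"
      using has_integral_powr_from_0[of "d - 1" R] True d
      by (subst nn_integral_cmult) (auto intro!: arg_cong[of _ _ "(*) _"] nn_integral_has_integral_lebesgue)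
    also have "\<dots> = ennreal (c * R powr d)"
      using c d by (subst ennreal_mult[symmetric]) auto
    finally show ?thesis using True by simp
  next
    case False
    have "emeasure (density lborel ?h) {..R} = (\<integral>\<^sup>+v. ?h v * indicator {..R} v \<partial>lborel)"
      by (intro emeasure_density) auto
    also have "\<dots> = (\<integral>\<^sup>+v. 0 \<partial>(lborel :: real measure))"
      by (intro nn_integral_cong) (use False in \<open>auto split: split_indicator\<close>)
    finally show ?thesis using False by simp
  qed
  have pre: "emeasure (distr N borel f) {..R} = (if R > 0 then ennreal (c * R powr d) else 0)" for R
  proof (cases "R > 0")
    case True
    then show ?thesis using level[OF True] by (subst emeasure_distr) (auto simp: vimage_def Int_def conj_commute)
  next
    case False
    \<comment> \<open>For \<open>R \<le> 0\<close> the sublevel set is contained in those of all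
      positive levels, whose measures tend to 0.\<close>
    have le: "emeasure (distr N borel f) {..R} \<le> ennreal (c * \<epsilon> powr d)" if "\<epsilon> > 0" for \<epsilon>
    proof -
      have "emeasure (distr N borel f) {..R} = emeasure N (f -` {..R} \<inter> space N)"
        by (subst emeasure_distr) auto
      also have "\<dots> \<le> emeasure N {x \<in> space N. f x \<le> \<epsilon>}"
        using that False by (intro emeasure_mono) auto
      finally show ?thesis using level[OF that] by simp
    qed
    have pos: "eventually (\<lambda>\<epsilon>::real. \<epsilon> > 0) (at_right 0)" by (rule eventually_at_right_less)
    have "((\<lambda>\<epsilon>. \<epsilon> powr d) \<longlongrightarrow> 0 powr d) (at_right (0::real))"
      using d pos by (intro tendsto_powr' tendsto_ident_at tendsto_const) (auto elim: eventually_mono)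
    then have "((\<lambda>\<epsilon>. ennreal (c * \<epsilon> powr d)) \<longlongrightarrow> ennreal (c * 0)) (at_right 0)"
      by (intro tendsto_ennrealI tendsto_mult tendsto_const) simp
    then have "emeasure (distr N borel f) {..R} \<le> ennreal (c * 0)"
    proof (rule tendsto_lowerbound)
      show "eventually (\<lambda>\<epsilon>. emeasure (distr N borel f) {..R} \<le> ennreal (c * \<epsilon> powr d)) (at_right 0)"
        using pos by (rule eventually_mono) (rule le)
    qed simp
    then show ?thesis using False by simp
  qed
  have "distr N borel f = density lborel ?h"
  proof (rule measure_eqI_generator_eq[of ?E UNIV _ _ "\<lambda>i. {..real i}"])
    show "Int_stable ?E" by (auto simp: Int_stable_def)
    show "sets (distr N borel f) = sigma_sets UNIV ?E" "sets (density lborel ?h) = sigma_sets UNIV ?E"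
      by (simp_all add: borel_eq_atMost)
    show "(\<Union>i. {..real i}) = UNIV" by (auto intro: real_arch_simple)
  qed (auto simp: dens pre)
  then have "(\<integral>\<^sup>+v. g v \<partial>distr N borel f) = (\<integral>\<^sup>+v. g v \<partial>density lborel ?h)" by simp
  then show ?thesis by (simp add: nn_integral_distr nn_integral_density mult_ac)
qed

lemma borel_measurable_tan [measurable]: "tan \<in> borel_measurable (borel :: real measure)"
  unfolding tan_def[abs_def] by measurable

text \<open>Lebesgue measure is the image under the tangent of the measure with density 1 / cos^2 on
  the open interval. This is checked on boxes, by the fundamental theorem of calculus, and therefore
  extends to every nonnegative measurable integrand.\<close>

lemma nn_integral_tan_substitution:
  fixes g :: "real \<Rightarrow> ennreal"
  assumes [measurable]: "g \<in> borel_measurable borel"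
  shows "(\<integral>\<^sup>+y. g y \<partial>lborel)
    = (\<integral>\<^sup>+\<psi>. g (tan \<psi>) * ennreal (inverse ((cos \<psi>)\<^sup>2)) * indicator {- (pi / 2)<..<pi / 2} \<psi> \<partial>lborel)"
proof -
  let ?h = "\<lambda>\<psi>::real. ennreal (inverse ((cos \<psi>)\<^sup>2)) * indicator {- (pi / 2)<..<pi / 2} \<psi>"
  have "lborel = distr (density lborel ?h) borel tan"
  proof (rule lborel_eqI)
    fix l u :: real assume "\<And>b. b \<in> Basis \<Longrightarrow> l \<bullet> b \<le> u \<bullet> b"
    then have lu: "l \<le> u" by simp
    have "emeasure (distr (density lborel ?h) borel tan) (box l u)
        = emeasure (density lborel ?h) (tan -` {l<..<u})"
      by (subst emeasure_distr) (auto simp: box_real)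
    also have "\<dots> = (\<integral>\<^sup>+\<psi>. ?h \<psi> * indicator (tan -` {l<..<u}) \<psi> \<partial>lborel)"
      by (intro emeasure_density) (auto intro: measurable_sets_borel[OF borel_measurable_tan])
    also have "\<dots> = (\<integral>\<^sup>+\<psi>. ennreal (inverse ((cos \<psi>)\<^sup>2)) * indicator {arctan l..arctan u} \<psi> \<partial>lborel)"
    proof (intro nn_integral_cong_AE)
      show "AE \<psi> in lborel. ?h \<psi> * indicator (tan -` {l<..<u}) \<psi>
          = ennreal (inverse ((cos \<psi>)\<^sup>2)) * indicator {arctan l..arctan u} \<psi>"
        using AE_lborel_singleton[of "arctan l"] AE_lborel_singleton[of "arctan u"]
      proof eventually_elim
        case (elim \<psi>)
        show ?case
        proof (cases "\<psi> \<in> {- (pi / 2)<..<pi / 2}")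
          case True
          then have "\<psi> = arctan (tan \<psi>)" by (simp add: arctan_tan)
          then have "l < tan \<psi> \<longleftrightarrow> arctan l < \<psi>" "tan \<psi> < u \<longleftrightarrow> \<psi> < arctan u"
            by (metis arctan_less_iff)+
          then show ?thesis using True elim by (auto simp: indicator_def)
        next
          case False
          then show ?thesis using arctan_lbound[of l] arctan_ubound[of u] by (auto simp: indicator_def)
        qed
      qed
    qed
    also have "\<dots> = ennreal (tan (arctan u) - tan (arctan l))"
    proof (rule nn_integral_FTC_Icc)
      show "DERIV tan x :> inverse ((cos x)\<^sup>2)" if "x \<in> {arctan l..arctan u}" for x
        using that arctan_lbound[of l] arctan_ubound[of u] cos_gt_zero_pi[of x]
        by (intro DERIV_tan) auto
      show "arctan l \<le> arctan u" using lu by (simp add: arctan_le_iff)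
    qed auto
    finally show "emeasure (distr (density lborel ?h) borel tan) (box l u) = (\<Prod>b\<in>Basis. (u - l) \<bullet> b)"
      by (simp add: tan_arctan)
  qed simp
  then have "(\<integral>\<^sup>+y. g y \<partial>lborel) = (\<integral>\<^sup>+y. g y \<partial>distr (density lborel ?h) borel tan)" by simp
  also have "\<dots> = (\<integral>\<^sup>+\<psi>. g (tan \<psi>) * ennreal (inverse ((cos \<psi>)\<^sup>2)) * indicator {- (pi / 2)<..<pi / 2} \<psi> \<partial>lborel)"
    by (simp add: nn_integral_distr nn_integral_density mult_ac)
  finally show ?thesis .
qed

text \<open>In the product of the coordinate lines the axis \<open>b\<close> is split off. The
  remaining coordinates enter only through their norm, whose sublevel sets are balls of one
  dimension less.\<close>

lemma nn_integral_lborel_split_coordinate: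
  fixes h :: "real \<Rightarrow> real \<Rightarrow> ennreal" and b :: "'a::euclidean_space"
  assumes [measurable]: "case_prod h \<in> borel_measurable borel" and b: "b \<in> Basis" and n: "DIM('a) \<ge> 2"
  shows "(\<integral>\<^sup>+x. h (norm x) (x \<bullet> b) \<partial>lborel)
    = (\<integral>\<^sup>+y. (\<integral>\<^sup>+v. h (sqrt (y\<^sup>2 + v\<^sup>2)) y *
        ennreal (unit_ball_vol (real (DIM('a) - 1)) * real (DIM('a) - 1) * v powr (real (DIM('a) - 1) - 1))
        * indicator {0<..} v \<partial>lborel) \<partial>lborel)"
proof -
  have hm [measurable (raw)]: "(\<lambda>x. h (f x) (g x)) \<in> borel_measurable N"
    if "f \<in> borel_measurable N" "g \<in> borel_measurable N" for f g and N :: "'z measure"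
    using measurable_compose[OF measurable_Pair[OF that] assms(1)[folded borel_prod]] by simp
  let ?I = "Basis - {b} :: 'a set"
  interpret product_sigma_finite "\<lambda>_::'a. lborel :: real measure" ..
  have ins: "insert b ?I = Basis" using b by blast
  have card: "card ?I = DIM('a) - 1" using b by simp
  let ?G = "\<lambda>f :: 'a \<Rightarrow> real. h (sqrt (\<Sum>i\<in>Basis. (f i)\<^sup>2)) (f b)"
  have norm: "norm (\<Sum>i\<in>Basis. f i *\<^sub>R i) = sqrt (\<Sum>i\<in>Basis. (f i)\<^sup>2)" for f :: "'a \<Rightarrow> real"
    unfolding norm_eq_sqrt_inner
    by (subst euclidean_inner)
       (auto simp: inner_sum_left inner_Basis power2_eq_square if_distrib intro!: arg_cong[of _ _ sqrt] sum.cong cong: if_cong)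
  have "(\<integral>\<^sup>+x. h (norm x) (x \<bullet> b) \<partial>lborel) = (\<integral>\<^sup>+f. ?G f \<partial>Pi\<^sub>M Basis (\<lambda>_. lborel))"
    using b by (subst lborel_eq, subst nn_integral_distr)
      (auto simp: norm inner_sum_left inner_Basis if_distrib cong: if_cong)
  also have "\<dots> = (\<integral>\<^sup>+f. ?G f \<partial>Pi\<^sub>M (insert b ?I) (\<lambda>_. lborel))" by (simp only: ins)
  also have "\<dots> = (\<integral>\<^sup>+y. (\<integral>\<^sup>+f. ?G (f(b := y)) \<partial>Pi\<^sub>M ?I (\<lambda>_. lborel)) \<partial>lborel)"
  proof (rule product_nn_integral_insert_rev)
    show "?G \<in> borel_measurable (Pi\<^sub>M (insert b ?I) (\<lambda>_. lborel))"
      unfolding ins using b by measurable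
  qed auto
  also have "\<dots> = (\<integral>\<^sup>+y. (\<integral>\<^sup>+f. h (sqrt (y\<^sup>2 + (sqrt (\<Sum>i\<in>?I. (f i)\<^sup>2))\<^sup>2)) y \<partial>Pi\<^sub>M ?I (\<lambda>_. lborel)) \<partial>lborel)"
  proof (intro nn_integral_cong)
    fix y and f :: "'a \<Rightarrow> real"
    have "(\<Sum>i\<in>Basis. ((f(b := y)) i)\<^sup>2) = y\<^sup>2 + (\<Sum>i\<in>?I. ((f(b := y)) i)\<^sup>2)"
      using b by (subst sum.remove[of _ b]) auto
    also have "(\<Sum>i\<in>?I. ((f(b := y)) i)\<^sup>2) = (\<Sum>i\<in>?I. (f i)\<^sup>2)" by (intro sum.cong) auto
    finally show "?G (f(b := y)) = h (sqrt (y\<^sup>2 + (sqrt (\<Sum>i\<in>?I. (f i)\<^sup>2))\<^sup>2)) y"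
      by (simp add: sum_nonneg)
  qed
  also have "\<dots> = (\<integral>\<^sup>+y. (\<integral>\<^sup>+v. h (sqrt (y\<^sup>2 + v\<^sup>2)) y *
        ennreal (unit_ball_vol (real (DIM('a) - 1)) * real (DIM('a) - 1) * v powr (real (DIM('a) - 1) - 1))
        * indicator {0<..} v \<partial>lborel) \<partial>lborel)"
  proof (intro nn_integral_cong)
    fix y
    show "(\<integral>\<^sup>+f. h (sqrt (y\<^sup>2 + (sqrt (\<Sum>i\<in>?I. (f i)\<^sup>2))\<^sup>2)) y \<partial>Pi\<^sub>M ?I (\<lambda>_. lborel))
      = (\<integral>\<^sup>+v. h (sqrt (y\<^sup>2 + v\<^sup>2)) y *
        ennreal (unit_ball_vol (real (DIM('a) - 1)) * real (DIM('a) - 1) * v powr (real (DIM('a) - 1) - 1))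
        * indicator {0<..} v \<partial>lborel)"
    proof (rule nn_integral_powr_distribution[where f = "\<lambda>f. sqrt (\<Sum>i\<in>?I. (f i)\<^sup>2)" and g = "\<lambda>v. h (sqrt (y\<^sup>2 + v\<^sup>2)) y"])
      fix R :: real assume "R > 0"
      then show "emeasure (Pi\<^sub>M ?I (\<lambda>_. lborel)) {f \<in> space (Pi\<^sub>M ?I (\<lambda>_. lborel)). sqrt (\<Sum>i\<in>?I. (f i)\<^sup>2) \<le> R}
          = ennreal (unit_ball_vol (real (DIM('a) - 1)) * R powr real (DIM('a) - 1))"
        using emeasure_cball_aux[of ?I R] powr_realpow[of R "DIM('a) - 1"]
        by (simp add: card Int_def conj_commute del: of_nat_diff)
    qed (use n in \<open>auto simp: sum_nonneg\<close>)
  qed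
  finally show ?thesis .
qed

text \<open>Two one-dimensional substitutions: with \<open>y\<close> the coordinate along
  \<open>b\<close> and \<open>v\<close> the distance from the axis,
  \<open>y = v * tan \<psi>\<close> at fixed \<open>v\<close> and then
  \<open>v = s * cos \<psi>\<close> at fixed \<psi>; finally
  \<open>\<phi> = pi / 2 - \<psi>\<close>. For a function of the norm and one coordinate no surface
  measure has to be introduced.\<close>

lemma nn_integral_lborel_polar:
  fixes h :: "real \<Rightarrow> real \<Rightarrow> ennreal" and b :: "'a::euclidean_space"
  assumes h: "case_prod h \<in> borel_measurable borel" and b: "b \<in> Basis" and n: "DIM('a) \<ge> 2"
  shows "(\<integral>\<^sup>+x. h (norm x) (x \<bullet> b) \<partial>lborel)
    = (\<integral>\<^sup>+\<phi>. (\<integral>\<^sup>+s. h s (s * cos \<phi>) *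
        ennreal (unit_ball_vol (real (DIM('a) - 1)) * real (DIM('a) - 1) * s ^ (DIM('a) - 1) * sin \<phi> ^ (DIM('a) - 2))
        * indicator {0<..} s \<partial>lborel) * indicator {0<..<pi} \<phi> \<partial>lborel)"
proof -
  have hm [measurable (raw)]: "(\<lambda>x. h (f x) (g x)) \<in> borel_measurable N"
    if "f \<in> borel_measurable N" "g \<in> borel_measurable N" for f g and N :: "'z measure"
    using measurable_compose[OF measurable_Pair[OF that] h[folded borel_prod]] by simp
  define k where "k = DIM('a) - 2"
  have k: "DIM('a) - 1 = Suc k" "DIM('a) - 2 = k" using n by (auto simp: k_def)
  define C where "C = unit_ball_vol (real (DIM('a) - 1)) * real (DIM('a) - 1)"
  have C: "C \<ge> 0" by (simp add: C_def)
  let ?J = "{- (pi / 2)<..<pi / 2}"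
  have "(\<integral>\<^sup>+x. h (norm x) (x \<bullet> b) \<partial>lborel)
    = (\<integral>\<^sup>+y. (\<integral>\<^sup>+v. h (sqrt (y\<^sup>2 + v\<^sup>2)) y * ennreal (C * v ^ k) * indicator {0<..} v \<partial>lborel) \<partial>lborel)"
  proof -
    have "ennreal (unit_ball_vol (real (DIM('a) - 1)) * real (DIM('a) - 1) * v powr (real (DIM('a) - 1) - 1))
        * indicator {0<..} v = ennreal (C * v ^ k) * indicator {0<..} v" for v
      unfolding C_def[symmetric]
      by (cases "v > 0") (simp_all add: k(1)[unfolded One_nat_def] powr_realpow del: of_nat_diff)
    then show ?thesis
      unfolding nn_integral_lborel_split_coordinate[OF h b n] by (simp only: mult.assoc)
  qed
  also have "\<dots> = (\<integral>\<^sup>+v. (\<integral>\<^sup>+y. h (sqrt (y\<^sup>2 + v\<^sup>2)) y * ennreal (C * v ^ k) * indicator {0<..} v \<partial>lborel) \<partial>lborel)"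
    by (rule lborel_pair.Fubini') measurable
  also have "\<dots> = (\<integral>\<^sup>+v. (\<integral>\<^sup>+\<psi>. h (v / cos \<psi>) (v * tan \<psi>) * ennreal (C * v ^ Suc k * inverse ((cos \<psi>)\<^sup>2))
      * indicator {0<..} v * indicator ?J \<psi> \<partial>lborel) \<partial>lborel)"
  proof (rule nn_integral_cong)
    fix v :: real
    show "(\<integral>\<^sup>+y. h (sqrt (y\<^sup>2 + v\<^sup>2)) y * ennreal (C * v ^ k) * indicator {0<..} v \<partial>lborel)
      = (\<integral>\<^sup>+\<psi>. h (v / cos \<psi>) (v * tan \<psi>) * ennreal (C * v ^ Suc k * inverse ((cos \<psi>)\<^sup>2))
      * indicator {0<..} v * indicator ?J \<psi> \<partial>lborel)"
    proof (cases "v > 0")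
      case True
      have "(\<integral>\<^sup>+y. h (sqrt (y\<^sup>2 + v\<^sup>2)) y * ennreal (C * v ^ k) * indicator {0<..} v \<partial>lborel)
          = ennreal v * (\<integral>\<^sup>+z. h (sqrt ((v * z)\<^sup>2 + v\<^sup>2)) (v * z) * ennreal (C * v ^ k) \<partial>lborel)"
        using True by (subst nn_integral_real_affine[where c = v and t = 0]) auto
      also have "\<dots> = (\<integral>\<^sup>+z. ennreal v * (h (sqrt ((v * z)\<^sup>2 + v\<^sup>2)) (v * z) * ennreal (C * v ^ k)) \<partial>lborel)"
        by (intro nn_integral_cmult[symmetric]) measurable
      also have "\<dots> = (\<integral>\<^sup>+\<psi>. ennreal v * (h (sqrt ((v * tan \<psi>)\<^sup>2 + v\<^sup>2)) (v * tan \<psi>) * ennreal (C * v ^ k))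
          * ennreal (inverse ((cos \<psi>)\<^sup>2)) * indicator ?J \<psi> \<partial>lborel)"
        by (rule nn_integral_tan_substitution) measurable
      also have "\<dots> = (\<integral>\<^sup>+\<psi>. h (v / cos \<psi>) (v * tan \<psi>) * ennreal (C * v ^ Suc k * inverse ((cos \<psi>)\<^sup>2))
          * indicator {0<..} v * indicator ?J \<psi> \<partial>lborel)"
      proof (intro nn_integral_cong, cases)
        fix \<psi> assume \<psi>: "\<psi> \<in> ?J"
        then have c: "cos \<psi> > 0" by (intro cos_gt_zero_pi) auto
        have "(v * tan \<psi>)\<^sup>2 + v\<^sup>2 = (v / cos \<psi>)\<^sup>2"
        proof -
          have "(v * tan \<psi>)\<^sup>2 + v\<^sup>2 = v\<^sup>2 * (1 + (tan \<psi>)\<^sup>2)"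
            by (simp add: power_mult_distrib distrib_left)
          also have "1 + (tan \<psi>)\<^sup>2 = (inverse (cos \<psi>))\<^sup>2" using c by (intro tan_sec) simp
          finally show ?thesis by (simp add: power_mult_distrib divide_inverse)
        qed
        then have "sqrt ((v * tan \<psi>)\<^sup>2 + v\<^sup>2) = v / cos \<psi>" using c True by simp
        moreover have "ennreal (C * v ^ Suc k * inverse ((cos \<psi>)\<^sup>2))
            = ennreal v * ennreal (C * v ^ k) * ennreal (inverse ((cos \<psi>)\<^sup>2))"
          using C True by (subst ennreal_mult[symmetric]; simp add: mult_ac)+
        ultimately show "ennreal v * (h (sqrt ((v * tan \<psi>)\<^sup>2 + v\<^sup>2)) (v * tan \<psi>) * ennreal (C * v ^ k))
          * ennreal (inverse ((cos \<psi>)\<^sup>2)) * indicator ?J \<psi>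
          = h (v / cos \<psi>) (v * tan \<psi>) * ennreal (C * v ^ Suc k * inverse ((cos \<psi>)\<^sup>2))
          * indicator {0<..} v * indicator ?J \<psi>"
          using True by (simp add: mult_ac)
      next
        fix \<psi> assume "\<psi> \<notin> ?J"
        then have "indicator ?J \<psi> = (0::ennreal)" by simp
        then show "ennreal v * (h (sqrt ((v * tan \<psi>)\<^sup>2 + v\<^sup>2)) (v * tan \<psi>) * ennreal (C * v ^ k))
          * ennreal (inverse ((cos \<psi>)\<^sup>2)) * indicator ?J \<psi>
          = h (v / cos \<psi>) (v * tan \<psi>) * ennreal (C * v ^ Suc k * inverse ((cos \<psi>)\<^sup>2))
          * indicator {0<..} v * indicator ?J \<psi>"
          by (simp only: mult_zero_right)
      qed
      finally show ?thesis .
    next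
      case False
      then show ?thesis by simp
    qed
  qed
  also have "\<dots> = (\<integral>\<^sup>+\<psi>. (\<integral>\<^sup>+v. h (v / cos \<psi>) (v * tan \<psi>) * ennreal (C * v ^ Suc k * inverse ((cos \<psi>)\<^sup>2))
      * indicator {0<..} v * indicator ?J \<psi> \<partial>lborel) \<partial>lborel)"
    by (rule lborel_pair.Fubini') measurable
  also have "\<dots> = (\<integral>\<^sup>+\<psi>. (\<integral>\<^sup>+s. h s (s * sin \<psi>) * ennreal (C * s ^ Suc k * cos \<psi> ^ k)
      * indicator {0<..} s \<partial>lborel) * indicator ?J \<psi> \<partial>lborel)"
  proof (intro nn_integral_cong)
    fix \<psi> :: real
    show "(\<integral>\<^sup>+v. h (v / cos \<psi>) (v * tan \<psi>) * ennreal (C * v ^ Suc k * inverse ((cos \<psi>)\<^sup>2))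
      * indicator {0<..} v * indicator ?J \<psi> \<partial>lborel)
      = (\<integral>\<^sup>+s. h s (s * sin \<psi>) * ennreal (C * s ^ Suc k * cos \<psi> ^ k)
      * indicator {0<..} s \<partial>lborel) * indicator ?J \<psi>"
    proof (cases "\<psi> \<in> ?J")
      case True
      then have c: "cos \<psi> > 0" by (intro cos_gt_zero_pi) auto
      have "(\<integral>\<^sup>+v. h (v / cos \<psi>) (v * tan \<psi>) * ennreal (C * v ^ Suc k * inverse ((cos \<psi>)\<^sup>2))
          * indicator {0<..} v * indicator ?J \<psi> \<partial>lborel)
        = ennreal (cos \<psi>) * (\<integral>\<^sup>+s. h ((cos \<psi> * s) / cos \<psi>) ((cos \<psi> * s) * tan \<psi>) *
          ennreal (C * (cos \<psi> * s) ^ Suc k * inverse ((cos \<psi>)\<^sup>2)) * indicator {0<..} (cos \<psi> * s) \<partial>lborel)"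
        using c True by (subst nn_integral_real_affine[where c = "cos \<psi>" and t = 0]) auto
      also have "\<dots> = (\<integral>\<^sup>+s. ennreal (cos \<psi>) * (h ((cos \<psi> * s) / cos \<psi>) ((cos \<psi> * s) * tan \<psi>) *
          ennreal (C * (cos \<psi> * s) ^ Suc k * inverse ((cos \<psi>)\<^sup>2)) * indicator {0<..} (cos \<psi> * s)) \<partial>lborel)"
        by (intro nn_integral_cmult[symmetric]) measurable
      also have "\<dots> = (\<integral>\<^sup>+s. h s (s * sin \<psi>) * ennreal (C * s ^ Suc k * cos \<psi> ^ k) * indicator {0<..} s \<partial>lborel)"
      proof (intro nn_integral_cong, cases)
        fix s :: real assume s: "s \<in> {0<..}"
        have comm: "a * (x * b * y) = x * (a * b) * y" for a b x y :: ennreal by (simp add: mult_ac)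
        have "ennreal (cos \<psi>) * ennreal (C * (cos \<psi> * s) ^ Suc k * inverse ((cos \<psi>)\<^sup>2))
            = ennreal (C * s ^ Suc k * cos \<psi> ^ k)"
          using c by (subst ennreal_mult'[symmetric])
            (auto simp: power_mult_distrib power2_eq_square field_simps)
        then have e: "ennreal (cos \<psi>) * (x * ennreal (C * (cos \<psi> * s) ^ Suc k * inverse ((cos \<psi>)\<^sup>2)) * y)
            = x * ennreal (C * s ^ Suc k * cos \<psi> ^ k) * y" for x y
          using comm[of "ennreal (cos \<psi>)" x "ennreal (C * (cos \<psi> * s) ^ Suc k * inverse ((cos \<psi>)\<^sup>2))" y]
          by (simp only:)
        have "cos \<psi> * s * tan \<psi> = s * sin \<psi>" "(cos \<psi> * s) / cos \<psi> = s"
          "indicator {0<..} (cos \<psi> * s) = (indicator {0<..} s :: ennreal)"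
          using c s by (simp_all add: tan_def)
        then show "ennreal (cos \<psi>) * (h ((cos \<psi> * s) / cos \<psi>) ((cos \<psi> * s) * tan \<psi>) *
          ennreal (C * (cos \<psi> * s) ^ Suc k * inverse ((cos \<psi>)\<^sup>2)) * indicator {0<..} (cos \<psi> * s))
          = h s (s * sin \<psi>) * ennreal (C * s ^ Suc k * cos \<psi> ^ k) * indicator {0<..} s"
          by (simp only: e)
      next
        fix s :: real assume s: "s \<notin> {0<..}"
        then show "ennreal (cos \<psi>) * (h ((cos \<psi> * s) / cos \<psi>) ((cos \<psi> * s) * tan \<psi>) *
          ennreal (C * (cos \<psi> * s) ^ Suc k * inverse ((cos \<psi>)\<^sup>2)) * indicator {0<..} (cos \<psi> * s))
          = h s (s * sin \<psi>) * ennreal (C * s ^ Suc k * cos \<psi> ^ k) * indicator {0<..} s"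
          using c by (auto simp: zero_less_mult_iff)
      qed
      finally show ?thesis using True by simp
    qed simp
  qed
  also have "\<dots> = (\<integral>\<^sup>+\<phi>. (\<integral>\<^sup>+s. h s (s * cos \<phi>) * ennreal (C * s ^ Suc k * sin \<phi> ^ k)
      * indicator {0<..} s \<partial>lborel) * indicator {0<..<pi} \<phi> \<partial>lborel)"
    by (subst nn_integral_real_affine[where c = "-1" and t = "pi / 2"])
       (auto simp: sin_diff cos_diff intro!: nn_integral_cong split: split_indicator)
  finally show ?thesis unfolding C_def k .
qed

text \<open>Translation and reflection invariance suffice. The integral is multiplied by the volume
  of the unit ball, written as the integral of \<open>indicator ?B (f x + y)\<close> over
  \<open>y\<close>. After Fubini and a translation of \<open>x\<close> the variable \<open>y\<close>
  occurs only in \<open>g (f x - y)\<close>, and \<open>f\<close> preserves the norm.\<close>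

lemma nn_integral_lborel_orthogonal:
  fixes f :: "'a::euclidean_space \<Rightarrow> 'a" and g :: "'a \<Rightarrow> ennreal"
  assumes f: "orthogonal_transformation f" and [measurable]: "g \<in> borel_measurable borel"
  shows "(\<integral>\<^sup>+x. g (f x) \<partial>lborel) = (\<integral>\<^sup>+x. g x \<partial>lborel)"
proof -
  have [measurable]: "f \<in> borel \<rightarrow>\<^sub>M borel"
    by (rule borel_measurable_orthogonal_transformation[OF f])
  let ?B = "cball (0::'a) 1"
  have [measurable]: "?B \<in> sets borel" by simp
  have pos: "emeasure lborel ?B \<noteq> 0" "emeasure lborel ?B \<noteq> \<infinity>"
    using emeasure_lborel_cball_finite[of "0::'a" 1] unit_ball_vol_pos[of "real DIM('a)", THEN less_imp_neq]
    by (auto simp: emeasure_cball)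
  \<comment> \<open>A preimage under \<open>f\<close> turns a shift of the value by \<open>y\<close>
    into a shift of the argument.\<close>
  obtain f' where f': "\<And>x. f (f' x) = x"
    using f by (metis orthogonal_transformation_surj surj_f_inv_f)
  have lin: "f (x - f' y) = f x - y" for x y
    using linear_diff[OF orthogonal_transformation_linear[OF f], of x "f' y"] f' by simp
  have shift: "(\<integral>\<^sup>+x. k (x + c) \<partial>lborel) = (\<integral>\<^sup>+x. k x \<partial>lborel)"
    if [measurable]: "k \<in> borel_measurable borel" for k :: "'a \<Rightarrow> ennreal" and c
    by (subst (2) lborel_affine[of 1 c])
       (simp_all add: nn_integral_density nn_integral_distr add.commute)
  have reflect: "(\<integral>\<^sup>+x. k (c - x) \<partial>lborel) = (\<integral>\<^sup>+x. k x \<partial>lborel)"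
    if [measurable]: "k \<in> borel_measurable borel" for k :: "'a \<Rightarrow> ennreal" and c
    by (subst (2) lborel_affine[of "-1" c])
       (simp_all add: nn_integral_density nn_integral_distr)
  have "(\<integral>\<^sup>+x. g (f x) \<partial>lborel) * emeasure lborel ?B
      = (\<integral>\<^sup>+x. g (f x) * (\<integral>\<^sup>+y. indicator ?B (f x + y) \<partial>lborel) \<partial>lborel)"
  proof -
    have "(\<integral>\<^sup>+y. indicator ?B (f x + y) \<partial>lborel) = emeasure lborel ?B" for x
      using shift[of "indicator ?B" "f x"] by (simp add: add.commute[of _ "f x"] borel_measurable_indicator)
    then show ?thesis by (simp add: nn_integral_multc)
  qed
  also have "\<dots> = (\<integral>\<^sup>+x. (\<integral>\<^sup>+y. g (f x) * indicator ?B (f x + y) \<partial>lborel) \<partial>lborel)"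
    by (intro nn_integral_cong nn_integral_cmult[symmetric]) measurable
  also have "\<dots> = (\<integral>\<^sup>+y. (\<integral>\<^sup>+x. g (f x) * indicator ?B (f x + y) \<partial>lborel) \<partial>lborel)"
    by (rule lborel_pair.Fubini') measurable
  also have "\<dots> = (\<integral>\<^sup>+y. (\<integral>\<^sup>+x. g (f x - y) * indicator ?B (f x) \<partial>lborel) \<partial>lborel)"
  proof (rule nn_integral_cong)
    fix y
    show "(\<integral>\<^sup>+x. g (f x) * indicator ?B (f x + y) \<partial>lborel) = (\<integral>\<^sup>+x. g (f x - y) * indicator ?B (f x) \<partial>lborel)"
      using shift[of "\<lambda>x. g (f x) * indicator ?B (f x + y)" "- f' y"] by (simp add: lin)
  qed
  also have "\<dots> = (\<integral>\<^sup>+x. (\<integral>\<^sup>+y. g (f x - y) * indicator ?B (f x) \<partial>lborel) \<partial>lborel)"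
    by (rule lborel_pair.Fubini') measurable
  also have "\<dots> = (\<integral>\<^sup>+x. (\<integral>\<^sup>+y. g y \<partial>lborel) * indicator ?B (f x) \<partial>lborel)"
    by (simp add: nn_integral_multc reflect)
  also have "\<dots> = (\<integral>\<^sup>+y. g y \<partial>lborel) * (\<integral>\<^sup>+x. indicator ?B x \<partial>lborel)"
  proof -
    have "indicator ?B (f x) = (indicator ?B x :: ennreal)" for x
      using f by (simp add: indicator_def orthogonal_transformation_norm)
    then show ?thesis by (subst nn_integral_cmult) auto
  qed
  also have "(\<integral>\<^sup>+x. indicator ?B x \<partial>lborel) = emeasure lborel ?B" by simp
  finally show ?thesis using pos by (simp add: ennreal_mult_cancel_left mult.commute[of _ "emeasure lborel ?B"])
qed

text \<open>The sublevel sets of \<open>v = B * norm x powr r\<close> have volumes proportional to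
  the level to the power dimension over \<open>r\<close>, so the integral becomes the one over the
  half-line that defines Gamma.\<close>

lemma nn_integral_norm_powr_exp:
  fixes a B r :: real
  assumes r: "r > 0" and B: "B > 0" and a: "a \<ge> 0"
  shows "(\<integral>\<^sup>+x. ennreal (norm x powr a * exp (- B * norm x powr r)) \<partial>(lborel :: 'a::euclidean_space measure))
    = ennreal (unit_ball_vol (real DIM('a)) * (real DIM('a) / r) * B powr (- (real DIM('a) + a) / r)
        * Gamma ((real DIM('a) + a) / r))"
proof -
  let ?n = "real DIM('a)"
  let ?c = "unit_ball_vol ?n * B powr (- ?n / r)" and ?d = "?n / r"
  let ?s = "(?n + a) / r"
  have s: "?s > 0" using r a by (intro divide_pos_pos add_pos_nonneg) auto
  let ?g = "\<lambda>v. ennreal ((v / B) powr (a / r) * exp (- v))"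
  have "(\<integral>\<^sup>+x. ennreal (norm x powr a * exp (- B * norm x powr r)) \<partial>(lborel :: 'a measure))
      = (\<integral>\<^sup>+x. ?g (B * norm x powr r) \<partial>(lborel :: 'a measure))"
    using B r by (intro nn_integral_cong) (simp add: powr_powr)
  also have "\<dots> = (\<integral>\<^sup>+v. ?g v * ennreal (?c * ?d * v powr (?d - 1)) * indicator {0<..} v \<partial>lborel)"
  proof (rule nn_integral_powr_distribution)
    fix R :: real assume R: "R > 0"
    have "B * norm x powr r \<le> R \<longleftrightarrow> norm x \<le> (R / B) powr (1 / r)" for x :: 'a
    proof -
      have "B * norm x powr r \<le> R \<longleftrightarrow> norm x powr r \<le> R / B" using B by (simp add: field_simps)
      also have "R / B = ((R / B) powr (1 / r)) powr r" using R B r by (simp add: powr_powr)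
      also have "norm x powr r \<le> ((R / B) powr (1 / r)) powr r \<longleftrightarrow> norm x \<le> (R / B) powr (1 / r)"
        using r powr_less_mono2[of r "(R / B) powr (1 / r)" "norm x"] powr_mono2[of r "norm x" "(R / B) powr (1 / r)"]
        by (cases "norm x \<le> (R / B) powr (1 / r)") auto
      finally show ?thesis .
    qed
    then have "{x \<in> space (lborel :: 'a measure). B * norm x powr r \<le> R} = cball 0 ((R / B) powr (1 / r))"
      by (simp only: set_eq_iff mem_Collect_eq mem_cball_0 space_lborel UNIV_I simp_thms) simp
    moreover have "emeasure lborel (cball (0::'a) ((R / B) powr (1 / r))) = ennreal (?c * R powr ?d)"
    proof -
      have "((R / B) powr (1 / r)) ^ DIM('a) = ((R / B) powr (1 / r)) powr ?n"
        using R B by (intro powr_realpow[symmetric]) auto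
      also have "\<dots> = (R / B) powr ?d" by (simp add: powr_powr)
      also have "\<dots> = R powr ?d * B powr (- ?d)"
        using R B by (subst powr_divide) (simp_all add: powr_minus divide_inverse)
      finally show ?thesis by (subst emeasure_cball) (simp_all add: mult_ac)
    qed
    ultimately show "emeasure lborel {x \<in> space (lborel :: 'a measure). B * norm x powr r \<le> R} = ennreal (?c * R powr ?d)"
      by simp
  qed (use B r in auto)
  also have "\<dots> = (\<integral>\<^sup>+v. ennreal (?c * ?d * B powr (- a / r)) *
      ennreal (indicator {0..} v * v powr (?s - 1) / exp v) \<partial>lborel)"
  proof (intro nn_integral_cong_AE)
    show "AE v in lborel. ?g v * ennreal (?c * ?d * v powr (?d - 1)) * indicator {0<..} v
        = ennreal (?c * ?d * B powr (- a / r)) * ennreal (indicator {0..} v * v powr (?s - 1) / exp v)"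
      using AE_lborel_singleton[of "0::real"]
    proof eventually_elim
      case (elim v)
      show ?case
      proof (cases "v > 0")
        case True
        have s1: "?s - 1 = a / r + (?d - 1)" by (simp add: add_divide_distrib)
        have "(v / B) powr (a / r) * exp (- v) * (?c * ?d * v powr (?d - 1))
            = ?c * ?d * B powr (- a / r) * (v powr (?s - 1) / exp v)"
          unfolding s1 powr_add[of v "a / r"]
          using True B by (subst powr_divide) (simp_all add: powr_minus exp_minus divide_inverse mult_ac)
        then show ?thesis using True B r
          by (simp flip: ennreal_mult)
      qed (use elim in \<open>auto split: split_indicator\<close>)
    qed
  qed
  also have "\<dots> = ennreal (?c * ?d * B powr (- a / r)) * ennreal (Gamma ?s)"
    unfolding Gamma_conv_nn_integral_real[OF s] by (intro nn_integral_cmult) measurable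
  also have "\<dots> = ennreal (?c * ?d * B powr (- a / r) * Gamma ?s)"
    using r B s by (intro ennreal_mult[symmetric]) (auto intro: Gamma_real_nonneg)
  also have "B powr (- (?n + a) / r) = B powr (- ?n / r) * B powr (- a / r)"
    by (simp add: powr_add[symmetric] add_divide_distrib diff_divide_distrib)
  then have "?c * ?d * B powr (- a / r) * Gamma ?s
      = unit_ball_vol ?n * (?n / r) * B powr (- (?n + a) / r) * Gamma ?s" by simp
  finally show ?thesis .
qed

section \<open>The zero cell\<close>

text \<open>The origin is on the closed side and \<open>q\<close> lies more than \<epsilon> beyond
  the hyperplane. The value \<open>t = 0\<close> is allowed, in accordance with the intersection of
  both half-spaces in \<open>origin_halfspace\<close>. A positive margin keeps a whole neighbourhood
  of \<open>q\<close> cut off.\<close>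

definition separating :: "'a::euclidean_space \<Rightarrow> real \<Rightarrow> 'a set set" where
  "separating q \<epsilon> = {hyperplane u t |u t. u \<in> sphere 0 1 \<and> 0 \<le> t \<and> t + \<epsilon> < q \<bullet> u}"

lemma mem_zero_cell_iff: "x \<in> zero_cell X \<longleftrightarrow> X \<inter> separating x 0 = {}"
proof -
  have "x \<in> origin_halfspace H \<longleftrightarrow> (\<forall>u t. u \<in> sphere 0 1 \<and> H = hyperplane u t \<and> 0 \<le> t \<longrightarrow> x \<bullet> u \<le> t)" for H
  proof (intro iffI allI impI)
    fix u t assume x: "x \<in> origin_halfspace H" and ut: "u \<in> sphere 0 1 \<and> H = hyperplane u t \<and> 0 \<le> t"
    then have "{z. z \<bullet> u \<le> t} \<in> {K. \<exists>u t. u \<in> sphere 0 1 \<and> H = hyperplane u t \<and> K = {x. x \<bullet> u \<le> t} \<and> 0 \<in> K}"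
      by auto
    with x show "x \<bullet> u \<le> t" unfolding origin_halfspace_def by blast
  qed (auto simp: origin_halfspace_def)
  then have "x \<in> origin_halfspace H \<longleftrightarrow> H \<notin> separating x 0" for H
    unfolding separating_def by (auto simp: not_less)
  then show ?thesis unfolding zero_cell_def by auto
qed

text \<open>Two test points decide: \<open>t *\<^sub>R u\<close> and its translate by the part of
  \<open>v\<close> orthogonal to \<open>u\<close>. The equation for \<open>v\<close> and
  \<open>s\<close> at both of them forces \<open>1 - c * c = 0\<close> for the cosine
  \<open>c\<close> of the angle between the normals.\<close>

lemma hyperplane_eq_imp:
  fixes u v :: "'a::euclidean_space"
  assumes u: "u \<in> sphere 0 1" and v: "v \<in> sphere 0 1" and eq: "hyperplane u t = hyperplane v s"
  shows "(v = u \<and> s = t) \<or> (v = - u \<and> s = - t)"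
proof -
  have nu: "u \<bullet> u = 1" "v \<bullet> v = 1" using u v by (auto simp: norm_eq_1[symmetric])
  define c where "c = u \<bullet> v"
  have "t *\<^sub>R u \<in> hyperplane v s" "t *\<^sub>R u + (v - c *\<^sub>R u) \<in> hyperplane v s"
    unfolding eq[symmetric] using nu
    by (auto simp: hyperplane_def c_def inner_add_left inner_diff_left inner_commute[of v u])
  then have s: "t * c = s" and "1 - c * c = 0"
    using nu by (auto simp: hyperplane_def c_def inner_add_left inner_diff_left)
  then have "c = 1 \<or> c = -1" using square_eq_1_iff[of c] by simp
  moreover have "v = u" if "c = 1"
  proof -
    have "(v - u) \<bullet> (v - u) = 0" using that nu by (simp add: inner_diff_left inner_diff_right c_def inner_commute[of v u])
    then show ?thesis by simp
  qed
  moreover have "v = - u" if "c = -1"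
  proof -
    have "(v + u) \<bullet> (v + u) = 0" using that nu by (simp add: inner_add_left inner_add_right c_def inner_commute[of v u])
    then show ?thesis by (simp add: eq_neg_iff_add_eq_0)
  qed
  ultimately show ?thesis using s by auto
qed

lemma hyperplane_minus: "hyperplane (- u) (- t) = hyperplane u t"
  by (simp add: hyperplane_def)

section \<open>Measurable sets of hyperplanes\<close>

lemma space_hyperplane_space [simp]: "space hyperplane_space = hyperplanes"
  unfolding hyperplane_space_def by (rule space_measure_of) (auto simp: hyperplane_open_def)

text \<open>The symmetry of \<open>P\<close> makes the preimage under the two-to-one parametrisation
  the set described by \<open>P\<close> itself, so openness can be read off there.\<close>

lemma hyperplane_openI:
  assumes P: "\<And>u t. P (- u) (- t) \<longleftrightarrow> P u t" and op: "open {(u, t). P u t}"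
  shows "{hyperplane u t |u t. u \<in> sphere 0 1 \<and> P u t} \<in> sets hyperplane_space"
proof -
  let ?W = "{hyperplane u t |u t. u \<in> sphere 0 1 \<and> P u t}"
  have "{(u, t). u \<in> sphere 0 1 \<and> hyperplane u t \<in> ?W} = (sphere 0 1 \<times> UNIV) \<inter> {(u, t). P u t}"
  proof (intro set_eqI iffI)
    fix p assume "p \<in> {(u, t). u \<in> sphere 0 1 \<and> hyperplane u t \<in> ?W}"
    then obtain u t v s where *: "p = (u, t)" "u \<in> sphere 0 1" "v \<in> sphere 0 1" "P v s"
      "hyperplane u t = hyperplane v s" by auto
    from hyperplane_eq_imp[OF *(2,3,5)] * P[of u t]
    show "p \<in> (sphere 0 1 \<times> UNIV) \<inter> {(u, t). P u t}" by auto
  qed (auto; blast)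
  then have "hyperplane_open ?W"
    unfolding hyperplane_open_def openin_open using op by (auto simp: hyperplanes_def)
  then show ?thesis
    unfolding hyperplane_space_def by (subst sets_measure_of) (auto simp: hyperplane_open_def)
qed

text \<open>The condition \<open>0 \<le> t\<close> is not open, and at \<open>t = 0\<close> both
  normals name the same hyperplane. The part with nonzero offset is the symmetrised open set
  \<open>W\<close>. The hyperplanes through the origin are the complement of the open set
  \<open>Z\<close>, and among them the symmetric open condition of \<open>V\<close> selects the
  right ones.\<close>

lemma sets_separating:
  fixes q :: "'a::euclidean_space"
  assumes \<epsilon>: "\<epsilon> \<ge> 0"
  shows "separating q \<epsilon> \<in> sets hyperplane_space"
proof -
  let ?P = "\<lambda>(u::'a) t. (0 < t \<and> t + \<epsilon> < q \<bullet> u) \<or> (t < 0 \<and> - t + \<epsilon> < - (q \<bullet> u))"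
  define W where "W = {hyperplane u t |u t. u \<in> sphere 0 1 \<and> ?P u t}"
  define Z where "Z = {hyperplane (u::'a) t |u t. u \<in> sphere 0 1 \<and> t \<noteq> 0}"
  define V where "V = {hyperplane u t |u t. u \<in> sphere 0 1 \<and> \<epsilon> < \<bar>q \<bullet> u - t\<bar>}"
  have W: "W \<in> sets hyperplane_space" unfolding W_def
  proof (rule hyperplane_openI)
    show "open {(u, t). ?P u t}" unfolding case_prod_unfold
      by (intro open_Collect_disj open_Collect_conj open_Collect_less continuous_intros)
  qed (auto simp: inner_minus_right)
  have Z: "Z \<in> sets hyperplane_space" unfolding Z_def
  proof (rule hyperplane_openI)
    show "open {(u :: 'a, t :: real). t \<noteq> 0}" unfolding case_prod_unfold
      by (intro open_Collect_neq continuous_intros)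
  qed auto
  have V: "V \<in> sets hyperplane_space" unfolding V_def
  proof (rule hyperplane_openI)
    show "open {(u, t). \<epsilon> < \<bar>q \<bullet> u - t\<bar>}" unfolding case_prod_unfold
      by (intro open_Collect_less continuous_intros)
  qed (auto simp: inner_minus_right)
  have "separating q \<epsilon> = W \<union> (V - Z)"
  proof (intro set_eqI iffI)
    fix H assume "H \<in> separating q \<epsilon>"
    then obtain u t where H: "H = hyperplane u t" "u \<in> sphere 0 1" "0 \<le> t" "t + \<epsilon> < q \<bullet> u"
      by (auto simp: separating_def)
    show "H \<in> W \<union> (V - Z)"
    proof (cases "t = 0")
      case True
      have "H \<notin> Z"
      proof
        assume "H \<in> Z"
        then obtain v s where "v \<in> sphere 0 1" "s \<noteq> 0" "hyperplane u t = hyperplane v s" using H by (auto simp: Z_def)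
        with hyperplane_eq_imp[of u v t s] H True show False by auto
      qed
      moreover have "\<epsilon> < \<bar>q \<bullet> u - t\<bar>" using H True \<epsilon> by auto
      ultimately show ?thesis using H by (auto simp: V_def)
    next
      case False
      with H have "?P u t" by auto
      with H show ?thesis unfolding W_def by blast
    qed
  next
    fix H assume "H \<in> W \<union> (V - Z)"
    then show "H \<in> separating q \<epsilon>"
    proof
      assume "H \<in> W"
      then obtain u t where H: "H = hyperplane u t" "u \<in> sphere 0 1" "?P u t" by (auto simp: W_def)
      show ?thesis
      proof (cases "t > 0")
        case True
        with H show ?thesis unfolding separating_def by fastforce
      next
        case False
        with H have "H = hyperplane (- u) (- t) \<and> - u \<in> sphere 0 1 \<and> 0 \<le> - t \<and> - t + \<epsilon> < q \<bullet> (- u)"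
          by (auto simp: hyperplane_minus)
        then show ?thesis unfolding separating_def by blast
      qed
    next
      assume "H \<in> V - Z"
      then obtain u t where H: "H = hyperplane u t" "u \<in> sphere 0 1" "\<epsilon> < \<bar>q \<bullet> u - t\<bar>" "H \<notin> Z"
        by (auto simp: V_def)
      then have t: "t = 0" unfolding Z_def by blast
      show ?thesis
      proof (cases "q \<bullet> u > 0")
        case True
        with H t show ?thesis unfolding separating_def by fastforce
      next
        case False
        with H t have "H = hyperplane (- u) (- t) \<and> - u \<in> sphere 0 1 \<and> 0 \<le> - t \<and> - t + \<epsilon> < q \<bullet> (- u)"
          using hyperplane_minus[of u t] by auto
        then show ?thesis unfolding separating_def by blast
      qed
    qed
  qed
  then show ?thesis using W Z V by simp
qed

text \<open>A point outside the zero cell has a neighbourhood which is cut off from the zero cell by a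
  single hyperplane; these neighbourhoods can be taken from a countable family.\<close>

lemma zero_cell_complement_iff:
  assumes D: "\<And>U. open U \<Longrightarrow> U \<noteq> {} \<Longrightarrow> \<exists>d\<in>D. d \<in> U"
  shows "x \<notin> zero_cell Y \<longleftrightarrow>
    (\<exists>q\<in>D. \<exists>k::nat. Y \<inter> separating q (1 / real (Suc k)) \<noteq> {} \<and> x \<in> ball q (1 / real (Suc k)))"
proof
  assume "x \<notin> zero_cell Y"
  then obtain u t where H: "hyperplane u t \<in> Y" "u \<in> sphere 0 1" "0 \<le> t" "t < x \<bullet> u"
    unfolding mem_zero_cell_iff separating_def by auto
  \<comment> \<open>Half of the excess, because moving from \<open>x\<close> to \<open>q\<close> may
    cost \<open>1 / Suc k\<close>, and as much again is needed as margin.\<close>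
  then obtain k where k: "1 / real (Suc k) < (x \<bullet> u - t) / 2"
    using nat_approx_posE[of "(x \<bullet> u - t) / 2"] by auto
  obtain q where q: "q \<in> D" "q \<in> ball x (1 / real (Suc k))"
    using D[of "ball x (1 / real (Suc k))"] by auto
  have "x \<bullet> u - q \<bullet> u \<le> norm (x - q)"
    using norm_cauchy_schwarz[of "x - q" u] H(2) by (simp add: inner_diff_left)
  also have "\<dots> < 1 / real (Suc k)" using q by (simp add: dist_norm)
  finally have "t + 1 / real (Suc k) < q \<bullet> u" using k unfolding less_diff_eq[symmetric] by argo
  then have "hyperplane u t \<in> Y \<inter> separating q (1 / real (Suc k))"
    using H unfolding separating_def by blast
  moreover have "x \<in> ball q (1 / real (Suc k))" using q by (simp add: dist_commute)
  ultimately show "\<exists>q\<in>D. \<exists>k::nat. Y \<inter> separating q (1 / real (Suc k)) \<noteq> {} \<and> x \<in> ball q (1 / real (Suc k))"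
    using q by blast
next
  assume "\<exists>q\<in>D. \<exists>k::nat. Y \<inter> separating q (1 / real (Suc k)) \<noteq> {} \<and> x \<in> ball q (1 / real (Suc k))"
  then obtain q k u t where H: "hyperplane u t \<in> Y" "u \<in> sphere 0 1" "0 \<le> t"
    "t + 1 / real (Suc k) < q \<bullet> u" "dist q x < 1 / real (Suc k)"
    unfolding separating_def by auto
  \<comment> \<open>The margin equals the radius of the ball, so no point of the ball reaches back
    to the hyperplane.\<close>
  have "q \<bullet> u - x \<bullet> u \<le> norm (q - x)"
    using norm_cauchy_schwarz[of "q - x" u] H(2) by (simp add: inner_diff_left)
  with H have "t < x \<bullet> u" by (simp add: dist_norm)
  with H show "x \<notin> zero_cell Y"
    unfolding mem_zero_cell_iff separating_def by auto
qed

lemma point_count_eq_0_iff: "point_count X A \<omega> = 0 \<longleftrightarrow> X \<omega> \<inter> A = {}"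
  by (simp add: point_count_def emeasure_count_space_eq_0)

text \<open>The complement is a countable union of rectangles, each the event that the process hits
  one \<open>separating\<close> set times a ball. Joint measurability is what Fubini's theorem
  needs.\<close>

lemma sets_zero_cell:
  fixes X :: "'w \<Rightarrow> 'a::euclidean_space set set"
  assumes meas: "\<And>A. A \<in> sets hyperplane_space \<Longrightarrow> point_count X A \<in> borel_measurable M"
  shows "{p \<in> space (M \<Otimes>\<^sub>M lborel). snd p \<in> zero_cell (X (fst p))} \<in> sets (M \<Otimes>\<^sub>M lborel)"
proof -
  obtain D :: "'a set" where D: "countable D" "\<And>U. open U \<Longrightarrow> U \<noteq> {} \<Longrightarrow> \<exists>d\<in>D. d \<in> U"
    by (rule countable_dense_setE) blast
  let ?N = "\<lambda>q k. {\<omega> \<in> space M. X \<omega> \<inter> separating q (1 / real (Suc k)) \<noteq> {}}"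
  have N: "?N q k \<in> sets M" for q k
  proof -
    have [measurable]: "point_count X (separating q (1 / real (Suc k))) \<in> borel_measurable M"
      by (intro meas sets_separating) simp
    have "?N q k = {\<omega> \<in> space M. point_count X (separating q (1 / real (Suc k))) \<omega> \<noteq> 0}"
      by (simp add: point_count_eq_0_iff)
    also have "\<dots> \<in> sets M" by measurable
    finally show ?thesis .
  qed
  have "{p \<in> space (M \<Otimes>\<^sub>M lborel). snd p \<in> zero_cell (X (fst p))}
      = space (M \<Otimes>\<^sub>M lborel) - (\<Union>q\<in>D. \<Union>k. ?N q k \<times> ball q (1 / real (Suc k)))"
  proof (intro set_eqI)
    fix p :: "'w \<times> 'a"
    show "p \<in> {p \<in> space (M \<Otimes>\<^sub>M lborel). snd p \<in> zero_cell (X (fst p))} \<longleftrightarrow>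
        p \<in> space (M \<Otimes>\<^sub>M lborel) - (\<Union>q\<in>D. \<Union>k. ?N q k \<times> ball q (1 / real (Suc k)))"
      using zero_cell_complement_iff[of D "snd p" "X (fst p)", OF D(2)]
      by (cases p) (simp only: mem_Collect_eq Diff_iff UN_iff mem_Times_iff fst_conv snd_conv
          space_pair_measure UNIV_I bex_UNIV, blast)
  qed
  also have "\<dots> \<in> sets (M \<Otimes>\<^sub>M lborel)"
    using N D(1) by (intro sets.Diff sets.top sets.countable_UN' pair_measureI) auto
  finally show ?thesis .
qed

lemma measurable_hyperplane:
  assumes [measurable]: "g \<in> borel_measurable borel"
  shows "(\<lambda>(u :: 'a::euclidean_space, t). hyperplane u t)
    \<in> sphere_measure \<Otimes>\<^sub>M density lborel g \<rightarrow>\<^sub>M hyperplane_space"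
  unfolding hyperplane_space_def
proof (rule measurable_measure_of)
  let ?N = "(sphere_measure :: 'a measure) \<Otimes>\<^sub>M density lborel g"
  show "{W. hyperplane_open W} \<subseteq> Pow hyperplanes" by (auto simp: hyperplane_open_def)
  show "(\<lambda>(u :: 'a, t). hyperplane u t) \<in> space ?N \<rightarrow> hyperplanes"
    by (auto simp: space_pair_measure hyperplanes_def)
  fix W :: "'a set set" assume "W \<in> {W. hyperplane_open W}"
  then obtain T where T: "open T"
    "{(u, t). u \<in> sphere 0 1 \<and> hyperplane u t \<in> W} = (sphere 0 1 \<times> UNIV) \<inter> T"
    unfolding hyperplane_open_def openin_open by auto
  have [measurable]: "(\<lambda>u. u) \<in> (sphere_measure :: 'a measure) \<rightarrow>\<^sub>M borel"
    by (rule measurable_sphere_measure) simp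
  have id: "(\<lambda>p. (fst p, snd p)) \<in> ?N \<rightarrow>\<^sub>M borel \<Otimes>\<^sub>M borel"
    by measurable
  have "T \<in> sets (borel \<Otimes>\<^sub>M borel)" unfolding borel_prod using T(1) by (rule borel_open)
  from measurable_sets[OF id this]
  have "T \<inter> space ?N \<in> sets ?N" by simp
  also have "T \<inter> space ?N = (\<lambda>(u, t). hyperplane u t) -` W \<inter> space ?N"
    using T(2) by (auto simp: space_pair_measure set_eq_iff)
  finally show "(\<lambda>(u, t). hyperplane u t) -` W \<inter> space ?N \<in> sets ?N" .
qed

section \<open>Intensity of separating hyperplanes\<close>

definition capacity :: "'a::euclidean_space itself \<Rightarrow> real \<Rightarrow> real \<Rightarrow> real" where
  "capacity _ \<gamma> r = 2 * \<gamma> / (real DIM('a) * unit_ball_vol (real DIM('a))) / r"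

lemma sets_hyperplane_intensity [simp]: "sets (hyperplane_intensity \<gamma> r) = sets hyperplane_space"
  by (simp add: hyperplane_intensity_def)

text \<open>For a fixed normal \<open>u\<close> and up to null sets, the hyperplanes that cut off
  \<open>x\<close> or \<open>y\<close> are those with offset below the larger of
  \<open>u \<bullet> x\<close> and \<open>u \<bullet> y\<close>. Integrating
  \<open>t powr (r - 1)\<close> up to there yields the power \<open>r\<close> and the divisor
  \<open>r\<close> in \<open>capacity\<close>.\<close>

lemma emeasure_hyperplane_intensity:
  fixes x y :: "'a::euclidean_space"
  assumes \<gamma>: "\<gamma> > 0" and r: "r > 0"
  shows "emeasure (hyperplane_intensity \<gamma> r) (separating x 0 \<union> separating y 0)
    = ennreal (capacity TYPE('a) \<gamma> r) * (\<integral>\<^sup>+u. ennreal (max 0 (max (u \<bullet> x) (u \<bullet> y)) powr r) \<partial>sphere_measure)"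
proof -
  let ?g = "\<lambda>t. ennreal (indicator {0..} t * t powr (r - 1))"
  let ?d = "density lborel ?g" and ?\<sigma> = "sphere_measure :: 'a measure"
  let ?A = "separating x 0 \<union> separating y 0"
  let ?c = "2 * \<gamma> / (real DIM('a) * unit_ball_vol (real DIM('a)))"
  have c: "?c \<ge> 0" using \<gamma> by simp
  have A: "?A \<in> sets hyperplane_space" by (intro sets.Un sets_separating) auto
  have m: "(\<lambda>(u :: 'a, t). hyperplane u t) \<in> ?\<sigma> \<Otimes>\<^sub>M ?d \<rightarrow>\<^sub>M hyperplane_space"
    by (rule measurable_hyperplane) measurable
  interpret d: sigma_finite_measure ?d
    by (subst sigma_finite_measure.sigma_finite_iff_density_finite'[OF sigma_finite_lborel]) auto
  have inner: "emeasure ?d (Pair u -` ((\<lambda>(u, t). hyperplane u t) -` ?A \<inter> space (?\<sigma> \<Otimes>\<^sub>M ?d)))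
      = ennreal (max 0 (max (u \<bullet> x) (u \<bullet> y)) powr r / r)" if u: "u \<in> space ?\<sigma>" for u
  proof -
    let ?m = "max 0 (max (u \<bullet> x) (u \<bullet> y))"
    let ?S = "Pair u -` ((\<lambda>(u, t). hyperplane u t) -` ?A \<inter> space (?\<sigma> \<Otimes>\<^sub>M ?d))"
    have S: "?S \<in> sets ?d"
      using measurable_sets[OF m A] by (rule sets_Pair1)
    \<comment> \<open>For positive offsets the normal is determined by the hyperplane;
      \<open>t = 0\<close>, where it is not, is a null set.\<close>
    have mem: "t \<in> ?S \<longleftrightarrow> t < ?m" if "t > 0" for t
    proof -
      have "hyperplane u t \<in> separating z 0 \<longleftrightarrow> t < u \<bullet> z" for z
      proof
        assume "hyperplane u t \<in> separating z 0"
        then obtain v s where "v \<in> sphere 0 1" "0 \<le> s" "s < z \<bullet> v" "hyperplane u t = hyperplane v s"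
          by (auto simp: separating_def)
        with hyperplane_eq_imp[of u v t s] u \<open>t > 0\<close> show "t < u \<bullet> z" by (auto simp: inner_commute)
      next
        assume "t < u \<bullet> z"
        then have "u \<in> sphere 0 1 \<and> 0 \<le> t \<and> t + 0 < z \<bullet> u" using u \<open>t > 0\<close> by (simp add: inner_commute)
        then show "hyperplane u t \<in> separating z 0" unfolding separating_def by blast
      qed
      then have "hyperplane u t \<in> ?A \<longleftrightarrow> t < u \<bullet> x \<or> t < u \<bullet> y" by (simp only: Un_iff)
      moreover have "t \<in> ?S \<longleftrightarrow> hyperplane u t \<in> ?A"
        using u by (simp only: vimage_eq Int_iff space_pair_measure case_prod_conv mem_Times_iff
            fst_conv snd_conv space_density space_lborel space_borel UNIV_I simp_thms)
      ultimately show ?thesis using \<open>t > 0\<close> by (simp only: less_max_iff_disj) linarith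
    qed
    have "emeasure ?d ?S = (\<integral>\<^sup>+t. ?g t * indicator ?S t \<partial>lborel)"
      using S by (intro emeasure_density) auto
    also have "\<dots> = (\<integral>\<^sup>+t. ennreal (indicator {0..?m} t * t powr (r - 1)) \<partial>lborel)"
    proof (intro nn_integral_cong_AE)
      show "AE t in lborel. ?g t * indicator ?S t = ennreal (indicator {0..?m} t * t powr (r - 1))"
        using AE_lborel_singleton[of 0] AE_lborel_singleton[of ?m]
      proof eventually_elim
        case (elim t)
        then show ?case using mem[of t] by (cases "t > 0") (auto simp: indicator_def)
      qed
    qed
    also have "\<dots> = ennreal (?m powr (r - 1 + 1) / (r - 1 + 1))"
      using r by (intro nn_integral_has_integral_lebesgue has_integral_powr_from_0) auto
    finally show ?thesis by simp
  qed
  have [measurable]: "(\<lambda>u. u) \<in> ?\<sigma> \<rightarrow>\<^sub>M borel"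
    by (rule measurable_sphere_measure) simp
  have "emeasure (hyperplane_intensity \<gamma> r) ?A
      = ennreal ?c * emeasure (?\<sigma> \<Otimes>\<^sub>M ?d) ((\<lambda>(u, t). hyperplane u t) -` ?A \<inter> space (?\<sigma> \<Otimes>\<^sub>M ?d))"
    unfolding hyperplane_intensity_def using m A by (simp add: emeasure_distr)
  also have "emeasure (?\<sigma> \<Otimes>\<^sub>M ?d) ((\<lambda>(u, t). hyperplane u t) -` ?A \<inter> space (?\<sigma> \<Otimes>\<^sub>M ?d))
      = (\<integral>\<^sup>+u. ennreal (max 0 (max (u \<bullet> x) (u \<bullet> y)) powr r / r) \<partial>?\<sigma>)"
    by (subst d.emeasure_pair_measure_alt[OF measurable_sets[OF m A]]) (rule nn_integral_cong, rule inner)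
  also have "\<dots> = (\<integral>\<^sup>+u. ennreal (1 / r) * ennreal (max 0 (max (u \<bullet> x) (u \<bullet> y)) powr r) \<partial>?\<sigma>)"
    using r by (intro nn_integral_cong) (simp flip: ennreal_mult)
  also have "\<dots> = ennreal (1 / r) * (\<integral>\<^sup>+u. ennreal (max 0 (max (u \<bullet> x) (u \<bullet> y)) powr r) \<partial>?\<sigma>)"
    by (intro nn_integral_cmult) measurable
  finally show ?thesis
    using r c by (simp add: capacity_def mult.assoc[symmetric] ennreal_mult[symmetric])
qed

text \<open>The function \<Phi> of the overview as a real number; by
  \<open>emeasure_hyperplane_intensity_finite\<close> the passage to \<open>measure\<close> loses
  nothing when \<gamma> and \<open>r\<close> are positive.\<close>

definition hitting :: "real \<Rightarrow> real \<Rightarrow> 'a::euclidean_space \<Rightarrow> 'a \<Rightarrow> real" where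
  "hitting \<gamma> r x y = measure (hyperplane_intensity \<gamma> r) (separating x 0 \<union> separating y 0)"

lemma emeasure_hyperplane_intensity_finite:
  fixes x y :: "'a::euclidean_space"
  assumes \<gamma>: "\<gamma> > 0" and r: "r > 0"
  shows "emeasure (hyperplane_intensity \<gamma> r) (separating x 0 \<union> separating y 0) < \<infinity>"
proof -
  interpret S: finite_measure "sphere_measure :: 'a measure" by (rule finite_measure_sphere_measure)
  have "(\<integral>\<^sup>+u. ennreal (max 0 (max (u \<bullet> x) (u \<bullet> y)) powr r) \<partial>(sphere_measure :: 'a measure))
      \<le> (\<integral>\<^sup>+u. ennreal ((norm x + norm y) powr r) \<partial>(sphere_measure :: 'a measure))"
  proof (intro nn_integral_mono ennreal_leI powr_mono2)
    fix u :: 'a assume "u \<in> space sphere_measure"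
    then have "u \<bullet> x \<le> norm x" "u \<bullet> y \<le> norm y"
      using norm_cauchy_schwarz[of u x] norm_cauchy_schwarz[of u y] by auto
    then show "max 0 (max (u \<bullet> x) (u \<bullet> y)) \<le> norm x + norm y"
      using norm_ge_zero[of x] norm_ge_zero[of y] by linarith
  qed (use r in auto)
  also have "\<dots> < \<infinity>"
    using emeasure_sphere_measure_finite[where 'a = 'a] by (simp add: ennreal_mult_less_top)
  finally show ?thesis
    unfolding emeasure_hyperplane_intensity[OF assms] by (simp add: ennreal_mult_less_top)
qed

lemma hitting_eq:
  fixes x y :: "'a::euclidean_space"
  assumes "\<gamma> > 0" "r > 0"
  shows "ennreal (hitting \<gamma> r x y)
    = ennreal (capacity TYPE('a) \<gamma> r) * (\<integral>\<^sup>+u. ennreal (max 0 (max (u \<bullet> x) (u \<bullet> y)) powr r) \<partial>sphere_measure)"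
  using emeasure_hyperplane_intensity_finite[OF assms, of x y] emeasure_hyperplane_intensity[OF assms, of x y]
  unfolding hitting_def by (metis emeasure_eq_ennreal_measure infinity_ennreal_def less_top)

lemma hitting_nonneg: "hitting \<gamma> r x y \<ge> 0"
  by (simp add: hitting_def)

text \<open>The definition involves the points only through a set, which says little about the
  dependence on them; the formula \<open>hitting_eq\<close> is a parameter integral and therefore
  measurable.\<close>

lemma borel_measurable_hitting:
  fixes f g :: "'b \<Rightarrow> 'a::euclidean_space"
  assumes "\<gamma> > 0" "r > 0" and [measurable]: "f \<in> borel_measurable N" "g \<in> borel_measurable N"
  shows "(\<lambda>z. hitting \<gamma> r (f z) (g z)) \<in> borel_measurable N"
proof -
  interpret S: finite_measure "sphere_measure :: 'a measure" by (rule finite_measure_sphere_measure)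
  have [measurable]: "(\<lambda>u. u) \<in> (sphere_measure :: 'a measure) \<rightarrow>\<^sub>M borel"
    by (rule measurable_sphere_measure) simp
  have "hitting \<gamma> r (f z) (g z) = enn2real (ennreal (hitting \<gamma> r (f z) (g z)))" for z
    by (simp add: hitting_nonneg)
  then show ?thesis
    unfolding hitting_eq[OF assms(1,2)] by simp
qed

section \<open>Moments of the volume\<close>

context
  fixes M :: "'w measure" and X :: "'w \<Rightarrow> 'a::euclidean_space set set" and \<gamma> r :: real
  assumes \<gamma>: "\<gamma> > 0" and r: "r > 0" and X: "poisson_hyperplane_process M \<gamma> r X"
begin

lemma poisson_prob_space: "prob_space M"
  using X by (simp add: poisson_hyperplane_process_def poisson_process_def)

lemma sets_zero_cell_process [measurable]:
  "{p \<in> space (M \<Otimes>\<^sub>M lborel). snd p \<in> zero_cell (X (fst p))} \<in> sets (M \<Otimes>\<^sub>M lborel)"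
  using X by (intro sets_zero_cell) (simp add: poisson_hyperplane_process_def poisson_process_def)

lemma prob_points_in_zero_cell:
  "emeasure M {\<omega> \<in> space M. x \<in> zero_cell (X \<omega>) \<and> y \<in> zero_cell (X \<omega>)} = ennreal (exp (- hitting \<gamma> r x y))"
proof -
  interpret prob_space M by (rule poisson_prob_space)
  let ?A = "separating x 0 \<union> separating y 0"
  have A: "?A \<in> sets (hyperplane_intensity \<gamma> r)" by (simp add: sets.Un sets_separating)
  have "measure M {\<omega> \<in> space M. point_count X ?A \<omega> = of_nat 0} = exp (- hitting \<gamma> r x y)"
  proof -
    have "\<forall>A \<in> sets (hyperplane_intensity \<gamma> r). emeasure (hyperplane_intensity \<gamma> r) A < \<infinity> \<longrightarrow>
        (\<forall>k::nat. measure M {\<omega> \<in> space M. point_count X A \<omega> = of_nat k} =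
           exp (- measure (hyperplane_intensity \<gamma> r) A) * measure (hyperplane_intensity \<gamma> r) A ^ k / fact k)"
      using X unfolding poisson_hyperplane_process_def poisson_process_def by simp
    from this[rule_format, OF A emeasure_hyperplane_intensity_finite[OF \<gamma> r], of 0] show ?thesis
      by (simp add: hitting_def)
  qed
  moreover have "{\<omega> \<in> space M. point_count X ?A \<omega> = of_nat 0}
      = {\<omega> \<in> space M. x \<in> zero_cell (X \<omega>) \<and> y \<in> zero_cell (X \<omega>)}"
    by (auto simp: point_count_eq_0_iff mem_zero_cell_iff)
  ultimately show ?thesis by (simp add: emeasure_eq_measure)
qed

text \<open>The volume is the integral of the indicator of the cell, and its square a double
  integral of a product of two indicators; the expectation of that product is the probability that
  both points lie in the cell.\<close>

lemma zero_cell_moments: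
  shows "(\<lambda>\<omega>. emeasure lborel (zero_cell (X \<omega>))) \<in> borel_measurable M"
    and "(\<integral>\<^sup>+\<omega>. emeasure lborel (zero_cell (X \<omega>)) \<partial>M) = (\<integral>\<^sup>+x. ennreal (exp (- hitting \<gamma> r x x)) \<partial>(lborel :: 'a measure))"
    and "(\<integral>\<^sup>+\<omega>. (emeasure lborel (zero_cell (X \<omega>)))\<^sup>2 \<partial>M)
      = (\<integral>\<^sup>+x. (\<integral>\<^sup>+y. ennreal (exp (- hitting \<gamma> r x y)) \<partial>(lborel :: 'a measure)) \<partial>lborel)"
proof -
  interpret prob_space M by (rule poisson_prob_space)
  interpret P: pair_sigma_finite M "lborel :: 'a measure" ..
  let ?S = "{p \<in> space (M \<Otimes>\<^sub>M lborel). snd p \<in> zero_cell (X (fst p))}"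
  let ?i = "\<lambda>\<omega> x. indicator ?S (\<omega>, x) :: ennreal"
  have im [measurable (raw)]: "(\<lambda>z. ?i (f z) (g z)) \<in> borel_measurable N"
    if "f \<in> N \<rightarrow>\<^sub>M M" "g \<in> N \<rightarrow>\<^sub>M lborel" for f g and N :: "'z measure"
    using measurable_compose[OF measurable_Pair[OF that] borel_measurable_indicator[OF sets_zero_cell_process]] .
  have cell: "zero_cell (X \<omega>) \<in> sets lborel" if "\<omega> \<in> space M" for \<omega>
  proof -
    have "Pair \<omega> -` ?S \<in> sets lborel" by (rule sets_Pair1[OF sets_zero_cell_process])
    also have "Pair \<omega> -` ?S = zero_cell (X \<omega>)" using that by (auto simp: space_pair_measure)
    finally show ?thesis .
  qed
  have vol: "emeasure lborel (zero_cell (X \<omega>)) = (\<integral>\<^sup>+x. ?i \<omega> x \<partial>lborel)" if "\<omega> \<in> space M" for \<omega>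
  proof -
    have "(\<integral>\<^sup>+x. ?i \<omega> x \<partial>lborel) = (\<integral>\<^sup>+x. indicator (zero_cell (X \<omega>)) x \<partial>lborel)"
      using that by (intro nn_integral_cong) (auto simp: indicator_def space_pair_measure)
    then show ?thesis using cell[OF that] by (simp only: nn_integral_indicator)
  qed
  have prob: "(\<integral>\<^sup>+\<omega>. ?i \<omega> x * ?i \<omega> y \<partial>M) = ennreal (exp (- hitting \<gamma> r x y))" for x y
  proof -
    have "(\<integral>\<^sup>+\<omega>. ?i \<omega> x * ?i \<omega> y \<partial>M)
        = (\<integral>\<^sup>+\<omega>. indicator {\<omega> \<in> space M. x \<in> zero_cell (X \<omega>) \<and> y \<in> zero_cell (X \<omega>)} \<omega> \<partial>M)"
      by (intro nn_integral_cong) (auto simp: indicator_def space_pair_measure)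
    also have "\<dots> = emeasure M {\<omega> \<in> space M. x \<in> zero_cell (X \<omega>) \<and> y \<in> zero_cell (X \<omega>)}"
    proof (rule nn_integral_indicator)
      have "{\<omega> \<in> space M. x \<in> zero_cell (X \<omega>) \<and> y \<in> zero_cell (X \<omega>)}
          = {\<omega> \<in> space M. ?i \<omega> x \<noteq> 0 \<and> ?i \<omega> y \<noteq> 0}"
        by (auto simp: indicator_def space_pair_measure)
      also have "\<dots> \<in> sets M" by measurable
      finally show "{\<omega> \<in> space M. x \<in> zero_cell (X \<omega>) \<and> y \<in> zero_cell (X \<omega>)} \<in> sets M" .
    qed
    finally show ?thesis by (simp add: prob_points_in_zero_cell)
  qed
  show "(\<lambda>\<omega>. emeasure lborel (zero_cell (X \<omega>))) \<in> borel_measurable M"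
    by (subst measurable_cong[OF vol]) measurable
  \<comment> \<open>The indicator is its own square, so the first moment is the diagonal case of the
    same formula.\<close>
  have "(\<integral>\<^sup>+\<omega>. emeasure lborel (zero_cell (X \<omega>)) \<partial>M) = (\<integral>\<^sup>+\<omega>. (\<integral>\<^sup>+x. ?i \<omega> x * ?i \<omega> x \<partial>lborel) \<partial>M)"
    by (intro nn_integral_cong) (simp add: vol indicator_inter_arith[symmetric])
  also have "\<dots> = (\<integral>\<^sup>+x. (\<integral>\<^sup>+\<omega>. ?i \<omega> x * ?i \<omega> x \<partial>M) \<partial>lborel)"
    by (rule P.Fubini'[symmetric]) measurable
  finally show "(\<integral>\<^sup>+\<omega>. emeasure lborel (zero_cell (X \<omega>)) \<partial>M) = (\<integral>\<^sup>+x. ennreal (exp (- hitting \<gamma> r x x)) \<partial>(lborel :: 'a measure))"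
    unfolding prob .
  have "(\<integral>\<^sup>+\<omega>. (emeasure lborel (zero_cell (X \<omega>)))\<^sup>2 \<partial>M)
      = (\<integral>\<^sup>+\<omega>. (\<integral>\<^sup>+x. (\<integral>\<^sup>+y. ?i \<omega> x * ?i \<omega> y \<partial>lborel) \<partial>lborel) \<partial>M)"
  proof (rule nn_integral_cong)
    fix \<omega> assume \<omega>: "\<omega> \<in> space M"
    have "(\<integral>\<^sup>+x. (\<integral>\<^sup>+y. ?i \<omega> x * ?i \<omega> y \<partial>lborel) \<partial>lborel)
        = (\<integral>\<^sup>+x. ?i \<omega> x * (\<integral>\<^sup>+y. ?i \<omega> y \<partial>lborel) \<partial>lborel)"
      using \<omega> by (intro nn_integral_cong nn_integral_cmult) measurable
    also have "\<dots> = (\<integral>\<^sup>+x. ?i \<omega> x \<partial>lborel) * (\<integral>\<^sup>+y. ?i \<omega> y \<partial>lborel)"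
      using \<omega> by (intro nn_integral_multc) measurable
    finally show "(emeasure lborel (zero_cell (X \<omega>)))\<^sup>2 = (\<integral>\<^sup>+x. (\<integral>\<^sup>+y. ?i \<omega> x * ?i \<omega> y \<partial>lborel) \<partial>lborel)"
      using \<omega> by (simp add: vol power2_eq_square)
  qed
  also have "\<dots> = (\<integral>\<^sup>+x. (\<integral>\<^sup>+\<omega>. (\<integral>\<^sup>+y. ?i \<omega> x * ?i \<omega> y \<partial>lborel) \<partial>M) \<partial>lborel)"
    by (rule P.Fubini'[symmetric]) measurable
  also have "\<dots> = (\<integral>\<^sup>+x. (\<integral>\<^sup>+y. (\<integral>\<^sup>+\<omega>. ?i \<omega> x * ?i \<omega> y \<partial>M) \<partial>lborel) \<partial>lborel)"
    by (intro nn_integral_cong P.Fubini'[symmetric]) measurable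
  finally show "(\<integral>\<^sup>+\<omega>. (emeasure lborel (zero_cell (X \<omega>)))\<^sup>2 \<partial>M)
      = (\<integral>\<^sup>+x. (\<integral>\<^sup>+y. ennreal (exp (- hitting \<gamma> r x y)) \<partial>(lborel :: 'a measure)) \<partial>lborel)"
    unfolding prob .
qed

text \<open>\<open>measure\<close> is 0 on sets of infinite volume. The finite first moment rules
  these out almost surely, so the moments of \<open>emeasure\<close> are those of the real random
  variable.\<close>

lemma variance_zero_cell:
  assumes a: "(\<integral>\<^sup>+x. ennreal (exp (- hitting \<gamma> r x x)) \<partial>(lborel :: 'a measure)) = ennreal a" "a \<ge> 0"
    and b: "(\<integral>\<^sup>+x. (\<integral>\<^sup>+y. ennreal (exp (- hitting \<gamma> r x y)) \<partial>(lborel :: 'a measure)) \<partial>lborel) = ennreal b" "b \<ge> 0"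
  shows "prob_space.variance M (\<lambda>\<omega>. measure lborel (zero_cell (X \<omega>))) = b - a\<^sup>2"
proof -
  interpret prob_space M by (rule poisson_prob_space)
  let ?V = "\<lambda>\<omega>. measure lborel (zero_cell (X \<omega>))" and ?E = "\<lambda>\<omega>. emeasure lborel (zero_cell (X \<omega>))"
  have [measurable]: "?E \<in> borel_measurable M" by (rule zero_cell_moments)
  then have [measurable]: "?V \<in> borel_measurable M" unfolding measure_def by measurable
  have "AE \<omega> in M. ?E \<omega> \<noteq> \<infinity>"
    using zero_cell_moments(2) a by (intro nn_integral_noteq_infinite) auto
  then have V: "AE \<omega> in M. ?E \<omega> = ennreal (?V \<omega>)"
    by eventually_elim (simp add: emeasure_eq_ennreal_measure)
  have 1: "(\<integral>\<^sup>+\<omega>. ennreal (?V \<omega>) \<partial>M) = ennreal a"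
    using nn_integral_cong_AE[OF V] zero_cell_moments(2) a by simp
  have "(\<integral>\<^sup>+\<omega>. (?E \<omega>)\<^sup>2 \<partial>M) = (\<integral>\<^sup>+\<omega>. ennreal ((?V \<omega>)\<^sup>2) \<partial>M)"
    using V by (intro nn_integral_cong_AE) (auto elim!: eventually_mono simp: ennreal_power)
  then have 2: "(\<integral>\<^sup>+\<omega>. ennreal ((?V \<omega>)\<^sup>2) \<partial>M) = ennreal b"
    using zero_cell_moments(3) b by simp
  have i1: "integrable M ?V" using 1 by (intro integrableI_nonneg) auto
  have i2: "integrable M (\<lambda>\<omega>. (?V \<omega>)\<^sup>2)" using 2 by (intro integrableI_nonneg) auto
  have "expectation ?V = a" using 1 a by (subst integral_eq_nn_integral) auto
  moreover have "expectation (\<lambda>\<omega>. (?V \<omega>)\<^sup>2) = b" using 2 b by (subst integral_eq_nn_integral) auto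
  ultimately show ?thesis using variance_eq[OF i1 i2] by simp
qed

end

section \<open>The overlap of two points\<close>

lemma emeasure_cylinder:
  fixes x :: "real^'n"
  assumes x: "norm x = 1" and d: "d \<ge> 0" and n: "CARD('n) \<ge> 2"
  shows "emeasure lborel {v. 0 \<le> v \<bullet> x \<and> v \<bullet> x \<le> 1 \<and> (norm v)\<^sup>2 - (v \<bullet> x)\<^sup>2 \<le> d\<^sup>2}
    = ennreal (unit_ball_vol (real (CARD('n) - 1)) * d ^ (CARD('n) - 1))"
proof -
  define m where "m = CARD('n) - 1"
  have m: "m \<ge> 1" "DIM(real^'n) - 1 = m" using n by (auto simp: m_def)
  let ?C = "\<lambda>x::real^'n. {v. 0 \<le> v \<bullet> x \<and> v \<bullet> x \<le> 1 \<and> (norm v)\<^sup>2 - (v \<bullet> x)\<^sup>2 \<le> d\<^sup>2}"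
  have meas: "?C x \<in> sets borel" for x by measurable
  obtain k :: 'n where True by simp
  define b :: "real^'n" where "b = axis k 1"
  have b: "b \<in> Basis" "norm b = 1" by (auto simp: b_def axis_in_Basis_iff)
  obtain f where f: "orthogonal_transformation f" "f b = x"
    using orthogonal_transformation_exists[of b x] x b by auto
  have "emeasure lborel (?C x) = (\<integral>\<^sup>+v. indicator (?C x) v \<partial>lborel)" using meas by simp
  also have "\<dots> = (\<integral>\<^sup>+v. indicator (?C x) (f v) \<partial>lborel)"
    using meas by (intro nn_integral_lborel_orthogonal[OF f(1), symmetric]) auto
  \<comment> \<open>With the axis rotated to a coordinate vector, the cylinder is described by the
    norm \<open>s\<close> and the height \<open>z\<close> alone, as the coordinate splitting
    requires.\<close>
  also have "\<dots> = (\<integral>\<^sup>+v. (\<lambda>s z. indicator {(s, z). 0 \<le> z \<and> z \<le> 1 \<and> s\<^sup>2 - z\<^sup>2 \<le> d\<^sup>2} (s, z)) (norm v) (v \<bullet> b) \<partial>lborel)"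
  proof (intro nn_integral_cong)
    fix v
    have "f v \<bullet> x = v \<bullet> b" using f by (metis orthogonal_transformation_def)
    then show "indicator (?C x) (f v) = (\<lambda>s z. indicator {(s, z). 0 \<le> z \<and> z \<le> 1 \<and> s\<^sup>2 - z\<^sup>2 \<le> d\<^sup>2} (s, z) :: ennreal) (norm v) (v \<bullet> b)"
      using f(1) by (simp add: indicator_def orthogonal_transformation_norm)
  qed
  also have "\<dots> = (\<integral>\<^sup>+y. (\<integral>\<^sup>+v. indicator {(s, z). 0 \<le> z \<and> z \<le> 1 \<and> s\<^sup>2 - z\<^sup>2 \<le> d\<^sup>2} (sqrt (y\<^sup>2 + v\<^sup>2), y) *
        ennreal (unit_ball_vol (real m) * real m * v powr (real m - 1))
        * indicator {0<..} v \<partial>lborel) \<partial>lborel)"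
  proof (subst nn_integral_lborel_split_coordinate[OF _ b(1)])
    show "(\<lambda>(s, z). indicator {(s, z). 0 \<le> z \<and> z \<le> 1 \<and> s\<^sup>2 - z\<^sup>2 \<le> d\<^sup>2} (s, z) :: ennreal) \<in> borel_measurable (borel :: (real \<times> real) measure)"
      unfolding case_prod_unfold borel_prod[symmetric] by measurable
  qed (use n m in simp_all)
  also have "\<dots> = (\<integral>\<^sup>+y. (\<integral>\<^sup>+v. ennreal (unit_ball_vol (real m) * real m) * ennreal (indicator {0..d} v * v powr (real m - 1)) \<partial>lborel)
      * indicator {0..1::real} y \<partial>lborel)"
  proof (intro nn_integral_cong)
    fix y :: real
    have "indicator {(s, z). 0 \<le> z \<and> z \<le> 1 \<and> s\<^sup>2 - z\<^sup>2 \<le> d\<^sup>2} (sqrt (y\<^sup>2 + v\<^sup>2), y) *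
        ennreal (unit_ball_vol (real m) * real m * v powr (real m - 1)) * indicator {0<..} v
      = ennreal (unit_ball_vol (real m) * real m) * ennreal (indicator {0..d} v * v powr (real m - 1)) * indicator {0..1} y"
      if "v \<noteq> 0" for v
      using that d by (auto simp: indicator_def ennreal_mult abs_le_square_iff[symmetric])
    then have "(\<integral>\<^sup>+v. indicator {(s, z). 0 \<le> z \<and> z \<le> 1 \<and> s\<^sup>2 - z\<^sup>2 \<le> d\<^sup>2} (sqrt (y\<^sup>2 + v\<^sup>2), y) *
        ennreal (unit_ball_vol (real m) * real m * v powr (real m - 1)) * indicator {0<..} v \<partial>lborel)
      = (\<integral>\<^sup>+v. ennreal (unit_ball_vol (real m) * real m) * ennreal (indicator {0..d} v * v powr (real m - 1)) * indicator {0..1} y \<partial>lborel)"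
      by (intro nn_integral_cong_AE eventually_mono[OF AE_lborel_singleton[of 0]]) auto
    also have "\<dots> = (\<integral>\<^sup>+v. ennreal (unit_ball_vol (real m) * real m) * ennreal (indicator {0..d} v * v powr (real m - 1)) \<partial>lborel)
      * indicator {0..1} y"
      by (intro nn_integral_multc) measurable
    finally show "(\<integral>\<^sup>+v. indicator {(s, z). 0 \<le> z \<and> z \<le> 1 \<and> s\<^sup>2 - z\<^sup>2 \<le> d\<^sup>2} (sqrt (y\<^sup>2 + v\<^sup>2), y) *
        ennreal (unit_ball_vol (real m) * real m * v powr (real m - 1)) * indicator {0<..} v \<partial>lborel)
      = (\<integral>\<^sup>+v. ennreal (unit_ball_vol (real m) * real m) * ennreal (indicator {0..d} v * v powr (real m - 1)) \<partial>lborel)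
      * indicator {0..1} y" .
  qed
  also have "(\<integral>\<^sup>+v. ennreal (unit_ball_vol (real m) * real m) * ennreal (indicator {0..d} v * v powr (real m - 1)) \<partial>lborel)
      = ennreal (unit_ball_vol (real m) * real m) * ennreal (d powr (real m - 1 + 1) / (real m - 1 + 1))"
    using has_integral_powr_from_0[of "real m - 1" d] d m
    by (subst nn_integral_cmult) (auto intro!: arg_cong[of _ _ "(*) _"] nn_integral_has_integral_lebesgue)
  also have "\<dots> = ennreal (unit_ball_vol (real m) * d ^ m)"
    using m d by (subst ennreal_mult[symmetric]) (auto simp: powr_realpow')
  finally show ?thesis
    by (subst (asm) nn_integral_cmult) (auto simp: m_def)
qed

text \<open>The cone over a piece of the sphere of diameter \<open>d\<close> lies in a cylinder of radius \<open>d\<close>.\<close>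

lemma emeasure_sphere_measure_pos:
  assumes n: "CARD('n) \<ge> 2"
  shows "emeasure (sphere_measure :: (real^'n) measure) (sphere 0 1) > 0"
proof -
  let ?S = "sphere (0::real^'n) 1" and ?m = "CARD('n) - 1"
  let ?\<kappa> = "unit_ball_vol (real ?m)"
  \<comment> \<open>The weight uses half the diameter, while the cylinder has the full diameter as
    its radius; this costs the factor \<open>2 ^ ?m\<close>.\<close>
  have cover: "emeasure lborel (cball (0::real^'n) 1) \<le> ennreal (2 ^ ?m) * (\<Sum>i. hausdorff_weight ?m (U i))"
    if U: "?S \<subseteq> (\<Union>i. U i)" "\<And>i. bounded (U i)" "\<And>i. diameter (U i) \<le> 1" for U :: "nat \<Rightarrow> (real^'n) set"
  proof -
    define x where "x i = (SOME x. x \<in> U i \<inter> ?S)" for i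
    define C where "C i = (if U i \<inter> ?S = {} then {} else
      {v. 0 \<le> v \<bullet> x i \<and> v \<bullet> x i \<le> 1 \<and> (norm v)\<^sup>2 - (v \<bullet> x i)\<^sup>2 \<le> (diameter (U i))\<^sup>2})" for i
    have x: "x i \<in> U i \<and> norm (x i) = 1" if "U i \<inter> ?S \<noteq> {}" for i
    proof -
      have "x i \<in> U i \<inter> ?S" unfolding x_def using that by (intro someI_ex[of "\<lambda>x. x \<in> U i \<inter> ?S"]) blast
      then show ?thesis by simp
    qed
    have C_meas: "C i \<in> sets borel" for i
    proof -
      have "{v. 0 \<le> v \<bullet> x i \<and> v \<bullet> x i \<le> 1 \<and> (norm v)\<^sup>2 - (v \<bullet> x i)\<^sup>2 \<le> (diameter (U i))\<^sup>2} \<in> sets borel"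
        by measurable
      then show ?thesis by (simp add: C_def)
    qed
    have "emeasure lborel (C i) \<le> ennreal (2 ^ ?m) * hausdorff_weight ?m (U i)" for i
    proof (cases "U i \<inter> ?S = {}")
      case False
      then have "emeasure lborel (C i) = ennreal (?\<kappa> * diameter (U i) ^ ?m)"
        using x[OF False] diameter_ge_0[OF U(2), of i] n by (simp add: C_def emeasure_cylinder)
      also have "\<dots> = ennreal (2 ^ ?m * (?\<kappa> * (diameter (U i) / 2) ^ ?m))"
        by (simp add: power_divide)
      also have "\<dots> = ennreal (2 ^ ?m) * hausdorff_weight ?m (U i)"
        using False by (subst ennreal_mult') (auto simp: hausdorff_weight_def)
      finally show ?thesis by simp
    qed (simp add: C_def)
    then have sum: "(\<Sum>i. emeasure lborel (C i)) \<le> (\<Sum>i. ennreal (2 ^ ?m) * hausdorff_weight ?m (U i))"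
      by (intro suminf_le) auto
    have "cball 0 1 \<subseteq> (\<Union>i. C i)"
    proof
      fix v :: "real^'n" assume v: "v \<in> cball 0 1"
      obtain z where z: "norm z = 1" "v = norm v *\<^sub>R z"
      proof (cases "v = 0")
        case True
        obtain k :: 'n where True by simp
        show ?thesis using True by (intro that[of "axis k 1"]) auto
      next
        case False
        then show ?thesis by (intro that[of "v /\<^sub>R norm v"]) auto
      qed
      then obtain i where i: "z \<in> U i" using U(1) by auto
      with z have ne: "U i \<inter> ?S \<noteq> {}" by auto
      define c where "c = z \<bullet> x i"
      have d: "norm (z - x i) \<le> diameter (U i)"
        using diameter_bounded_bound[OF U(2), of z i "x i"] i x[OF ne] by (simp add: dist_norm)
      have sq: "(norm (z - x i))\<^sup>2 = 2 - 2 * c"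
        using z(1) x[OF ne] unfolding power2_norm_eq_inner
        by (simp add: inner_diff_left inner_diff_right norm_eq_1 c_def inner_commute[of "x i" z])
      have "(norm (z - x i))\<^sup>2 \<le> (diameter (U i))\<^sup>2" using d by (intro power_mono) auto
      moreover have "(norm (z - x i))\<^sup>2 \<le> 1\<^sup>2" using d U(3)[of i] by (intro power_mono) auto
      moreover have "c \<le> 1" using norm_cauchy_schwarz[of z "x i"] z(1) x[OF ne] by (simp add: c_def)
      \<comment> \<open>Diameter at most 1 keeps the cosine \<open>c\<close> nonnegative, so the
        cone lies above the base of the cylinder.\<close>
      ultimately have c: "0 \<le> c" "c \<le> 1" "2 - 2 * c \<le> (diameter (U i))\<^sup>2" using sq by auto
      have vx: "v \<bullet> x i = norm v * c" by (subst z(2)) (simp add: c_def)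
      have v1: "norm v \<le> 1" using v by simp
      \<comment> \<open>The squared distance of \<open>v\<close> from the axis is at most
        \<open>1 - c * c\<close>, hence at most \<open>2 * (1 - c)\<close>, which is the squared
        chord and bounded by the squared diameter.\<close>
      have "(norm v)\<^sup>2 - (v \<bullet> x i)\<^sup>2 = (norm v)\<^sup>2 * ((1 - c) * (1 + c))"
        by (simp add: vx power2_eq_square algebra_simps)
      also have "\<dots> \<le> 1 * ((1 - c) * 2)"
        using c v1 by (intro mult_mono mult_left_mono) (auto simp: power_le_one)
      finally have "(norm v)\<^sup>2 - (v \<bullet> x i)\<^sup>2 \<le> (diameter (U i))\<^sup>2" using c by simp
      then have "v \<in> C i"
        using ne c v1 by (simp add: C_def vx mult_le_one)
      then show "v \<in> (\<Union>i. C i)" by blast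
    qed
    then have "emeasure lborel (cball (0::real^'n) 1) \<le> emeasure lborel (\<Union>i. C i)"
      using C_meas by (intro emeasure_mono) auto
    also have "\<dots> \<le> (\<Sum>i. emeasure lborel (C i))"
      using C_meas by (intro emeasure_subadditive_countably) auto
    finally show ?thesis using sum by simp
  qed
  have "hausdorff_premeasure 1 ?m ?S > 0"
  proof (rule ccontr)
    assume "\<not> ?thesis"
    \<comment> \<open>The threshold is the volume of the unit ball divided by the factor lost in
      \<open>cover\<close>; a cover of smaller weight would have too little volume.\<close>
    then have "hausdorff_premeasure 1 ?m ?S < ennreal (unit_ball_vol (real CARD('n)) / 2 ^ ?m)"
      using unit_ball_vol_pos[of "real CARD('n)"] by (simp add: zero_less_iff_neq_zero ennreal_eq_0_iff not_le)
    then obtain U where U: "?S \<subseteq> (\<Union>i. U i)" "\<And>i. bounded (U i)" "\<And>i. diameter (U i) \<le> 1"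
      "(\<Sum>i. hausdorff_weight ?m (U i)) < ennreal (unit_ball_vol (real CARD('n)) / 2 ^ ?m)"
      unfolding hausdorff_premeasure_def by (subst (asm) INF_less_iff) auto
    have "ennreal (unit_ball_vol (real CARD('n))) \<le> ennreal (2 ^ ?m) * (\<Sum>i. hausdorff_weight ?m (U i))"
      using cover[OF U(1,2,3)] by (simp add: emeasure_cball)
    also have "\<dots> < ennreal (2 ^ ?m) * ennreal (unit_ball_vol (real CARD('n)) / 2 ^ ?m)"
      using U(4) by (intro ennreal_mult_strict_left_mono) auto
    also have "\<dots> = ennreal (unit_ball_vol (real CARD('n)))"
      by (subst ennreal_mult[symmetric]) auto
    finally show False by simp
  qed
  also have "\<dots> \<le> hausdorff_outer ?m ?S" by (rule hausdorff_premeasure_le_outer) simp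
  finally show ?thesis by (subst emeasure_sphere_measure) auto
qed

text \<open>If the integral vanished, then for every unit vector \<open>e\<close> almost all
  \<open>u\<close> would satisfy \<open>u \<bullet> e \<le> 0\<close>. Taking the finitely many
  basis vectors and their negatives gives \<open>u = 0\<close> almost everywhere on a sphere of
  positive mass. The result allows division by c(n, r) in D.\<close>

lemma sphere_const_pos:
  assumes n: "CARD('n) \<ge> 2" and r: "r > 0"
  shows "sphere_const TYPE(real^'n) r > 0"
proof (rule ccontr)
  let ?\<sigma> = "sphere_measure :: (real^'n) measure"
  assume "\<not> ?thesis"
  then have c: "sphere_const TYPE(real^'n) r = 0" using sphere_const_nonneg[OF r, where 'n = 'n] by simp
  have [measurable]: "(\<lambda>u. u) \<in> ?\<sigma> \<rightarrow>\<^sub>M borel" by (rule measurable_sphere_measure) simp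
  have "AE u in ?\<sigma>. u \<bullet> e \<le> 0" if e: "norm e = 1" for e
  proof -
    have "AE u in ?\<sigma>. ennreal (max 0 (u \<bullet> e) powr r) = 0"
      using nn_integral_sphere_pos_part[OF r e] c by (subst nn_integral_0_iff_AE[symmetric]) auto
    then show ?thesis by eventually_elim (auto simp: max_def split: if_splits)
  qed
  from this[of "b :: real^'n" for b] this[of "- b :: real^'n" for b]
  have "AE u in ?\<sigma>. \<forall>b\<in>Basis. u \<bullet> b \<le> 0 \<and> u \<bullet> (- b) \<le> 0"
    by (intro AE_finite_allI) (auto simp del: inner_minus_right)
  then have "AE u in ?\<sigma>. False"
  proof (rule AE_mp, intro AE_I2 impI)
    fix u :: "real^'n" assume u: "u \<in> space ?\<sigma>" and "\<forall>b\<in>Basis. u \<bullet> b \<le> 0 \<and> u \<bullet> (- b) \<le> 0"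
    then have "\<forall>b\<in>Basis. u \<bullet> b = 0" by (auto intro: antisym)
    then have "u = 0" by (simp add: euclidean_all_zero_iff)
    with u show False by simp
  qed
  then have "emeasure ?\<sigma> (sphere 0 1) = 0"
    using ae_filter_eq_bot_iff[of ?\<sigma>] by (simp add: trivial_limit_def)
  with emeasure_sphere_measure_pos[OF n] show False by simp
qed

text \<open>Gram-Schmidt with \<open>y\<close> first, so that \<open>y\<close> has angle 0 and
  \<open>b\<close> the angle given by \<open>arccos\<close>, as in
  \<open>min_integral\<close>.\<close>

lemma orthonormal_frame:
  fixes b y :: "'a::euclidean_space"
  assumes n: "DIM('a) \<ge> 2" and b: "norm b = 1" and y: "y \<noteq> 0"
  obtains e1 e2 where "norm e1 = 1" "norm e2 = 1" "e1 \<bullet> e2 = 0" "y = norm y *\<^sub>R e1"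
    "b = cos (arccos (y \<bullet> b / norm y)) *\<^sub>R e1 + sin (arccos (y \<bullet> b / norm y)) *\<^sub>R e2"
proof -
  define e1 where "e1 = y /\<^sub>R norm y"
  have e1: "norm e1 = 1" "y = norm y *\<^sub>R e1" using y by (auto simp: e1_def)
  define c where "c = y \<bullet> b / norm y"
  have c: "c = e1 \<bullet> b" by (simp add: c_def e1_def divide_inverse mult.commute)
  have c1: "\<bar>c\<bar> \<le> 1" using Cauchy_Schwarz_ineq2[of e1 b] e1 b by (simp add: c)
  define w where "w = b - c *\<^sub>R e1"
  have w1: "e1 \<bullet> w = 0" using e1 by (simp add: w_def inner_diff_right c norm_eq_1)
  have "w \<bullet> w = 1 - c * c" using e1 b
    by (simp add: w_def inner_diff_right inner_diff_left norm_eq_1 c inner_commute[of b e1])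
  then have w2: "norm w = sin (arccos c)" using c1
    by (simp add: norm_eq_sqrt_inner sin_arccos_abs power2_eq_square)
  have cc: "cos (arccos c) = c" using c1 by (simp add: cos_arccos_abs)
  obtain e2 where e2: "norm e2 = 1" "e1 \<bullet> e2 = 0" "w = norm w *\<^sub>R e2"
  proof (cases "w = 0")
    \<comment> \<open>Parallel vectors leave \<open>e2\<close> free; dimension at least 2 provides
      an orthogonal direction.\<close>
    case True
    obtain z where z: "z \<noteq> 0" "orthogonal e1 z" using orthogonal_to_vector_exists[OF n, of e1] by blast
    then show ?thesis using True by (intro that[of "z /\<^sub>R norm z"]) (auto simp: orthogonal_def)
  next
    case False
    then show ?thesis using w1 by (intro that[of "w /\<^sub>R norm w"]) auto
  qed
  have "b = cos (arccos c) *\<^sub>R e1 + sin (arccos c) *\<^sub>R e2"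
    using e2(3) unfolding w2 cc by (simp add: w_def algebra_simps)
  with e1 e2 show ?thesis by (intro that[of e1 e2]) (auto simp: c_def)
qed

lemma hitting_self:
  fixes x :: "real^'n"
  assumes \<gamma>: "\<gamma> > 0" and r: "r > 0"
  shows "hitting \<gamma> r x x = capacity TYPE(real^'n) \<gamma> r * sphere_const TYPE(real^'n) r * norm x powr r"
proof -
  have cap: "capacity TYPE(real^'n) \<gamma> r \<ge> 0" using \<gamma> r by (simp add: capacity_def)
  have [measurable]: "(\<lambda>u. u) \<in> (sphere_measure :: (real^'n) measure) \<rightarrow>\<^sub>M borel"
    by (rule measurable_sphere_measure) simp
  have "(\<integral>\<^sup>+u. ennreal (max 0 (max (u \<bullet> x) (u \<bullet> x)) powr r) \<partial>sphere_measure)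
      = ennreal (sphere_const TYPE(real^'n) r * norm x powr r)"
  proof (cases "x = 0")
    case True
    then show ?thesis using r by simp
  next
    case False
    define e where "e = x /\<^sub>R norm x"
    have e: "norm e = 1" "x = norm x *\<^sub>R e" using False by (auto simp: e_def)
    have "max 0 (max (u \<bullet> x) (u \<bullet> x)) powr r = norm x powr r * max 0 (u \<bullet> e) powr r" for u
      by (subst e(2), subst (2) e(2)) (simp add: pos_part_mult powr_mult)
    then have "(\<integral>\<^sup>+u. ennreal (max 0 (max (u \<bullet> x) (u \<bullet> x)) powr r) \<partial>sphere_measure)
        = (\<integral>\<^sup>+u. ennreal (norm x powr r) * ennreal (max 0 (u \<bullet> e) powr r) \<partial>sphere_measure)"
      by (simp add: ennreal_mult)
    also have "\<dots> = ennreal (norm x powr r) * ennreal (sphere_const TYPE(real^'n) r)"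
      using nn_integral_sphere_pos_part[OF r e(1)] by (subst nn_integral_cmult) auto
    finally show ?thesis using sphere_const_nonneg[OF r, where 'n = 'n] by (simp add: ennreal_mult mult.commute)
  qed
  then have "ennreal (hitting \<gamma> r x x) = ennreal (capacity TYPE(real^'n) \<gamma> r * (sphere_const TYPE(real^'n) r * norm x powr r))"
    unfolding hitting_eq[OF assms] using cap sphere_const_nonneg[OF r, where 'n = 'n]
    by (simp add: ennreal_mult)
  then show ?thesis
    using cap sphere_const_nonneg[OF r, where 'n = 'n] hitting_nonneg[of \<gamma> r x x] by (simp add: mult_ac)
qed

section \<open>The overlap in polar coordinates\<close>

definition overlap :: "real \<Rightarrow> real \<Rightarrow> 'a::euclidean_space \<Rightarrow> 'a \<Rightarrow> real" where
  "overlap \<gamma> r x y = hitting \<gamma> r x x + hitting \<gamma> r y y - hitting \<gamma> r x y"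

text \<open>For nonnegative numbers the \<open>r\<close>-th powers of maximum and minimum add up to
  those of the two numbers. The identity is used as a sum in \<open>ennreal\<close>, and finiteness
  then permits the subtraction in \<open>overlap\<close>.\<close>

lemma overlap_eq:
  fixes x y :: "'a::euclidean_space"
  assumes \<gamma>: "\<gamma> > 0" and r: "r > 0"
  shows "overlap \<gamma> r x y \<ge> 0"
    and "ennreal (overlap \<gamma> r x y) = ennreal (capacity TYPE('a) \<gamma> r) *
      (\<integral>\<^sup>+u. ennreal (min (max 0 (u \<bullet> x)) (max 0 (u \<bullet> y)) powr r) \<partial>sphere_measure)"
proof -
  let ?k = "ennreal (capacity TYPE('a) \<gamma> r)" and ?\<sigma> = "sphere_measure :: 'a measure"
  let ?m = "?k * (\<integral>\<^sup>+u. ennreal (min (max 0 (u \<bullet> x)) (max 0 (u \<bullet> y)) powr r) \<partial>?\<sigma>)"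
  have [measurable]: "(\<lambda>u. u) \<in> ?\<sigma> \<rightarrow>\<^sub>M borel"
    by (rule measurable_sphere_measure) simp
  have "ennreal (hitting \<gamma> r x y) + ?m
      = ?k * (\<integral>\<^sup>+u. ennreal (max 0 (max (u \<bullet> x) (u \<bullet> y)) powr r)
          + ennreal (min (max 0 (u \<bullet> x)) (max 0 (u \<bullet> y)) powr r) \<partial>?\<sigma>)"
    unfolding hitting_eq[OF assms] by (subst nn_integral_add) (auto simp: distrib_left)
  also have "\<dots> = ?k * (\<integral>\<^sup>+u. ennreal (max 0 (max (u \<bullet> x) (u \<bullet> x)) powr r)
          + ennreal (max 0 (max (u \<bullet> y) (u \<bullet> y)) powr r) \<partial>?\<sigma>)"
    by (intro arg_cong[of _ _ "(*) _"] nn_integral_cong) (auto simp: max_def min_def add.commute)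
  also have "\<dots> = ennreal (hitting \<gamma> r x x) + ennreal (hitting \<gamma> r y y)"
    unfolding hitting_eq[OF assms] by (subst nn_integral_add) (auto simp: distrib_left)
  finally have eq: "ennreal (hitting \<gamma> r x y) + ?m = ennreal (hitting \<gamma> r x x + hitting \<gamma> r y y)"
    by (simp add: hitting_nonneg)
  then have "?m \<noteq> \<infinity>" by (metis ennreal_add_eq_top ennreal_neq_top infinity_ennreal_def)
  then obtain q where q: "?m = ennreal q" "q \<ge> 0" by (cases ?m) auto
  with eq have "hitting \<gamma> r x y + q = hitting \<gamma> r x x + hitting \<gamma> r y y"
    by (simp add: hitting_nonneg flip: ennreal_plus)
  then have "overlap \<gamma> r x y = q" by (simp add: overlap_def)
  then show "overlap \<gamma> r x y \<ge> 0" "ennreal (overlap \<gamma> r x y) = ?m" using q by simp_all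
qed

lemma overlap_orthogonal:
  fixes f :: "'a::euclidean_space \<Rightarrow> 'a"
  assumes "\<gamma> > 0" "r > 0" and f: "orthogonal_transformation f"
  shows "overlap \<gamma> r (f x) (f y) = overlap \<gamma> r x y"
proof -
  have "ennreal (overlap \<gamma> r (f x) (f y)) = ennreal (overlap \<gamma> r x y)"
    unfolding overlap_eq(2)[OF assms(1,2)]
    using f nn_integral_sphere_orthogonal[OF f, of "\<lambda>u. ennreal (min (max 0 (u \<bullet> f x)) (max 0 (u \<bullet> f y)) powr r)"]
    by (simp add: orthogonal_transformation_def)
  then show ?thesis by (simp add: overlap_eq(1)[OF assms(1,2)])
qed

text \<open>In the frame with \<open>y\<close> along \<open>e1\<close> the plane of the two points
  becomes the coordinate plane of \<open>min_integral\<close>. Taking \<rho> out by homogeneity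
  leaves a unit vector and a vector of length \<open>norm y / \<rho>\<close>. On the right only the
  norm of \<open>y\<close> and its inner product with \<open>b\<close> remain.\<close>

lemma overlap_polar:
  fixes b y :: "real^'n"
  assumes n: "CARD('n) \<ge> 2" and \<gamma>: "\<gamma> > 0" and r: "r > 0" and b: "norm b = 1" and \<rho>: "\<rho> > 0"
  shows "ennreal (overlap \<gamma> r (\<rho> *\<^sub>R b) y)
    = ennreal (capacity TYPE(real^'n) \<gamma> r * sphere_const TYPE(real^'n) r / cos_integral r * \<rho> powr r)
      * min_integral r (norm y / \<rho>) (arccos (y \<bullet> b / norm y))"
proof (cases "y = 0")
  \<comment> \<open>For \<open>y = 0\<close> the quotient in the angle is 0 by convention, but both
    sides vanish for every angle.\<close>
  case True
  have "overlap \<gamma> r (\<rho> *\<^sub>R b) 0 = 0"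
  proof -
    have "min (max 0 a) (max 0 0) = (0::real)" for a by simp
    then have "ennreal (overlap \<gamma> r (\<rho> *\<^sub>R b) 0) = 0"
      using r unfolding overlap_eq(2)[OF \<gamma> r] by simp
    then show ?thesis using overlap_eq(1)[OF \<gamma> r, of "\<rho> *\<^sub>R b" 0] by (simp add: ennreal_eq_0_iff)
  qed
  moreover have "min_integral r 0 \<phi> = 0" for \<phi>
    using r by (simp add: min_integral_def min_absorb2)
  ultimately show ?thesis using True by simp
next
  case False
  let ?k = "capacity TYPE(real^'n) \<gamma> r" and ?c = "sphere_const TYPE(real^'n) r" and ?W = "cos_integral r"
  let ?\<phi> = "arccos (y \<bullet> b / norm y)"
  have [measurable]: "(\<lambda>u. u) \<in> (sphere_measure :: (real^'n) measure) \<rightarrow>\<^sub>M borel"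
    by (rule measurable_sphere_measure) simp
  have k: "?k \<ge> 0" using \<gamma> r by (simp add: capacity_def)
  have W: "?W > 0" by (rule cos_integral_pos[OF r])
  have c: "?c \<ge> 0" by (rule sphere_const_nonneg[OF r])
  obtain e1 e2 where e: "norm e1 = 1" "norm e2 = 1" "e1 \<bullet> e2 = 0" and y: "y = norm y *\<^sub>R e1"
    and be: "b = cos ?\<phi> *\<^sub>R e1 + sin ?\<phi> *\<^sub>R e2"
    using orthonormal_frame[of b y] n b False by auto
  let ?f = "\<lambda>u. min (max 0 (cos ?\<phi> * (u \<bullet> e1) + sin ?\<phi> * (u \<bullet> e2))) (norm y / \<rho> * max 0 (u \<bullet> e1)) powr r"
  have "min (max 0 (u \<bullet> (\<rho> *\<^sub>R b))) (max 0 (u \<bullet> y)) powr r = \<rho> powr r * ?f u" for u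
  proof -
    have ub: "u \<bullet> b = cos ?\<phi> * (u \<bullet> e1) + sin ?\<phi> * (u \<bullet> e2)"
      by (subst be) (simp add: inner_add_right)
    have uy: "u \<bullet> y = norm y * (u \<bullet> e1)" by (subst y) simp
    have "min (max 0 (u \<bullet> (\<rho> *\<^sub>R b))) (max 0 (u \<bullet> y))
        = min (\<rho> * max 0 (u \<bullet> b)) (norm y * max 0 (u \<bullet> e1))"
      using \<rho> by (simp add: uy pos_part_mult)
    also have "\<dots> = \<rho> * min (max 0 (u \<bullet> b)) (norm y / \<rho> * max 0 (u \<bullet> e1))"
      using \<rho> by (simp add: min_mult_distrib_left)
    finally show ?thesis unfolding ub by (simp only: powr_mult)
  qed
  then have "(\<integral>\<^sup>+u. ennreal (min (max 0 (u \<bullet> (\<rho> *\<^sub>R b))) (max 0 (u \<bullet> y)) powr r) \<partial>sphere_measure)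
      = (\<integral>\<^sup>+u. ennreal (\<rho> powr r) * ennreal (?f u) \<partial>sphere_measure)"
    by (simp add: ennreal_mult)
  also have "\<dots> = ennreal (\<rho> powr r) * (\<integral>\<^sup>+u. ennreal (?f u) \<partial>sphere_measure)"
    by (intro nn_integral_cmult) measurable
  finally have 1: "ennreal (overlap \<gamma> r (\<rho> *\<^sub>R b) y)
      = ennreal ?k * (ennreal (\<rho> powr r) * (\<integral>\<^sup>+u. ennreal (?f u) \<partial>sphere_measure))"
    unfolding overlap_eq(2)[OF \<gamma> r] by simp
  have 2: "ennreal ?W * (\<integral>\<^sup>+u. ennreal (?f u) \<partial>sphere_measure) = ennreal ?c * min_integral r (norm y / \<rho>) ?\<phi>"
    using \<rho> by (intro nn_integral_sphere_min[OF e r]) simp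
  have "(\<integral>\<^sup>+u. ennreal (?f u) \<partial>sphere_measure) = ennreal (inverse ?W) * (ennreal ?W * (\<integral>\<^sup>+u. ennreal (?f u) \<partial>sphere_measure))"
    using W by (simp add: mult.assoc[symmetric] ennreal_mult[symmetric])
  also have "\<dots> = ennreal (?c / ?W) * min_integral r (norm y / \<rho>) ?\<phi>"
    unfolding 2 using W c by (simp add: mult.assoc[symmetric] ennreal_mult[symmetric] divide_inverse mult.commute)
  finally have 3: "(\<integral>\<^sup>+u. ennreal (?f u) \<partial>sphere_measure) = ennreal (?c / ?W) * min_integral r (norm y / \<rho>) ?\<phi>" .
  have mult: "ennreal p * (ennreal q * (ennreal s * z)) = ennreal (p * s * q) * z"
    if "p \<ge> 0" "q \<ge> 0" "s \<ge> 0" for p q s z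
    using that by (simp add: ennreal_mult mult_ac)
  have "?c / ?W \<ge> 0" using W c by simp
  from mult[OF k powr_ge_zero this] show ?thesis
    unfolding 1 3 by (simp only: times_divide_eq_right)
qed

lemma borel_measurable_min_integral:
  assumes r: "r > 0" and [measurable]: "f \<in> borel_measurable N" "g \<in> borel_measurable N"
  shows "(\<lambda>z. min_integral r (f z) (g z)) \<in> borel_measurable N"
  unfolding min_integral_def by measurable

lemma min_integral_le:
  assumes r: "r > 0" and t: "0 \<le> t" "t \<le> 1"
  shows "min_integral r t \<phi> \<le> ennreal (2 * pi)"
proof -
  have "min_integral r t \<phi> \<le> (\<integral>\<^sup>+\<theta>. 1 * indicator {-pi..<pi} \<theta> \<partial>lborel)"
    unfolding min_integral_def
  proof (intro nn_integral_mono mult_right_mono)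
    fix \<theta>
    have "min (max 0 (cos (\<theta> - \<phi>))) (t * max 0 (cos \<theta>)) \<le> 1"
      using cos_le_one[of "\<theta> - \<phi>"] by (simp add: min_le_iff_disj)
    then have "min (max 0 (cos (\<theta> - \<phi>))) (t * max 0 (cos \<theta>)) powr r \<le> 1"
      using r t by (intro powr_le1) auto
    then show "ennreal (min (max 0 (cos (\<theta> - \<phi>))) (t * max 0 (cos \<theta>)) powr r) \<le> 1"
      by (metis ennreal_1 ennreal_leI)
  qed simp
  then show ?thesis by simp
qed

text \<open>The overlap depends on \<open>y\<close> only through its norm and its angle with
  \<open>x\<close>, so \<open>x\<close> is rotated to a multiple of a basis vector and polar
  coordinates apply. The scaling \<open>s = norm x * t\<close> produces the power of
  \<open>norm x\<close>.\<close>

lemma nn_integral_overlap_cball: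
  fixes x :: "real^'n"
  assumes n: "CARD('n) \<ge> 2" and \<gamma>: "\<gamma> > 0" and r: "r > 0"
  shows "(\<integral>\<^sup>+y. ennreal (overlap \<gamma> r x y) * indicator (cball 0 (norm x)) y \<partial>lborel)
    = ennreal (capacity TYPE(real^'n) \<gamma> r * sphere_const TYPE(real^'n) r / cos_integral r
        * unit_ball_vol (real (CARD('n) - 1)) * real (CARD('n) - 1)) * ennreal (norm x powr (r + real CARD('n)))
      * (\<integral>\<^sup>+\<phi>. (\<integral>\<^sup>+t. ennreal (t ^ (CARD('n) - 1)) * min_integral r t \<phi> * indicator {0<..1} t \<partial>lborel)
          * ennreal (sin \<phi> ^ (CARD('n) - 2)) * indicator {0<..<pi} \<phi> \<partial>lborel)"
proof (cases "x = 0")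
  case True
  have "(\<integral>\<^sup>+y. ennreal (overlap \<gamma> r x y) * indicator (cball 0 (norm x)) y \<partial>lborel) = (\<integral>\<^sup>+y. 0 \<partial>(lborel :: (real^'n) measure))"
    by (intro nn_integral_cong_AE eventually_mono[OF AE_lborel_singleton[of 0]]) (auto simp: True)
  then show ?thesis using True r by simp
next
  case False
  define \<rho> where "\<rho> = norm x"
  have \<rho>: "\<rho> > 0" using False by (simp add: \<rho>_def)
  define m where "m = CARD('n) - 1"
  define V where "V = unit_ball_vol (real m) * real m"
  have V: "V \<ge> 0" by (simp add: V_def)
  define K where "K = capacity TYPE(real^'n) \<gamma> r * sphere_const TYPE(real^'n) r / cos_integral r"
  have K: "K \<ge> 0"
    using \<gamma> r sphere_const_nonneg[OF r, where 'n = 'n] cos_integral_pos[OF r] by (simp add: K_def capacity_def)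
  obtain i j :: 'n where ij: "i \<noteq> j"
  proof (rule ccontr)
    assume "\<not> thesis"
    with that have "(UNIV :: 'n set) = {undefined}" by auto
    then have "CARD('n) = 1" by (metis card_1_singleton_iff One_nat_def)
    with n show False by simp
  qed
  define b b' :: "real^'n" where "b = axis i 1" and "b' = axis j 1"
  have b: "b \<in> Basis" "norm b = 1" "norm b' = 1" "b \<bullet> b' = 0"
    using ij by (auto simp: b_def b'_def axis_in_Basis_iff inner_axis_axis)
  obtain f where f: "orthogonal_transformation f" "f (\<rho> *\<^sub>R b) = x"
    using orthogonal_transformation_exists[of "\<rho> *\<^sub>R b" x] \<rho> b by (auto simp: \<rho>_def)
  have [measurable]: "cball (0::real^'n) \<rho> \<in> sets borel" by simp
  have ov [measurable (raw)]: "(\<lambda>z. overlap \<gamma> r (p z) (q z)) \<in> borel_measurable N"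
    if "p \<in> borel_measurable N" "q \<in> borel_measurable N" for p q :: "'z \<Rightarrow> real^'n" and N
    unfolding overlap_def using that by (intro borel_measurable_add borel_measurable_diff borel_measurable_hitting \<gamma> r)
  have mi [measurable (raw)]: "(\<lambda>z. min_integral r (p z) (q z)) \<in> borel_measurable N"
    if "p \<in> borel_measurable N" "q \<in> borel_measurable N" for p q :: "'z \<Rightarrow> real" and N
    using that by (intro borel_measurable_min_integral r)
  \<comment> \<open>A representative with norm \<open>s\<close> and coordinate \<open>z\<close>
    along \<open>b\<close>: through it the dependence on these two numbers becomes a measurable
    function \<open>h\<close> on the whole plane, including the pairs with
    \<open>\<bar>z\<bar> > s\<close>, which no vector realises.\<close>
  define v where "v s z = z *\<^sub>R b + sqrt (s\<^sup>2 - z\<^sup>2) *\<^sub>R b'" for s z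
  have v: "v s z \<bullet> b = z" "norm (v s z) = s" if "\<bar>z\<bar> \<le> s" for s z
  proof -
    have "z\<^sup>2 \<le> s\<^sup>2" using that by (simp add: abs_le_square_iff[symmetric])
    then have "v s z \<bullet> v s z = s\<^sup>2"
      using b by (simp add: v_def inner_add_left inner_add_right norm_eq_1 inner_commute[of b' b] power2_eq_square[symmetric])
    then show "norm (v s z) = s" using that by (simp add: norm_eq_sqrt_inner)
    show "v s z \<bullet> b = z" using b by (simp add: v_def inner_add_left norm_eq_1 inner_commute[of b' b])
  qed
  define h where "h s z = ennreal (overlap \<gamma> r (\<rho> *\<^sub>R b) (v s z)) * indicator {..\<rho>} s" for s z
  have h_meas: "case_prod h \<in> borel_measurable borel"
    unfolding h_def v_def case_prod_unfold borel_prod[symmetric] by measurable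
  have "(\<integral>\<^sup>+y. ennreal (overlap \<gamma> r x y) * indicator (cball 0 (norm x)) y \<partial>lborel)
      = (\<integral>\<^sup>+y. ennreal (overlap \<gamma> r x (f y)) * indicator (cball 0 \<rho>) (f y) \<partial>lborel)"
    unfolding \<rho>_def[symmetric]
    by (rule nn_integral_lborel_orthogonal[OF f(1), symmetric]) measurable
  also have "\<dots> = (\<integral>\<^sup>+y. h (norm y) (y \<bullet> b) \<partial>lborel)"
  proof (rule nn_integral_cong)
    fix y :: "real^'n"
    have yb: "\<bar>y \<bullet> b\<bar> \<le> norm y" using Cauchy_Schwarz_ineq2[of y b] b by simp
    have "ennreal (overlap \<gamma> r (\<rho> *\<^sub>R b) y) = ennreal (overlap \<gamma> r (\<rho> *\<^sub>R b) (v (norm y) (y \<bullet> b)))"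
      unfolding overlap_polar[OF n \<gamma> r b(2) \<rho>] v[OF yb] ..
    moreover have "overlap \<gamma> r x (f y) = overlap \<gamma> r (\<rho> *\<^sub>R b) y"
      using overlap_orthogonal[OF \<gamma> r f(1), of "\<rho> *\<^sub>R b" y] f(2) by simp
    ultimately show "ennreal (overlap \<gamma> r x (f y)) * indicator (cball 0 \<rho>) (f y) = h (norm y) (y \<bullet> b)"
      using f(1) by (simp add: h_def indicator_def orthogonal_transformation_norm)
  qed
  also have "\<dots> = (\<integral>\<^sup>+\<phi>. (\<integral>\<^sup>+s. h s (s * cos \<phi>) * ennreal (V * s ^ m * sin \<phi> ^ (CARD('n) - 2))
        * indicator {0<..} s \<partial>lborel) * indicator {0<..<pi} \<phi> \<partial>lborel)"
    using nn_integral_lborel_polar[OF h_meas b(1)] n by (simp only: V_def m_def DIM_cart DIM_real mult_1_right)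
  also have "\<dots> = (\<integral>\<^sup>+\<phi>. ennreal (K * V) * ennreal (\<rho> powr (r + real CARD('n))) *
      ((\<integral>\<^sup>+t. ennreal (t ^ m) * min_integral r t \<phi> * indicator {0<..1} t \<partial>lborel)
          * ennreal (sin \<phi> ^ (CARD('n) - 2)) * indicator {0<..<pi} \<phi>) \<partial>lborel)"
  proof (rule nn_integral_cong)
    fix \<phi> :: real
    show "(\<integral>\<^sup>+s. h s (s * cos \<phi>) * ennreal (V * s ^ m * sin \<phi> ^ (CARD('n) - 2))
        * indicator {0<..} s \<partial>lborel) * indicator {0<..<pi} \<phi>
      = ennreal (K * V) * ennreal (\<rho> powr (r + real CARD('n))) *
      ((\<integral>\<^sup>+t. ennreal (t ^ m) * min_integral r t \<phi> * indicator {0<..1} t \<partial>lborel)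
          * ennreal (sin \<phi> ^ (CARD('n) - 2)) * indicator {0<..<pi} \<phi>)"
    proof (cases "\<phi> \<in> {0<..<pi}")
      case True
      define S where "S = sin \<phi> ^ (CARD('n) - 2)"
      have S: "S \<ge> 0" using True by (simp add: S_def sin_ge_zero)
      \<comment> \<open>The powers of \<rho>: \<open>r\<close> from the homogeneity of the overlap,
        \<open>m\<close> from the polar density, and one from the change of variable.\<close>
      have pw: "\<rho> powr (r + real CARD('n)) = \<rho> powr r * \<rho> ^ m * \<rho>"
        using \<rho> n by (simp add: powr_add powr_realpow m_def power_Suc2[symmetric] Suc_diff_le del: power_Suc2)
      have "(\<integral>\<^sup>+s. h s (s * cos \<phi>) * ennreal (V * s ^ m * S) * indicator {0<..} s \<partial>lborel)
          = (\<integral>\<^sup>+s. ennreal (K * \<rho> powr r) * min_integral r (s / \<rho>) \<phi> * ennreal (V * s ^ m * S) * indicator {0<..\<rho>} s \<partial>lborel)"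
      proof (rule nn_integral_cong)
        fix s :: real
        show "h s (s * cos \<phi>) * ennreal (V * s ^ m * S) * indicator {0<..} s
            = ennreal (K * \<rho> powr r) * min_integral r (s / \<rho>) \<phi> * ennreal (V * s ^ m * S) * indicator {0<..\<rho>} s"
        proof (cases "0 < s \<and> s \<le> \<rho>")
          case s: True
          then have "\<bar>s * cos \<phi>\<bar> \<le> s" by (simp add: abs_mult mult_left_le)
          from v[OF this] have "ennreal (overlap \<gamma> r (\<rho> *\<^sub>R b) (v s (s * cos \<phi>)))
              = ennreal (K * \<rho> powr r) * min_integral r (s / \<rho>) \<phi>"
            unfolding overlap_polar[OF n \<gamma> r b(2) \<rho>] using s True by (simp add: K_def arccos_cos)
          then show ?thesis using s by (simp add: h_def)
        qed (auto simp: h_def indicator_def)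
      qed
      also have "\<dots> = ennreal \<rho> * (\<integral>\<^sup>+t. ennreal (K * \<rho> powr r) * min_integral r ((\<rho> * t) / \<rho>) \<phi>
          * ennreal (V * (\<rho> * t) ^ m * S) * indicator {0<..\<rho>} (\<rho> * t) \<partial>lborel)"
        using \<rho> by (subst nn_integral_real_affine[where c = \<rho> and t = 0]) auto
      also have "\<dots> = (\<integral>\<^sup>+t. ennreal \<rho> * (ennreal (K * \<rho> powr r) * min_integral r ((\<rho> * t) / \<rho>) \<phi>
          * ennreal (V * (\<rho> * t) ^ m * S) * indicator {0<..\<rho>} (\<rho> * t)) \<partial>lborel)"
        by (intro nn_integral_cmult[symmetric]) measurable
      also have "\<dots> = (\<integral>\<^sup>+t. ennreal (K * V * (\<rho> powr (r + real CARD('n))) * S) *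
          (ennreal (t ^ m) * min_integral r t \<phi> * indicator {0<..1} t) \<partial>lborel)"
      proof (rule nn_integral_cong)
        fix t :: real
        show "ennreal \<rho> * (ennreal (K * \<rho> powr r) * min_integral r ((\<rho> * t) / \<rho>) \<phi>
          * ennreal (V * (\<rho> * t) ^ m * S) * indicator {0<..\<rho>} (\<rho> * t))
          = ennreal (K * V * (\<rho> powr (r + real CARD('n))) * S) *
          (ennreal (t ^ m) * min_integral r t \<phi> * indicator {0<..1} t)"
        proof (cases "0 < t \<and> t \<le> 1")
          case t: True
          have "ennreal \<rho> * ennreal (K * \<rho> powr r) * ennreal (V * (\<rho> * t) ^ m * S)
              = ennreal (\<rho> * (K * \<rho> powr r) * (V * (\<rho> * t) ^ m * S))"
            using \<rho> K V S t by (simp add: ennreal_mult)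
          also have "\<rho> * (K * \<rho> powr r) * (V * (\<rho> * t) ^ m * S) = K * V * (\<rho> powr (r + real CARD('n))) * S * t ^ m"
            unfolding pw by (simp add: power_mult_distrib)
          also have "ennreal \<dots> = ennreal (K * V * (\<rho> powr (r + real CARD('n))) * S) * ennreal (t ^ m)"
            using K V S t by (intro ennreal_mult) auto
          finally have e: "ennreal \<rho> * ennreal (K * \<rho> powr r) * ennreal (V * (\<rho> * t) ^ m * S)
              = ennreal (K * V * (\<rho> powr (r + real CARD('n))) * S) * ennreal (t ^ m)" .
          have comm: "a * (b * c * d * 1) = a * b * d * c" "a * (b * c * 1) = a * b * c" for a b c d :: ennreal
            by (simp_all add: mult_ac)
          have ind: "indicator {0<..\<rho>} (\<rho> * t) = (1::ennreal)" "indicator {0<..1} t = (1::ennreal)" "(\<rho> * t) / \<rho> = t"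
            using t \<rho> by (auto simp: indicator_def)
          show ?thesis unfolding ind by (subst comm(1), subst e, subst comm(2), rule refl)
        next
          case False
          then have "indicator {0<..\<rho>} (\<rho> * t) = (0::ennreal)" "indicator {0<..1} t = (0::ennreal)"
            using \<rho> by (auto simp: indicator_def zero_less_mult_iff)
          then show ?thesis by (simp only: mult_zero_right)
        qed
      qed
      also have "\<dots> = ennreal (K * V * (\<rho> powr (r + real CARD('n))) * S) *
          (\<integral>\<^sup>+t. ennreal (t ^ m) * min_integral r t \<phi> * indicator {0<..1} t \<partial>lborel)"
        by (intro nn_integral_cmult) measurable
      also have "ennreal (K * V * (\<rho> powr (r + real CARD('n))) * S)
          = ennreal (K * V) * ennreal (\<rho> powr (r + real CARD('n))) * ennreal S"
        using K V S by (simp add: ennreal_mult)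
      finally show ?thesis using True unfolding S_def[symmetric] by (simp add: mult_ac)
    qed simp
  qed
  also have "\<dots> = ennreal (K * V) * ennreal (\<rho> powr (r + real CARD('n))) *
      (\<integral>\<^sup>+\<phi>. ((\<integral>\<^sup>+t. ennreal (t ^ m) * min_integral r t \<phi> * indicator {0<..1} t \<partial>lborel)
          * ennreal (sin \<phi> ^ (CARD('n) - 2)) * indicator {0<..<pi} \<phi>) \<partial>lborel)"
    by (intro nn_integral_cmult) measurable
  finally show ?thesis unfolding K_def V_def m_def \<rho>_def by (simp only: mult.assoc)
qed

section \<open>The variance\<close>

text \<open>A shift by \<open>pi / 2\<close> turns the sine integral into
  \<open>cos_integral (real n - 2)\<close>. The case \<open>n = 2\<close> is separate, since the
  exponent 0 falls under the Gamma expression in \<open>sphere_const\<close>.\<close>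

lemma sphere_const_2_sin:
  assumes n: "n \<ge> 2"
  shows "(\<integral>\<^sup>+\<phi>. ennreal (sin \<phi> ^ (n - 2)) * indicator {0<..<pi} \<phi> \<partial>lborel)
      = ennreal (sphere_const TYPE(real^2) (real n - 2))"
    and "sphere_const TYPE(real^2) (real n - 2) > 0"
proof -
  let ?S = "sphere_const TYPE(real^2) (real n - 2)"
  show pos: "?S > 0"
  proof (cases "n = 2")
    case True
    then show ?thesis by (simp add: sphere_const_def Gamma_one_half_real)
  next
    case False
    then show ?thesis using n sphere_const_2[of "real n - 2"] cos_integral_pos[of "real n - 2"] by simp
  qed
  show "(\<integral>\<^sup>+\<phi>. ennreal (sin \<phi> ^ (n - 2)) * indicator {0<..<pi} \<phi> \<partial>lborel) = ennreal ?S"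
  proof (cases "n = 2")
    case True
    have "?S = pi"
      using True by (simp add: sphere_const_def Gamma_one_half_real powr_half_sqrt)
    then show ?thesis using True by simp
  next
    case False
    have r: "real n - 2 > 0" using False n by simp
    have rn: "real n - 2 = real (n - 2)" using n by simp
    have "(\<integral>\<^sup>+\<phi>. ennreal (sin \<phi> ^ (n - 2)) * indicator {0<..<pi} \<phi> \<partial>lborel)
        = (\<integral>\<^sup>+\<theta>. ennreal (cos \<theta> ^ (n - 2)) * indicator {- (pi / 2)<..<pi / 2} \<theta> \<partial>lborel)"
      by (subst nn_integral_real_affine[where c = 1 and t = "pi / 2"])
         (auto simp: sin_add intro!: nn_integral_cong split: split_indicator)
    also have "\<dots> = (\<integral>\<^sup>+\<theta>. ennreal (cos \<theta> powr (real n - 2)) * indicator {- (pi / 2)..pi / 2} \<theta> \<partial>lborel)"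
    proof (intro nn_integral_cong_AE)
      show "AE \<theta> in lborel. ennreal (cos \<theta> ^ (n - 2)) * indicator {- (pi / 2)<..<pi / 2} \<theta>
          = ennreal (cos \<theta> powr (real n - 2)) * indicator {- (pi / 2)..pi / 2} \<theta>"
        using AE_lborel_singleton[of "pi / 2"] AE_lborel_singleton[of "- (pi / 2)"]
      proof eventually_elim
        case (elim \<theta>)
        show ?case
        proof (cases "\<theta> \<in> {- (pi / 2)<..<pi / 2}")
          case True
          then have "cos \<theta> > 0" by (intro cos_gt_zero_pi) auto
          then show ?thesis using True by (simp add: rn powr_realpow del: of_nat_diff)
        next
          case False
          then have "indicator {- (pi / 2)<..<pi / 2} \<theta> = (0::ennreal)" "indicator {- (pi / 2)..pi / 2} \<theta> = (0::ennreal)"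
            using elim by (auto simp: indicator_def)
          then show ?thesis by simp
        qed
      qed
    qed
    also have "\<dots> = ennreal (cos_integral (real n - 2))"
      unfolding cos_integral_def using cos_powr_integral(1)[OF r, of "- (pi / 2)" "pi / 2"] by simp
    finally show ?thesis by (simp add: sphere_const_2[OF r])
  qed
qed

text \<open>Both sides come from the volume of the unit ball in polar coordinates. The equation
  converts the factor of dimension n - 1 that polar coordinates produce into \<kappa>_n and the
  normalising constant of \<open>E_const\<close>.\<close>

lemma unit_ball_vol_recursion:
  assumes n: "CARD('n::finite) \<ge> 2"
  shows "unit_ball_vol (real (CARD('n) - 1)) * real (CARD('n) - 1) * sphere_const TYPE(real^2) (real CARD('n) - 2)
    = real CARD('n) * unit_ball_vol (real CARD('n))"
proof -
  let ?S = "sphere_const TYPE(real^2) (real CARD('n) - 2)"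
  define m where "m = CARD('n) - 1"
  have m: "m \<ge> 1" "CARD('n) = Suc m" using n by (auto simp: m_def)
  define V where "V = unit_ball_vol (real m) * real m"
  have V: "V \<ge> 0" by (simp add: V_def)
  have S: "?S > 0" by (rule sphere_const_2_sin(2)[OF n])
  obtain k :: 'n where True by simp
  have b: "(axis k 1 :: real^'n) \<in> Basis" by (simp add: axis_in_Basis_iff)
  have "ennreal (unit_ball_vol (real CARD('n))) = (\<integral>\<^sup>+y. indicator (cball (0::real^'n) 1) y \<partial>lborel)"
    by (simp add: emeasure_cball)
  also have "\<dots> = (\<integral>\<^sup>+y. (\<lambda>s z. indicator {..1} s) (norm (y :: real^'n)) (y \<bullet> axis k 1) \<partial>lborel)"
    by (intro nn_integral_cong) (simp add: indicator_def)
  also have "\<dots> = (\<integral>\<^sup>+\<phi>. (\<integral>\<^sup>+s. indicator {..1} s * ennreal (V * s ^ m * sin \<phi> ^ (CARD('n) - 2))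
        * indicator {0<..} s \<partial>lborel) * indicator {0<..<pi} \<phi> \<partial>lborel)"
  proof -
    have "(\<lambda>(s, z). indicator {..1} s :: ennreal) \<in> borel_measurable (borel :: (real \<times> real) measure)"
      unfolding case_prod_unfold borel_prod[symmetric] by measurable
    from nn_integral_lborel_polar[OF this b] n show ?thesis
      by (simp only: V_def m_def DIM_cart DIM_real mult_1_right)
  qed
  also have "\<dots> = (\<integral>\<^sup>+\<phi>. ennreal (V / real CARD('n)) * (ennreal (sin \<phi> ^ (CARD('n) - 2)) * indicator {0<..<pi} \<phi>) \<partial>lborel)"
  proof (rule nn_integral_cong)
    fix \<phi> :: real
    show "(\<integral>\<^sup>+s. indicator {..1} s * ennreal (V * s ^ m * sin \<phi> ^ (CARD('n) - 2))
        * indicator {0<..} s \<partial>lborel) * indicator {0<..<pi} \<phi>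
      = ennreal (V / real CARD('n)) * (ennreal (sin \<phi> ^ (CARD('n) - 2)) * indicator {0<..<pi} \<phi>)"
    proof (cases "\<phi> \<in> {0<..<pi}")
      case True
      define T where "T = sin \<phi> ^ (CARD('n) - 2)"
      have T: "T \<ge> 0" using True by (simp add: T_def sin_ge_zero)
      have "(\<integral>\<^sup>+s. indicator {..1} s * ennreal (V * s ^ m * T) * indicator {0<..} s \<partial>lborel)
          = (\<integral>\<^sup>+s. ennreal (V * s ^ m * T) * indicator {0..1} s \<partial>lborel)"
        by (intro nn_integral_cong_AE eventually_mono[OF AE_lborel_singleton[of 0]])
           (auto simp: indicator_def)
      also have "\<dots> = ennreal (V * 1 ^ Suc m / Suc m * T - V * 0 ^ Suc m / Suc m * T)"
      proof (rule nn_integral_FTC_Icc)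
        show "((\<lambda>s. V * s ^ Suc m / Suc m * T) has_real_derivative V * x ^ m * T) (at x)" for x
          by (auto intro!: derivative_eq_intros simp: field_simps simp del: power_Suc of_nat_Suc)
      qed (use V T in auto)
      also have "\<dots> = ennreal (V / real CARD('n)) * ennreal T"
        using V T m by (simp flip: ennreal_mult)
      finally show ?thesis using True by (simp add: T_def)
    qed simp
  qed
  also have "\<dots> = ennreal (V / real CARD('n)) * ennreal ?S"
    by (subst nn_integral_cmult) (simp_all add: sphere_const_2_sin(1)[OF n])
  also have "\<dots> = ennreal (V / real CARD('n) * ?S)" using V S by (intro ennreal_mult[symmetric]) auto
  finally have "unit_ball_vol (real CARD('n)) = V / real CARD('n) * ?S"
    using V S by simp
  then show ?thesis using n by (simp add: V_def m_def field_simps)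
qed

text \<open>\<open>E_const\<close> is built from Bochner integrals, which default to 0 where
  integrability fails. On the open ranges its integrand agrees, up to the constant \<open>W\<close>,
  with the measurable \<open>min_integral\<close>; the bound \<open>2 * pi\<close> makes the
  iterated nonnegative integrals finite, so that \<open>enn2real\<close> is exact.\<close>

lemma E_const_nn_integral:
  assumes n: "n \<ge> 2" and r: "r > 0"
  shows "(\<integral>\<^sup>+\<phi>. (\<integral>\<^sup>+t. ennreal (t ^ (n - 1)) * min_integral r t \<phi> * indicator {0<..1} t \<partial>lborel)
          * ennreal (sin \<phi> ^ (n - 2)) * indicator {0<..<pi} \<phi> \<partial>lborel)
      = ennreal (cos_integral r * sphere_const TYPE(real^2) (real n - 2) * E_const n r / real n)"
    and "E_const n r \<ge> 0"
proof -
  define W where "W = cos_integral r"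
  have W: "W > 0" unfolding W_def by (rule cos_integral_pos[OF r])
  define N where "N \<phi> = (\<integral>\<^sup>+t. ennreal (t ^ (n - 1)) * min_integral r t \<phi> * indicator {0<..1} t \<partial>lborel)" for \<phi>
  have mi [measurable (raw)]: "(\<lambda>z. min_integral r (p z) (q z)) \<in> borel_measurable N"
    if "p \<in> borel_measurable N" "q \<in> borel_measurable N" for p q :: "'z \<Rightarrow> real" and N
    using that by (intro borel_measurable_min_integral r)
  have N_meas [measurable]: "N \<in> borel_measurable borel" unfolding N_def by measurable
  have N_le: "N \<phi> \<le> ennreal (2 * pi)" for \<phi>
  proof -
    have "N \<phi> \<le> (\<integral>\<^sup>+t. ennreal (2 * pi) * indicator {0..1::real} t \<partial>lborel)"
      unfolding N_def
    proof (rule nn_integral_mono)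
      fix t :: real
      have "ennreal (t ^ (n - 1)) * min_integral r t \<phi> \<le> 1 * ennreal (2 * pi)" if "0 < t" "t \<le> 1"
        using that min_integral_le[OF r, of t \<phi>] by (intro mult_mono) (auto intro: power_le_one)
      then show "ennreal (t ^ (n - 1)) * min_integral r t \<phi> * indicator {0<..1} t \<le> ennreal (2 * pi) * indicator {0..1} t"
        by (auto simp: indicator_def)
    qed
    also have "\<dots> = ennreal (2 * pi)" by (subst nn_integral_cmult_indicator) auto
    finally show ?thesis .
  qed
  have N_real: "ennreal (enn2real (N \<phi>)) = N \<phi>" for \<phi>
    using N_le[of \<phi>] by (intro ennreal_enn2real) (auto intro: le_less_trans)
  have inner: "(LBINT t=0..1. t ^ (n - 1) * (1 + t powr r - F_fun r t \<phi>)) = enn2real (N \<phi>) / W"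
    if \<phi>: "\<phi> \<in> {0<..<pi}" for \<phi>
  proof -
    define f where "f t = t ^ (n - 1) * (enn2real (min_integral r t \<phi>) / W)" for t
    have [measurable]: "f \<in> borel_measurable borel" unfolding f_def by measurable
    have F: "min_integral r t \<phi> = ennreal (W * (1 + t powr r - F_fun r t \<phi>))" "0 \<le> 1 + t powr r - F_fun r t \<phi>"
      if "0 < t" "t \<le> 1" for t
      using min_integral_eq_F[OF r that] \<phi> sphere_const_2[OF r] by (auto simp: W_def)
    have f_eq: "t ^ (n - 1) * (1 + t powr r - F_fun r t \<phi>) = f t" if "0 < t" "t \<le> 1" for t
    proof -
      have "0 \<le> W * (1 + t powr r - F_fun r t \<phi>)" using F(2)[OF that] W by simp
      then show ?thesis unfolding f_def F(1)[OF that] using W by simp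
    qed
    \<comment> \<open>The interval integral lives on the open interval, which fits
      \<open>min_integral_eq_F\<close>, where \<open>t\<close> has to be positive.\<close>
    have "(LBINT t=0..1. t ^ (n - 1) * (1 + t powr r - F_fun r t \<phi>)) = (LBINT t:{0<..<1}. f t)"
      unfolding zero_ereal_def one_ereal_def
      by (subst interval_integral_Ioo)
         (auto intro!: set_lebesgue_integral_cong simp: f_eq[unfolded One_nat_def])
    also have "\<dots> = (LINT t|lborel. indicator {0<..<1} t * f t)"
      by (simp add: set_lebesgue_integral_def)
    also have "\<dots> = enn2real (\<integral>\<^sup>+t. ennreal (indicator {0<..<1} t * f t) \<partial>lborel)"
      using W by (intro integral_eq_nn_integral) (auto simp: f_def indicator_def)
    also have "(\<integral>\<^sup>+t. ennreal (indicator {0<..<1} t * f t) \<partial>lborel)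
        = (\<integral>\<^sup>+t. ennreal (1 / W) * (ennreal (t ^ (n - 1)) * min_integral r t \<phi> * indicator {0<..1} t) \<partial>lborel)"
    proof (intro nn_integral_cong_AE eventually_mono[OF AE_lborel_singleton[of 1]])
      fix t :: real assume "t \<noteq> 1"
      show "ennreal (indicator {0<..<1} t * f t)
          = ennreal (1 / W) * (ennreal (t ^ (n - 1)) * min_integral r t \<phi> * indicator {0<..1} t)"
      proof (cases "0 < t \<and> t < 1")
        case True
        then have "min_integral r t \<phi> = ennreal (enn2real (min_integral r t \<phi>))" by (simp add: F W[THEN less_imp_le])
        then have "ennreal (1 / W) * (ennreal (t ^ (n - 1)) * min_integral r t \<phi>)
            = ennreal (1 / W) * (ennreal (t ^ (n - 1)) * ennreal (enn2real (min_integral r t \<phi>)))" by simp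
        also have "\<dots> = ennreal (f t)"
          using True W by (simp add: f_def flip: ennreal_mult)
        finally show ?thesis using True by simp
      qed (use \<open>t \<noteq> 1\<close> in \<open>auto simp: indicator_def\<close>)
    qed
    also have "\<dots> = ennreal (1 / W) * N \<phi>" unfolding N_def by (intro nn_integral_cmult) measurable
    finally show ?thesis using W by (simp add: enn2real_mult)
  qed
  define I where "I = (LBINT \<phi>=0..pi. sin \<phi> ^ (n - 2) * (LBINT t=0..1. t ^ (n - 1) * (1 + t powr r - F_fun r t \<phi>)))"
  let ?R = "\<integral>\<^sup>+\<phi>. N \<phi> * ennreal (sin \<phi> ^ (n - 2)) * indicator {0<..<pi} \<phi> \<partial>lborel"
  have "?R \<le> (\<integral>\<^sup>+\<phi>. ennreal (2 * pi) * indicator {0..pi} \<phi> \<partial>lborel)"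
  proof (rule nn_integral_mono)
    fix \<phi> :: real
    have "N \<phi> * ennreal (sin \<phi> ^ (n - 2)) \<le> ennreal (2 * pi) * 1" if "0 < \<phi>" "\<phi> < pi"
      using that N_le[of \<phi>] sin_ge_zero[of \<phi>] by (intro mult_mono) (auto intro: power_le_one)
    then show "N \<phi> * ennreal (sin \<phi> ^ (n - 2)) * indicator {0<..<pi} \<phi> \<le> ennreal (2 * pi) * indicator {0..pi} \<phi>"
      by (auto simp: indicator_def)
  qed
  also have "\<dots> = ennreal (2 * pi) * ennreal pi" by (subst nn_integral_cmult_indicator) auto
  finally have R: "?R < \<infinity>" by (rule le_less_trans) (simp add: ennreal_mult_less_top)
  have "I = (LBINT \<phi>:{0<..<pi}. sin \<phi> ^ (n - 2) * (LBINT t=0..1. t ^ (n - 1) * (1 + t powr r - F_fun r t \<phi>)))"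
    unfolding I_def by (subst interval_integral_Ioo) simp_all
  also have "\<dots> = (LBINT \<phi>:{0<..<pi}. sin \<phi> ^ (n - 2) * (enn2real (N \<phi>) / W))"
  proof (intro set_lebesgue_integral_cong allI impI)
    show "sin \<phi> ^ (n - 2) * (LBINT t=0..1. t ^ (n - 1) * (1 + t powr r - F_fun r t \<phi>))
        = sin \<phi> ^ (n - 2) * (enn2real (N \<phi>) / W)" if "\<phi> \<in> {0<..<pi}" for \<phi>
      by (simp only: inner[OF that])
  qed simp
  also have "\<dots> = (LINT \<phi>|lborel. indicator {0<..<pi} \<phi> * (sin \<phi> ^ (n - 2) * (enn2real (N \<phi>) / W)))"
    by (simp add: set_lebesgue_integral_def)
  also have "\<dots> = enn2real (\<integral>\<^sup>+\<phi>. ennreal (indicator {0<..<pi} \<phi> * (sin \<phi> ^ (n - 2) * (enn2real (N \<phi>) / W))) \<partial>lborel)"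
    using W by (intro integral_eq_nn_integral) (auto simp: indicator_def sin_ge_zero)
  also have "(\<integral>\<^sup>+\<phi>. ennreal (indicator {0<..<pi} \<phi> * (sin \<phi> ^ (n - 2) * (enn2real (N \<phi>) / W))) \<partial>lborel)
      = (\<integral>\<^sup>+\<phi>. ennreal (1 / W) * (N \<phi> * ennreal (sin \<phi> ^ (n - 2)) * indicator {0<..<pi} \<phi>) \<partial>lborel)"
  proof (rule nn_integral_cong)
    fix \<phi> :: real
    show "ennreal (indicator {0<..<pi} \<phi> * (sin \<phi> ^ (n - 2) * (enn2real (N \<phi>) / W)))
      = ennreal (1 / W) * (N \<phi> * ennreal (sin \<phi> ^ (n - 2)) * indicator {0<..<pi} \<phi>)"
    proof (cases "\<phi> \<in> {0<..<pi}")
      case True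
      have "ennreal (1 / W) * (N \<phi> * ennreal (sin \<phi> ^ (n - 2)))
          = ennreal (1 / W) * (ennreal (enn2real (N \<phi>)) * ennreal (sin \<phi> ^ (n - 2)))" by (simp only: N_real)
      also have "\<dots> = ennreal (sin \<phi> ^ (n - 2) * (enn2real (N \<phi>) / W))"
        using True W by (simp add: sin_ge_zero mult.commute flip: ennreal_mult)
      finally show ?thesis using True by simp
    qed simp
  qed
  also have "\<dots> = ennreal (1 / W) * ?R" by (intro nn_integral_cmult) measurable
  finally have I: "I = enn2real ?R / W" using W by (simp add: enn2real_mult)
  have E: "E_const n r = real n / sphere_const TYPE(real^2) (real n - 2) * I"
    by (simp add: E_const_def I_def)
  have S: "sphere_const TYPE(real^2) (real n - 2) > 0" by (rule sphere_const_2_sin(2)[OF n])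
  show "E_const n r \<ge> 0" unfolding E I using S W by simp
  have "?R = ennreal (enn2real ?R)" using R by simp
  also have "enn2real ?R = W * sphere_const TYPE(real^2) (real n - 2) * E_const n r / real n"
    unfolding E I using S W n by simp
  finally show "(\<integral>\<^sup>+\<phi>. (\<integral>\<^sup>+t. ennreal (t ^ (n - 1)) * min_integral r t \<phi> * indicator {0<..1} t \<partial>lborel)
          * ennreal (sin \<phi> ^ (n - 2)) * indicator {0<..<pi} \<phi> \<partial>lborel)
      = ennreal (cos_integral r * sphere_const TYPE(real^2) (real n - 2) * E_const n r / real n)"
    by (simp only: N_def[symmetric] W_def)
qed

text \<open>The inner integral contributes the power \<open>r + ?n\<close> of the norm, so the
  radial Gamma integral has the argument \<open>(?n + (r + ?n)) / r = 2 * ?n / r + 1\<close>. By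
  \<open>unit_ball_vol_recursion\<close> the polar factor \<open>V\<close> and the normalising
  constant \<open>?S\<close> of \<open>E_const\<close> combine to \<open>?n * ?\<kappa>\<close>, and
  \<open>cos_integral r\<close> cancels.\<close>

lemma nn_integral_overlap_exp:
  assumes n: "CARD('n) \<ge> 2" and \<gamma>: "\<gamma> > 0" and r: "r > 0" and B: "B > 0"
  shows "(\<integral>\<^sup>+x. (\<integral>\<^sup>+y. ennreal (overlap \<gamma> r x y * exp (- B * norm x powr r)) * indicator (cball 0 (norm x)) y \<partial>lborel)
        \<partial>(lborel :: (real^'n) measure))
    = ennreal (capacity TYPE(real^'n) \<gamma> r * sphere_const TYPE(real^'n) r * E_const CARD('n) r
        * (unit_ball_vol (real CARD('n)))\<^sup>2 * real CARD('n) / r * B powr (- (2 * real CARD('n) / r + 1))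
        * Gamma (2 * real CARD('n) / r + 1))"
proof -
  let ?n = "real CARD('n)" and ?S = "sphere_const TYPE(real^2) (real CARD('n) - 2)"
  let ?\<kappa> = "unit_ball_vol (real CARD('n))" and ?E = "E_const CARD('n) r"
  let ?A = "capacity TYPE(real^'n) \<gamma> r * sphere_const TYPE(real^'n) r"
  have A: "?A \<ge> 0" using \<gamma> r sphere_const_nonneg[OF r, where 'n = 'n] by (simp add: capacity_def)
  have E: "?E \<ge> 0" by (rule E_const_nn_integral(2)[OF n r])
  have S: "?S > 0" by (rule sphere_const_2_sin(2)[OF n])
  have W: "cos_integral r > 0" by (rule cos_integral_pos[OF r])
  define V where "V = unit_ball_vol (real (CARD('n) - 1)) * real (CARD('n) - 1)"
  have V: "V * ?S = ?n * ?\<kappa>" "V \<ge> 0"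
    using unit_ball_vol_recursion[OF n] by (simp_all add: V_def)
  have meas: "(\<lambda>y. ennreal (overlap \<gamma> r x y) * indicator (cball 0 (norm x)) y) \<in> borel_measurable borel" for x :: "real^'n"
    unfolding overlap_def
    by (intro borel_measurable_times_ennreal measurable_compose[OF _ measurable_ennreal] borel_measurable_add
        borel_measurable_diff borel_measurable_hitting \<gamma> r borel_measurable_indicator) auto
  have inner: "(\<integral>\<^sup>+y. ennreal (overlap \<gamma> r x y) * indicator (cball 0 (norm x)) y \<partial>lborel)
      = ennreal (?A * ?\<kappa> * ?E) * ennreal (norm x powr (r + ?n))" for x :: "real^'n"
  proof -
    have "(\<integral>\<^sup>+y. ennreal (overlap \<gamma> r x y) * indicator (cball 0 (norm x)) y \<partial>lborel)
        = ennreal (?A / cos_integral r * V) * ennreal (norm x powr (r + ?n)) * ennreal (cos_integral r * ?S * ?E / ?n)"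
      unfolding nn_integral_overlap_cball[OF n \<gamma> r] E_const_nn_integral(1)[OF n r] V_def by (simp only: mult.assoc)
    also have "\<dots> = ennreal (?A / cos_integral r * V * norm x powr (r + ?n) * (cos_integral r * ?S * ?E / ?n))"
    proof -
      have "ennreal a * ennreal b * ennreal c = ennreal (a * b * c)" if "a \<ge> 0" "b \<ge> 0" "c \<ge> 0" for a b c
        using that by (simp add: ennreal_mult)
      then show ?thesis using A V E S W by simp
    qed
    also have "?A / cos_integral r * V * norm x powr (r + ?n) * (cos_integral r * ?S * ?E / ?n)
        = ?A * (V * ?S) / ?n * ?E * norm x powr (r + ?n)" using W by simp
    also have "\<dots> = ?A * ?\<kappa> * ?E * norm x powr (r + ?n)" using V(1) n by simp
    also have "ennreal \<dots> = ennreal (?A * ?\<kappa> * ?E) * ennreal (norm x powr (r + ?n))"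
      using A E by (intro ennreal_mult) auto
    finally show ?thesis .
  qed
  have "(\<integral>\<^sup>+x. (\<integral>\<^sup>+y. ennreal (overlap \<gamma> r x y * exp (- B * norm x powr r)) * indicator (cball 0 (norm x)) y \<partial>lborel)
        \<partial>(lborel :: (real^'n) measure))
      = (\<integral>\<^sup>+x. ennreal (?A * ?\<kappa> * ?E) * ennreal (norm x powr (r + ?n) * exp (- B * norm x powr r)) \<partial>(lborel :: (real^'n) measure))"
  proof (rule nn_integral_cong)
    fix x :: "real^'n"
    have "(\<integral>\<^sup>+y. ennreal (overlap \<gamma> r x y * exp (- B * norm x powr r)) * indicator (cball 0 (norm x)) y \<partial>lborel)
        = (\<integral>\<^sup>+y. ennreal (exp (- B * norm x powr r)) * (ennreal (overlap \<gamma> r x y) * indicator (cball 0 (norm x)) y) \<partial>lborel)"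
      by (intro nn_integral_cong) (simp add: ennreal_mult overlap_eq(1)[OF \<gamma> r] mult_ac)
    also have "\<dots> = ennreal (exp (- B * norm x powr r)) * (ennreal (?A * ?\<kappa> * ?E) * ennreal (norm x powr (r + ?n)))"
      using meas by (subst nn_integral_cmult) (auto simp: inner)
    also have "\<dots> = ennreal (?A * ?\<kappa> * ?E) * ennreal (norm x powr (r + ?n) * exp (- B * norm x powr r))"
      by (simp add: ennreal_mult mult_ac)
    finally show "(\<integral>\<^sup>+y. ennreal (overlap \<gamma> r x y * exp (- B * norm x powr r)) * indicator (cball 0 (norm x)) y \<partial>lborel)
        = ennreal (?A * ?\<kappa> * ?E) * ennreal (norm x powr (r + ?n) * exp (- B * norm x powr r))" .
  qed
  also have "\<dots> = ennreal (?A * ?\<kappa> * ?E) * (\<integral>\<^sup>+x. ennreal (norm x powr (r + ?n) * exp (- B * norm x powr r)) \<partial>(lborel :: (real^'n) measure))"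
    by (intro nn_integral_cmult) measurable
  also have "(\<integral>\<^sup>+x. ennreal (norm x powr (r + ?n) * exp (- B * norm x powr r)) \<partial>(lborel :: (real^'n) measure))
      = ennreal (?\<kappa> * (?n / r) * B powr (- (2 * ?n / r + 1)) * Gamma (2 * ?n / r + 1))"
  proof -
    have e: "(?n + (r + ?n)) / r = 2 * ?n / r + 1" "- (?n + (r + ?n)) / r = - (2 * ?n / r + 1)"
      using r by (simp_all add: field_simps)
    have "r + ?n \<ge> 0" using r by simp
    from nn_integral_norm_powr_exp[OF r B this, where 'a = "real^'n"] show ?thesis
      by (simp only: DIM_cart DIM_real mult_1_right e)
  qed
  also have "ennreal (?A * ?\<kappa> * ?E) * \<dots> = ennreal (?A * ?\<kappa> * ?E * (?\<kappa> * (?n / r) * B powr (- (2 * ?n / r + 1)) * Gamma (2 * ?n / r + 1)))"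
  proof (intro ennreal_mult[symmetric])
    have "Gamma (2 * ?n / r + 1) \<ge> 0"
      using r by (intro less_imp_le Gamma_real_pos add_nonneg_pos) auto
    then show "0 \<le> ?\<kappa> * (?n / r) * B powr (- (2 * ?n / r + 1)) * Gamma (2 * ?n / r + 1)"
      using r by (intro mult_nonneg_nonneg) auto
  qed (use A E in simp)
  also have "?A * ?\<kappa> * ?E * (?\<kappa> * (?n / r) * B powr (- (2 * ?n / r + 1)) * Gamma (2 * ?n / r + 1))
      = ?A * ?E * ?\<kappa>\<^sup>2 * ?n / r * B powr (- (2 * ?n / r + 1)) * Gamma (2 * ?n / r + 1)"
    by (simp add: power2_eq_square)
  finally show ?thesis by (simp only:)
qed

section \<open>Covariances and the two-sided bound\<close>

lemma hitting_commute: "hitting \<gamma> r x y = hitting \<gamma> r y x"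
  by (simp add: hitting_def Un_commute)

lemma hitting_mono:
  assumes "\<gamma> > 0" "r > 0"
  shows "hitting \<gamma> r x x \<le> hitting \<gamma> r x y"
proof -
  have "separating x 0 \<union> separating x 0 \<subseteq> separating x 0 \<union> separating y 0" by blast
  then show ?thesis
    unfolding hitting_def
    by (intro measure_mono_fmeasurable)
       (auto simp: fmeasurable_def sets_separating emeasure_hyperplane_intensity_finite[OF assms, unfolded infinity_ennreal_def])
qed

text \<open>For the hyperplane process this is the covariance of the events that \<open>x\<close>
  and that \<open>y\<close> lie in the zero cell.\<close>

definition hitting_covariance :: "real \<Rightarrow> real \<Rightarrow> 'a::euclidean_space \<Rightarrow> 'a \<Rightarrow> real" where
  "hitting_covariance \<gamma> r x y =
     exp (- hitting \<gamma> r x y) - exp (- (hitting \<gamma> r x x + hitting \<gamma> r y y))"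

lemma hitting_covariance_commute: "hitting_covariance \<gamma> r x y = hitting_covariance \<gamma> r y x"
  by (simp add: hitting_covariance_def hitting_commute[of \<gamma> r x y] add.commute)

lemma hitting_covariance_nonneg:
  assumes "\<gamma> > 0" "r > 0"
  shows "hitting_covariance \<gamma> r x y \<ge> 0"
  using overlap_eq(1)[OF assms, of x y] by (simp add: hitting_covariance_def overlap_def)

text \<open>With \<open>u = hitting \<gamma> r x y\<close> below
  \<open>v = hitting \<gamma> r x x + hitting \<gamma> r y y\<close>, the inequality
  \<open>1 + z \<le> exp z\<close> puts \<open>exp (- u) - exp (- v)\<close> between
  \<open>(v - u) * exp (- v)\<close> and \<open>(v - u) * exp (- u)\<close>. For
  \<open>norm y \<le> norm x\<close> the exponent \<open>v\<close> is at most twice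
  \<open>A * norm x powr r\<close>, and by monotonicity \<open>u\<close> is at least that quantity
  once.\<close>

lemma hitting_covariance_bounds:
  fixes x y :: "real^'n"
  assumes \<gamma>: "\<gamma> > 0" and r: "r > 0" and le: "norm y \<le> norm x"
  defines "A \<equiv> capacity TYPE(real^'n) \<gamma> r * sphere_const TYPE(real^'n) r"
  shows "overlap \<gamma> r x y * exp (- (2 * A) * norm x powr r) \<le> hitting_covariance \<gamma> r x y"
    and "hitting_covariance \<gamma> r x y \<le> overlap \<gamma> r x y * exp (- A * norm x powr r)"
proof -
  let ?u = "hitting \<gamma> r x y" and ?v = "hitting \<gamma> r x x + hitting \<gamma> r y y"
  have A: "A \<ge> 0" using \<gamma> r sphere_const_nonneg[OF r, where 'n = 'n] by (simp add: A_def capacity_def)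
  have self: "hitting \<gamma> r z z = A * norm z powr r" for z :: "real^'n"
    unfolding A_def by (rule hitting_self[OF \<gamma> r])
  have q: "overlap \<gamma> r x y = ?v - ?u" "?v - ?u \<ge> 0"
    using overlap_eq(1)[OF \<gamma> r, of x y] by (simp_all add: overlap_def)
  have "norm y powr r \<le> norm x powr r" using le r by (intro powr_mono2) auto
  from mult_left_mono[OF this A] have v: "?v \<le> 2 * A * norm x powr r" by (simp add: self)
  have u: "A * norm x powr r \<le> ?u" using hitting_mono[OF \<gamma> r, of x y] by (simp add: self)
  have "overlap \<gamma> r x y * exp (- (2 * A) * norm x powr r) \<le> (?v - ?u) * exp (- ?v)"
    unfolding q(1) using q(2) v by (intro mult_left_mono) auto
  also have "\<dots> \<le> (exp (?v - ?u) - 1) * exp (- ?v)"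
  proof (rule mult_right_mono)
    show "?v - ?u \<le> exp (?v - ?u) - 1" using exp_ge_add_one_self[of "?v - ?u"] by linarith
  qed simp
  also have "\<dots> = hitting_covariance \<gamma> r x y"
    by (simp add: hitting_covariance_def left_diff_distrib flip: exp_add)
  finally show "overlap \<gamma> r x y * exp (- (2 * A) * norm x powr r) \<le> hitting_covariance \<gamma> r x y" .
  have "hitting_covariance \<gamma> r x y = (1 - exp (- (?v - ?u))) * exp (- ?u)"
    by (simp add: hitting_covariance_def left_diff_distrib flip: exp_add)
  also have "\<dots> \<le> (?v - ?u) * exp (- ?u)"
  proof (rule mult_right_mono)
    show "1 - exp (- (?v - ?u)) \<le> ?v - ?u" using exp_ge_add_one_self[of "- (?v - ?u)"] by linarith
  qed simp
  also have "\<dots> \<le> overlap \<gamma> r x y * exp (- A * norm x powr r)"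
    unfolding q(1) using q(2) u by (intro mult_left_mono) auto
  finally show "hitting_covariance \<gamma> r x y \<le> overlap \<gamma> r x y * exp (- A * norm x powr r)" .
qed

lemma AE_norm_neq: "AE y::'a::euclidean_space in lborel. norm y \<noteq> c"
proof -
  have "sphere (0::'a) c \<in> null_sets lebesgue"
    by (simp add: negligible_sphere flip: negligible_iff_null_sets)
  then have "sphere (0::'a) c \<in> null_sets lborel"
    by (simp add: null_sets_completion_iff)
  then show ?thesis by (rule AE_I') auto
qed

lemma borel_measurable_hitting_covariance:
  fixes f g :: "'b \<Rightarrow> 'a::euclidean_space"
  assumes "\<gamma> > 0" "r > 0" "f \<in> borel_measurable N" "g \<in> borel_measurable N"
  shows "(\<lambda>z. hitting_covariance \<gamma> r (f z) (g z)) \<in> borel_measurable N"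
  unfolding hitting_covariance_def
  by (intro borel_measurable_diff measurable_compose[OF _ borel_measurable_exp] borel_measurable_uminus
      borel_measurable_add borel_measurable_hitting assms)

text \<open>Exchanging the two points carries one half of the domain to the other, except for the
  pairs of equal norm, which are negligible because spheres are null sets.\<close>

lemma nn_integral_hitting_covariance:
  assumes \<gamma>: "\<gamma> > 0" and r: "r > 0"
  shows "(\<integral>\<^sup>+x. (\<integral>\<^sup>+y. ennreal (hitting_covariance \<gamma> r x y) \<partial>(lborel :: 'a::euclidean_space measure)) \<partial>lborel)
    = 2 * (\<integral>\<^sup>+x. (\<integral>\<^sup>+y. ennreal (hitting_covariance \<gamma> r x y) * indicator (cball 0 (norm x)) y \<partial>(lborel :: 'a measure)) \<partial>lborel)"
proof -
  have T [measurable (raw)]: "(\<lambda>z. hitting_covariance \<gamma> r (f z) (g z)) \<in> borel_measurable N"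
    if "f \<in> borel_measurable N" "g \<in> borel_measurable N" for f g :: "'z \<Rightarrow> 'a" and N
    using that by (intro borel_measurable_hitting_covariance \<gamma> r)
  let ?T = "\<lambda>x y :: 'a. ennreal (hitting_covariance \<gamma> r x y)"
  have ind: "indicator (cball 0 (norm x)) y = (if norm y \<le> norm x then 1 else 0 :: ennreal)" for x y :: 'a
    by (simp add: indicator_def)
  have "(\<integral>\<^sup>+x. (\<integral>\<^sup>+y. ?T x y \<partial>lborel) \<partial>lborel)
      = (\<integral>\<^sup>+x. (\<integral>\<^sup>+y. ?T x y * (if norm y \<le> norm x then 1 else 0) \<partial>lborel)
          + (\<integral>\<^sup>+y. ?T x y * (if norm x < norm y then 1 else 0) \<partial>lborel) \<partial>lborel)"
    by (intro nn_integral_cong, subst nn_integral_add[symmetric]) (auto intro!: nn_integral_cong)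
  also have "\<dots> = (\<integral>\<^sup>+x. (\<integral>\<^sup>+y. ?T x y * (if norm y \<le> norm x then 1 else 0) \<partial>lborel) \<partial>lborel)
      + (\<integral>\<^sup>+x. (\<integral>\<^sup>+y. ?T x y * (if norm x < norm y then 1 else 0) \<partial>lborel) \<partial>lborel)"
    by (intro nn_integral_add) measurable
  also have "(\<integral>\<^sup>+x. (\<integral>\<^sup>+y. ?T x y * (if norm x < norm y then 1 else 0) \<partial>lborel) \<partial>lborel)
      = (\<integral>\<^sup>+y. (\<integral>\<^sup>+x. ?T x y * (if norm x < norm y then 1 else 0) \<partial>lborel) \<partial>lborel)"
    by (rule lborel_pair.Fubini') measurable
  also have "\<dots> = (\<integral>\<^sup>+y. (\<integral>\<^sup>+x. ?T y x * (if norm x \<le> norm y then 1 else 0) \<partial>lborel) \<partial>lborel)"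
  proof (rule nn_integral_cong)
    fix y :: 'a
    show "(\<integral>\<^sup>+x. ?T x y * (if norm x < norm y then 1 else 0) \<partial>lborel)
        = (\<integral>\<^sup>+x. ?T y x * (if norm x \<le> norm y then 1 else 0) \<partial>lborel)"
      by (intro nn_integral_cong_AE eventually_mono[OF AE_norm_neq[of "norm y"]])
         (auto simp: hitting_covariance_commute[of \<gamma> r y])
  qed
  finally show ?thesis by (simp add: ind mult_2)
qed

theorem theorem2:
  fixes M :: "'w measure" and X :: "'w \<Rightarrow> (real^'n) set set" and \<gamma> r :: real
  assumes "CARD('n) \<ge> 2" and "\<gamma> > 0" and "r > 0"
    and "poisson_hyperplane_process M \<gamma> r X"
  shows "E_const CARD('n) r * D_const TYPE(real^'n) \<gamma> r
           \<le> prob_space.variance M (\<lambda>\<omega>. measure lborel (zero_cell (X \<omega>)))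
         \<and> prob_space.variance M (\<lambda>\<omega>. measure lborel (zero_cell (X \<omega>)))
           \<le> E_const CARD('n) r * D_const TYPE(real^'n) \<gamma> r * 4 powr (2 * real CARD('n) / r + 1)"
proof -
  note n = assms(1) and \<gamma> = assms(2) and r = assms(3)
  let ?L = "lborel :: (real^'n) measure"
  define A where "A = capacity TYPE(real^'n) \<gamma> r * sphere_const TYPE(real^'n) r"
  define p where "p = 2 * real CARD('n) / r"
  define \<kappa> where "\<kappa> = unit_ball_vol (real CARD('n))"
  define E where "E = E_const CARD('n) r"
  \<comment> \<open>The factors common to both bounds and to the product of E and D; what remains
    are powers of \<open>A\<close> and \<open>2 * A\<close>.\<close>
  define Q where "Q = E * \<kappa>\<^sup>2 * real CARD('n) / r * Gamma (p + 1)"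
  have c: "sphere_const TYPE(real^'n) r > 0" by (rule sphere_const_pos[OF n r])
  have \<kappa>: "\<kappa> > 0" unfolding \<kappa>_def by (rule unit_ball_vol_pos) simp
  have A: "A > 0" using \<gamma> r c n \<kappa> by (simp add: A_def capacity_def \<kappa>_def)
  have p: "p > 0" using r n by (simp add: p_def)
  have E: "E \<ge> 0" unfolding E_def by (rule E_const_nn_integral(2)[OF n r])
  have Q: "Q \<ge> 0" using E r p by (auto simp: Q_def intro!: mult_nonneg_nonneg Gamma_real_nonneg)
  have T [measurable (raw)]: "(\<lambda>z. hitting_covariance \<gamma> r (f z) (g z)) \<in> borel_measurable N"
    if "f \<in> borel_measurable N" "g \<in> borel_measurable N" for f g :: "'z \<Rightarrow> real^'n" and N
    using that by (intro borel_measurable_hitting_covariance \<gamma> r)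
  have H [measurable (raw)]: "(\<lambda>z. hitting \<gamma> r (f z) (g z)) \<in> borel_measurable N"
    if "f \<in> borel_measurable N" "g \<in> borel_measurable N" for f g :: "'z \<Rightarrow> real^'n" and N
    using that by (intro borel_measurable_hitting \<gamma> r)
  let ?G = "\<integral>\<^sup>+x. (\<integral>\<^sup>+y. ennreal (hitting_covariance \<gamma> r x y) * indicator (cball 0 (norm x)) y \<partial>?L) \<partial>?L"
  let ?O = "\<lambda>B. \<integral>\<^sup>+x. (\<integral>\<^sup>+y. ennreal (overlap \<gamma> r x y * exp (- B * norm x powr r)) * indicator (cball 0 (norm x)) y \<partial>?L) \<partial>?L"
  have O: "?O B = ennreal (A * Q * B powr (- (p + 1)))" if "B > 0" for B
    unfolding nn_integral_overlap_exp[OF n \<gamma> r that]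
    by (simp add: A_def Q_def p_def \<kappa>_def E_def mult_ac)
  have lower: "?O (2 * A) \<le> ?G"
    using hitting_covariance_bounds(1)[OF \<gamma> r, where 'n = 'n, folded A_def]
    by (intro nn_integral_mono) (auto simp: indicator_def intro!: ennreal_leI)
  have upper: "?G \<le> ?O A"
    using hitting_covariance_bounds(2)[OF \<gamma> r, where 'n = 'n, folded A_def]
    by (intro nn_integral_mono) (auto simp: indicator_def intro!: ennreal_leI)
  then have "?G < \<infinity>" unfolding O[OF A] by (rule le_less_trans) simp
  then obtain g where g: "?G = ennreal g" "g \<ge> 0" by (cases ?G) auto
  have A2: "2 * A > 0" using A by simp
  have gl: "A * Q * (2 * A) powr (- (p + 1)) \<le> g"
    using lower g(2) unfolding O[OF A2] g(1) by (subst (asm) ennreal_le_iff)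
  have gu: "g \<le> A * Q * A powr (- (p + 1))"
    using upper A Q unfolding O[OF A] g(1) by (subst (asm) ennreal_le_iff) auto
  have self: "hitting \<gamma> r x x = A * norm x powr r" for x :: "real^'n"
    unfolding A_def by (rule hitting_self[OF \<gamma> r])
  obtain a where a: "(\<integral>\<^sup>+x. ennreal (exp (- hitting \<gamma> r x x)) \<partial>?L) = ennreal a" "a \<ge> 0"
  proof -
    \<comment> \<open>The factor \<open>norm x powr 0\<close> is 0 instead of 1 at the origin, hence
      the equality holds by an almost everywhere argument.\<close>
    have "(\<integral>\<^sup>+x. ennreal (exp (- hitting \<gamma> r x x)) \<partial>?L)
        = (\<integral>\<^sup>+x. ennreal (norm x powr 0 * exp (- A * norm x powr r)) \<partial>?L)"
      by (intro nn_integral_cong_AE eventually_mono[OF AE_lborel_singleton[of 0]]) (auto simp: self)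
    then have "(\<integral>\<^sup>+x. ennreal (exp (- hitting \<gamma> r x x)) \<partial>?L) < \<infinity>"
      using nn_integral_norm_powr_exp[OF r A, of 0, where 'a = "real^'n"] by simp
    then show thesis by (intro that[of "enn2real (\<integral>\<^sup>+x. ennreal (exp (- hitting \<gamma> r x x)) \<partial>?L)"]) auto
  qed
  \<comment> \<open>Independence would give the product \<open>exp (- hitting \<gamma> r x x) * exp
    (- hitting \<gamma> r y y)\<close>, whose double integral is the square of the mean; the
    covariance is added to it rather than obtained by subtraction, to stay in
    \<open>ennreal\<close>.\<close>
  have b: "(\<integral>\<^sup>+x. (\<integral>\<^sup>+y. ennreal (exp (- hitting \<gamma> r x y)) \<partial>?L) \<partial>?L) = ennreal (a\<^sup>2 + 2 * g)"
  proof -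
    have "(\<integral>\<^sup>+x. (\<integral>\<^sup>+y. ennreal (exp (- hitting \<gamma> r x y)) \<partial>?L) \<partial>?L)
        = (\<integral>\<^sup>+x. (ennreal (exp (- hitting \<gamma> r x x)) * ennreal a
            + (\<integral>\<^sup>+y. ennreal (hitting_covariance \<gamma> r x y) \<partial>?L)) \<partial>?L)"
    proof (rule nn_integral_cong)
      fix x :: "real^'n"
      have "(\<integral>\<^sup>+y. ennreal (exp (- hitting \<gamma> r x y)) \<partial>?L)
          = (\<integral>\<^sup>+y. (ennreal (exp (- hitting \<gamma> r x x)) * ennreal (exp (- hitting \<gamma> r y y))
              + ennreal (hitting_covariance \<gamma> r x y)) \<partial>?L)"
      proof (rule nn_integral_cong)
        fix y :: "real^'n"
        have "exp (- hitting \<gamma> r x y) = exp (- hitting \<gamma> r x x) * exp (- hitting \<gamma> r y y) + hitting_covariance \<gamma> r x y"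
          by (simp add: hitting_covariance_def flip: exp_add)
        then show "ennreal (exp (- hitting \<gamma> r x y)) = ennreal (exp (- hitting \<gamma> r x x)) * ennreal (exp (- hitting \<gamma> r y y))
              + ennreal (hitting_covariance \<gamma> r x y)"
          using hitting_covariance_nonneg[OF \<gamma> r, of x y] by (simp add: ennreal_mult)
      qed
      also have "\<dots> = (\<integral>\<^sup>+y. ennreal (exp (- hitting \<gamma> r x x)) * ennreal (exp (- hitting \<gamma> r y y)) \<partial>?L)
          + (\<integral>\<^sup>+y. ennreal (hitting_covariance \<gamma> r x y) \<partial>?L)"
        by (intro nn_integral_add) measurable
      also have "(\<integral>\<^sup>+y. ennreal (exp (- hitting \<gamma> r x x)) * ennreal (exp (- hitting \<gamma> r y y)) \<partial>?L)
          = ennreal (exp (- hitting \<gamma> r x x)) * ennreal a"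
        unfolding a(1)[symmetric] by (intro nn_integral_cmult) measurable
      finally show "(\<integral>\<^sup>+y. ennreal (exp (- hitting \<gamma> r x y)) \<partial>?L)
          = ennreal (exp (- hitting \<gamma> r x x)) * ennreal a + (\<integral>\<^sup>+y. ennreal (hitting_covariance \<gamma> r x y) \<partial>?L)" .
    qed
    also have "\<dots> = (\<integral>\<^sup>+x. ennreal (exp (- hitting \<gamma> r x x)) * ennreal a \<partial>?L)
        + (\<integral>\<^sup>+x. (\<integral>\<^sup>+y. ennreal (hitting_covariance \<gamma> r x y) \<partial>?L) \<partial>?L)"
      by (intro nn_integral_add) measurable
    also have "(\<integral>\<^sup>+x. ennreal (exp (- hitting \<gamma> r x x)) * ennreal a \<partial>?L) = ennreal a * ennreal a"
      unfolding a(1)[symmetric] by (intro nn_integral_multc) measurable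
    also have "(\<integral>\<^sup>+x. (\<integral>\<^sup>+y. ennreal (hitting_covariance \<gamma> r x y) \<partial>?L) \<partial>?L) = 2 * ennreal g"
      unfolding nn_integral_hitting_covariance[OF \<gamma> r] g(1) ..
    also have "ennreal a * ennreal a + 2 * ennreal g = ennreal (a\<^sup>2 + 2 * g)"
      using a(2) g(2) by (simp add: power2_eq_square ennreal_mult)
    finally show ?thesis .
  qed
  have var: "prob_space.variance M (\<lambda>\<omega>. measure lborel (zero_cell (X \<omega>))) = 2 * g"
    using variance_zero_cell[OF \<gamma> r assms(4) a b] g(2) by simp
  \<comment> \<open>The 4 in the base of D consists of the 2 in the normalisation of the intensity
    and the 2 of the exponent \<open>2 * A\<close>. This makes the product of E and D exactly twice
    the lower bound for \<open>g\<close>, as \<open>low\<close> records.\<close>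
  have ratio: "real CARD('n) * \<kappa> * r / (4 * \<gamma> * sphere_const TYPE(real^'n) r) = inverse (2 * A)"
    using \<gamma> r c n \<kappa> by (simp add: A_def capacity_def \<kappa>_def field_simps)
  have "D_const TYPE(real^'n) \<gamma> r = real CARD('n) * \<kappa>\<^sup>2 / r * Gamma (p + 1) * inverse (2 * A) powr p"
    by (simp only: D_const_def Let_def DIM_cart DIM_real mult_1_right \<kappa>_def[symmetric] p_def[symmetric] ratio)
  also have "inverse (2 * A) powr p = (2 * A) powr (- p)"
    unfolding powr_minus by (rule inverse_powr)
  finally have ED: "E_const CARD('n) r * D_const TYPE(real^'n) \<gamma> r = Q * (2 * A) powr (- p)"
    by (simp add: Q_def E_def)
  have low: "2 * (A * Q * (2 * A) powr (- (p + 1))) = Q * (2 * A) powr (- p)"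
  proof -
    have "(2 * A) powr (- p) = (2 * A) powr (1 + - (p + 1))" by simp
    also have "\<dots> = (2 * A) * (2 * A) powr (- (p + 1))"
      using A by (subst powr_add) simp
    finally show ?thesis by simp
  qed
  \<comment> \<open>In \<open>low\<close> the 2 for the two halves of the domain is used up by the
    additional power of \<open>2 * A\<close>; here it remains, together with \<open>2 powr p\<close>
    from replacing \<open>2 * A\<close> by \<open>A\<close>.\<close>
  have up: "2 * (A * Q * A powr (- (p + 1))) = Q * (2 * A) powr (- p) * 2 powr (p + 1)"
  proof -
    have "A * A powr (- (p + 1)) = A powr (1 + - (p + 1))" using A by (subst powr_add) simp
    moreover have "(2 * A) powr (- p) * 2 powr (p + 1) = 2 * A powr (- p)"
      by (simp add: powr_mult powr_add powr_minus)
    ultimately show ?thesis by (simp add: mult_ac)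
  qed
  \<comment> \<open>The estimates give the upper bound with base 2; base 4 follows because
    \<open>p + 1\<close> is positive.\<close>
  have "Q * (2 * A) powr (- p) * 2 powr (p + 1) \<le> Q * (2 * A) powr (- p) * 4 powr (p + 1)"
    using Q p by (intro mult_left_mono powr_mono2) auto
  then show ?thesis
    unfolding var ED p_def[symmetric] using gl gu low up by linarith
qed

end
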